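(* Let $q\ge2$ be an integer and $k$ a positive integer. Assume the Generalized Riemann Hypothesis. Then for every $\varepsilon>0$, \[\sum_{\substack{\chi\bmod q\\ \chi\neq\chi_0}}\frac{1}{|L(1,\chi)|^{2k}}=C(k)\,\varphi(q)\prod_{p\mid q}\left(1+\frac{\binom{k}{1}^2}{p^2}+\dots+\frac{\binom{k}{k}^2}{p^{2k}}\right)^{-1}\left(1+O\!\left(q^{-1+\varepsilon}\right)\right),\] where the sum runs over all non-principal Dirichlet characters modulo $q$ and \[C(k)=\prod_p\left(1+\frac{\binom{k}{1}^2}{p^2}+\dots+\frac{\binom{k}{k}^2}{p^{2k}}\right),\] the products being over primes $p$.
   Context: $\chi_0$ is the principal character modulo $q$, $L(s,\chi)$ the Dirichlet $L$-function, $\varphi$ Euler's totient function. GRH asserts all nontrivial zeros of all Dirichlet $L$-functions have real part $1/2$. The implied constant may depend on $k$ and $\varepsilon$. *)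

theory Defs
  imports "HOL-Analysis.Analysis" "HOL-Number_Theory.Number_Theory"
begin

definition dcharacter :: "nat \<Rightarrow> (nat \<Rightarrow> complex) \<Rightarrow> bool" where
  "dcharacter q chi \<longleftrightarrow>
     (\<forall>n. chi (n + q) = chi n) \<and>
     (\<forall>m n. chi (m * n) = chi m * chi n) \<and>
     chi 1 = 1 \<and>
     (\<forall>n. chi n = 0 \<longleftrightarrow> \<not> coprime n q)"

definition principal_char :: "nat \<Rightarrow> nat \<Rightarrow> complex" where
  "principal_char q n = (if coprime n q then 1 else 0)"

text \<open>Dirichlet eta function (alternating zeta series), convergent for Re s > 0.\<close>
definition eta_fun :: "complex \<Rightarrow> complex" where
  "eta_fun s = lim (\<lambda>N. \<Sum>n=1..N. (-1) ^ (n + 1) * of_nat n powr (-s))"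

text \<open>Riemann zeta function in the half plane Re s > 0 (s not a zero of 1 - 2^(1-s)),
  via analytic continuation zeta(s) = eta(s) / (1 - 2^(1-s)).\<close>
definition zeta_fun :: "complex \<Rightarrow> complex" where
  "zeta_fun s = eta_fun s / (1 - 2 powr (1 - s))"

text \<open>Dirichlet L-function L(s,chi) for Re s > 0 (and s \<noteq> 1 when chi is principal).
  For non-principal chi it is the (convergent) Dirichlet series; for the principal
  character mod q it is zeta(s) times the Euler factors at primes dividing q.\<close>
definition dirichlet_L :: "nat \<Rightarrow> (nat \<Rightarrow> complex) \<Rightarrow> complex \<Rightarrow> complex" where
  "dirichlet_L q chi s =
     (if chi = principal_char q
      then (\<Prod>p\<in>prime_factors q. 1 - of_nat p powr (-s)) * zeta_fun s
      else lim (\<lambda>N. \<Sum>n=1..N. chi n * of_nat n powr (-s)))"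

definition GRH :: bool where
  "GRH \<longleftrightarrow> (\<forall>q chi s. q \<ge> 1 \<longrightarrow> dcharacter q chi \<longrightarrow> 0 < Re s \<longrightarrow> Re s < 1 \<longrightarrow>
              dirichlet_L q chi s = 0 \<longrightarrow> Re s = 1 / 2)"

definition local_factor :: "nat \<Rightarrow> nat \<Rightarrow> real" where
  "local_factor k p = (\<Sum>j=0..k. real (k choose j) ^ 2 / real p ^ (2 * j))"

definition C_const :: "nat \<Rightarrow> real" where
  "C_const k = prodinf (\<lambda>n. if prime n then local_factor k n else 1)"

end

theory Submission
  imports Defs "HOL-Complex_Analysis.Complex_Analysis"
begin

text \<open>
  Under GRH, \<open>F(s) = L(s, \<chi>)\<^sup>-\<^sup>k\<close> is holomorphic on the disc of radius \<open>3/2\<close> about \<open>2\<close> (on the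
  line \<open>Re s = 1\<close> the function \<open>L\<close> has no zeros by Landau's argument), and the
  Borel-Caratheodory inequality bounds it there by a power of \<open>q\<close>. Since \<open>1\<close> lies inside this disc,
  the Taylor series of \<open>F\<close> at \<open>2\<close>, cut off after \<open>J\<close> of order \<open>log q\<close> terms, gives \<open>F(1)\<close> up to \<open>O(1/q)\<close>.
  The Taylor coefficients come from the Dirichlet series of \<open>F\<close>, so the cut-off series is
  \<open>\<Sum> a(n) \<chi>(n) w(n)/n\<close>, where \<open>w(n)\<close> is the probability that a Poisson variable of mean
  \<open>log n\<close> is at most \<open>J\<close>. By orthogonality of characters the mean square of these sums over \<open>\<chi>\<close> is the
  diagonal \<open>\<Sum> a(n)\<^sup>2/n\<^sup>2\<close> over \<open>n\<close> coprime to \<open>q\<close>, which is the Euler product of the theorem; Chernoff bounds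
  for \<open>w\<close> control the truncation and the off-diagonal terms.
\<close>

section \<open>Orthogonality of Dirichlet characters\<close>

text \<open>The point 1 lies on the boundary of absolute convergence of the series for F, so that
  series cannot simply be squared and summed over the characters. The weights w(n) restore absolute
  convergence, at a price: for z < 1 they gain a factor n^(z-1) but lose (1/z)^J, whereas the Taylor
  tail needs J large. Two facts reconcile the demands. The tail decays geometrically, since F is
  controlled up to distance 5/4 > 1 from the centre, so J = A log q suffices with A depending on k
  alone; and z may then be taken so close to 1 that (1/z)^J is only about q^(eps/4). Orthogonality
  concerns all characters, so the principal one is added artificially. Its sum is estimated by
  absolute values, and the square of that estimate, about q^(eps/2), set against a main term of
  order phi(q) already produces an error of the shape q^(-1+eps). The off-diagonal pairs m, n differ
  by at least q and lose almost a full power of q for the same reason.\<close>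

lemma dcharacter_mod: "dcharacter q chi \<Longrightarrow> chi (n mod q) = chi n"
proof -
  assume d: "dcharacter q chi"
  have "chi (r + k * q) = chi r" for r k
  proof (induction k)
    case (Suc k)
    have "r + Suc k * q = (r + k * q) + q" by simp
    thus ?case using d Suc unfolding dcharacter_def by metis
  qed auto
  from this [of "n mod q" "n div q"] show ?thesis by simp
qed

lemma dcharacter_cong: "dcharacter q chi \<Longrightarrow> [m = n] (mod q) \<Longrightarrow> chi m = chi n"
  by (metis dcharacter_mod cong_def)

lemma dcharacter_power: "dcharacter q chi \<Longrightarrow> chi (n ^ i) = chi n ^ i"
  by (induction i) (auto simp: dcharacter_def)

lemma dcharacter_pow_totient:
  assumes "dcharacter q chi" "coprime n q"
  shows "chi n ^ totient q = 1"
proof -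
  have "chi n ^ totient q = chi 1"
    using assms euler_theorem[of n q] by (metis dcharacter_power dcharacter_cong)
  thus ?thesis using assms by (simp add: dcharacter_def)
qed

lemma norm_dcharacter:
  assumes "dcharacter q chi" "q > 0"
  shows "norm (chi n) = (if coprime n q then 1 else 0)"
proof (cases "coprime n q")
  case True
  have "norm (chi n) ^ totient q = 1"
    using dcharacter_pow_totient[OF assms(1) True] by (metis norm_power norm_one)
  moreover have "totient q > 0" using assms(2) by simp
  ultimately have "norm (chi n) = 1"
    by (metis norm_ge_zero power_eq_1_iff neq0_conv real_norm_def abs_of_nonneg)
  thus ?thesis using True by simp
next
  case False
  thus ?thesis using assms by (simp add: dcharacter_def)
qed

lemma norm_dcharacter_le: "dcharacter q chi \<Longrightarrow> q > 0 \<Longrightarrow> norm (chi n) \<le> 1"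
  by (simp add: norm_dcharacter)

lemma coprime_add_self: "coprime (n + q) q \<longleftrightarrow> coprime n (q::nat)"
  unfolding coprime_iff_gcd_eq_1 by (rule arg_cong[of _ _ "\<lambda>x. x = 1"]) (rule gcd_add1)

lemma dcharacter_principal: "q > 0 \<Longrightarrow> dcharacter q (principal_char q)"
  unfolding dcharacter_def principal_char_def by (auto simp: coprime_add_self)

lemma dcharacter_cnj: "dcharacter q chi \<Longrightarrow> dcharacter q (\<lambda>n. cnj (chi n))"
  unfolding dcharacter_def by auto

lemma dcharacter_mult:
  "dcharacter q chi \<Longrightarrow> dcharacter q psi \<Longrightarrow> dcharacter q (\<lambda>n. chi n * psi n)"
  unfolding dcharacter_def by auto

lemma dcharacter_cnj_mult:
  assumes "dcharacter q chi" "q > 0"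
  shows "cnj (chi n) * chi n = (if coprime n q then 1 else 0)"
proof -
  have "cnj (chi n) * chi n = of_real ((norm (chi n))\<^sup>2)"
    by (simp only: complex_norm_square mult.commute)
  thus ?thesis using norm_dcharacter[OF assms, of n] by simp
qed

text \<open>Periodicity reduces a character to its values below \<open>q\<close>, each of which is 0
  or a \<open>totient q\<close>-th root of unity. Finiteness matters for the meaning of later sums:
  \<open>sum\<close> over an infinite set is 0 by default.\<close>

lemma finite_dcharacter:
  assumes "q > 0"
  shows "finite {chi. dcharacter q chi}"
proof -
  define R where "R = insert 0 {z::complex. z ^ totient q = 1}"
  have "finite R"
    unfolding R_def using assms finite_roots_unity[of "totient q"] by (simp add: Suc_le_eq)
  hence fin: "finite (PiE {..<q} (\<lambda>_. R))" by (intro finite_PiE) auto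
  have "inj_on (\<lambda>chi. restrict chi {..<q}) {chi. dcharacter q chi}"
  proof (rule inj_onI, rule ext)
    fix chi psi n
    assume *: "chi \<in> {chi. dcharacter q chi}" "psi \<in> {chi. dcharacter q chi}"
      "restrict chi {..<q} = restrict psi {..<q}"
    have "n mod q < q" using assms by simp
    hence "chi (n mod q) = psi (n mod q)"
      using fun_cong[OF *(3), of "n mod q"] by simp
    thus "chi n = psi n" using * by (simp add: dcharacter_mod)
  qed
  moreover have "(\<lambda>chi. restrict chi {..<q}) ` {chi. dcharacter q chi} \<subseteq> PiE {..<q} (\<lambda>_. R)"
  proof (rule image_subsetI)
    fix chi assume "chi \<in> {chi. dcharacter q chi}"
    hence chi: "dcharacter q chi" by simp
    have "chi n \<in> R" for n
      using dcharacter_pow_totient[OF chi, of n] norm_dcharacter[OF chi assms, of n]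
      by (cases "coprime n q") (simp_all add: R_def)
    thus "restrict chi {..<q} \<in> PiE {..<q} (\<lambda>_. R)" by auto
  qed
  ultimately show ?thesis using fin by (rule inj_on_finite)
qed

text \<open>A complex character of a subgroup of the units modulo \<open>q\<close>. The subgroup is
  a set of naturals closed under congruence, so that no quotient group is formed; inverses are
  powers with exponent \<open>totient q - 1\<close>.\<close>

definition partial_char :: "nat \<Rightarrow> nat set \<Rightarrow> (nat \<Rightarrow> complex) \<Rightarrow> bool" where
  "partial_char q H f \<longleftrightarrow>
     (\<forall>n\<in>H. coprime n q) \<and> 1 \<in> H \<and> (\<forall>m\<in>H. \<forall>n\<in>H. m * n \<in> H) \<and>
     (\<forall>m\<in>H. \<forall>n. [m = n] (mod q) \<longrightarrow> n \<in> H \<and> f m = f n) \<and>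
     f 1 = 1 \<and> (\<forall>m\<in>H. \<forall>n\<in>H. f (m * n) = f m * f n)"

lemma partial_char_power:
  assumes "partial_char q H f" "n \<in> H"
  shows "n ^ i \<in> H" "f (n ^ i) = f n ^ i"
  using assms by (induction i) (auto simp: partial_char_def)

lemma partial_char_cancel:
  assumes "q > 0" and f: "partial_char q H f" and a: "a \<in> H" and ab: "a * b \<in> H"
  shows "b \<in> H"
proof -
  have cop: "coprime a q" using f a by (auto simp: partial_char_def)
  have tq: "totient q > 0" using assms by simp
  have "[a ^ totient q * b = 1 * b] (mod q)"
    by (intro cong_mult euler_theorem cop) auto
  moreover have "a ^ totient q * b = a ^ (totient q - 1) * (a * b)"
    using tq by (metis mult.assoc power_minus_mult)
  moreover have "a ^ (totient q - 1) * (a * b) \<in> H"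
    using f partial_char_power[OF f a] ab by (auto simp: partial_char_def)
  ultimately show ?thesis using f by (auto simp: partial_char_def)
qed

text \<open>Here \<open>m\<close> is the order of \<open>g\<close> relative to \<open>H\<close>, and
  \<open>z ^ m = f (g ^ m)\<close> is the only constraint on the new value \<open>z\<close>. Leaving
  \<open>z\<close> free is what later permits a value different from 1.\<close>

lemma partial_char_extend:
  fixes g q :: nat
  assumes q: "q > 0" and f: "partial_char q H f" and g: "coprime g q"
  defines "m \<equiv> (LEAST m. m > 0 \<and> g ^ m \<in> H)"
  assumes z: "z ^ m = f (g ^ m)"
  shows "\<exists>H' f'. partial_char q H' f' \<and> H \<subseteq> H' \<and> g \<in> H' \<and> (\<forall>n\<in>H. f' n = f n) \<and> f' g = z"
proof -
  have H1: "1 \<in> H" and Hcop: "\<And>n. n \<in> H \<Longrightarrow> coprime n q"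
    and Hmult: "\<And>a b. a \<in> H \<Longrightarrow> b \<in> H \<Longrightarrow> a * b \<in> H"
    and Hcong: "\<And>a b. a \<in> H \<Longrightarrow> [a = b] (mod q) \<Longrightarrow> b \<in> H"
    and fcong: "\<And>a b. a \<in> H \<Longrightarrow> [a = b] (mod q) \<Longrightarrow> f a = f b"
    and f1: "f 1 = 1" and fmult: "\<And>a b. a \<in> H \<Longrightarrow> b \<in> H \<Longrightarrow> f (a * b) = f a * f b"
    using f by (auto simp: partial_char_def)
  have "g ^ totient q \<in> H"
    using Hcong[OF H1] euler_theorem[OF g] cong_sym by blast
  hence ex: "totient q > 0 \<and> g ^ totient q \<in> H" using q by simp
  have m: "m > 0" "g ^ m \<in> H"
    using LeastI[of "\<lambda>m. m > 0 \<and> g ^ m \<in> H", OF ex] by (auto simp: m_def)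
  have least: "i \<ge> m" if "i > 0" "g ^ i \<in> H" for i
    using that unfolding m_def by (intro Least_le) auto
  \<comment> \<open>Division with remainder: a positive remainder \<open>d mod m\<close> with
    \<open>g ^ (d mod m)\<close> in \<open>H\<close> would contradict the minimality of
    \<open>m\<close>.\<close>
  have fpow: "f (g ^ d) = z ^ d" if d: "g ^ d \<in> H" for d
  proof -
    have eq: "g ^ d = (g ^ m) ^ (d div m) * g ^ (d mod m)"
      by (metis div_mult_mod_eq mult.commute power_add power_mult)
    have "g ^ (d mod m) \<in> H"
      using partial_char_cancel[OF q f] partial_char_power(1)[OF f m(2)] d eq by metis
    hence "d mod m = 0" using least[of "d mod m"] m(1) by (meson linorder_not_less mod_less_divisor neq0_conv)
    hence "g ^ d = (g ^ m) ^ (d div m)" "z ^ d = (z ^ m) ^ (d div m)"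
      using eq by (simp, metis \<open>d mod m = 0\<close> div_mult_mod_eq mult.commute power_mult add.right_neutral)
    thus ?thesis using partial_char_power(2)[OF f m(2)] z by simp
  qed
  \<comment> \<open>Ordering the exponents lets the common power of \<open>g\<close> be cancelled,
    so the argument avoids negative exponents.\<close>
  have wd0: "f h * z ^ i = f h' * z ^ i'"
    if h: "h \<in> H" "h' \<in> H" and c: "[h * g ^ i = h' * g ^ i'] (mod q)" and le: "i \<le> i'" for h h' i i'
  proof -
    define d where "d = i' - i"
    have i': "i' = d + i" using le by (simp add: d_def)
    have "[h * g ^ i = (h' * g ^ d) * g ^ i] (mod q)"
      using c by (simp add: i' power_add mult.assoc)
    hence c': "[h = h' * g ^ d] (mod q)"
      using g by (subst (asm) cong_mult_rcancel_nat) (auto simp: coprime_commute)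
    hence hd: "h' * g ^ d \<in> H" using Hcong h by blast
    hence gd: "g ^ d \<in> H" using partial_char_cancel[OF q f h(2)] by blast
    have "f h = f (h' * g ^ d)" using fcong h c' by blast
    also have "\<dots> = f h' * z ^ d" using fmult h gd fpow by simp
    finally show ?thesis by (simp add: i' power_add)
  qed
  have wd: "f h * z ^ i = f h' * z ^ i'"
    if "h \<in> H" "h' \<in> H" "[h * g ^ i = h' * g ^ i'] (mod q)" for h h' i i'
    using wd0[of h h' i i'] wd0[of h' h i' i] that by (metis cong_sym nle_le)
  define H' where "H' = {n. \<exists>h\<in>H. \<exists>i. [h * g ^ i = n] (mod q)}"
  \<comment> \<open>By \<open>wd\<close>, the value does not depend on the representation that
    \<open>SOME\<close> picks.\<close>
  define f' where "f' n = (SOME v. \<exists>h\<in>H. \<exists>i. [h * g ^ i = n] (mod q) \<and> v = f h * z ^ i)" for n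
  have f'eq: "f' n = f h * z ^ i" if "h \<in> H" "[h * g ^ i = n] (mod q)" for n h i
  proof -
    have "\<exists>v. \<exists>h\<in>H. \<exists>i. [h * g ^ i = n] (mod q) \<and> v = f h * z ^ i" using that by blast
    from someI_ex[OF this] obtain h' i' where "h' \<in> H" "[h' * g ^ i' = n] (mod q)" "f' n = f h' * z ^ i'"
      unfolding f'_def by blast
    thus ?thesis using wd[of h h' i i'] that by (metis cong_sym cong_trans)
  qed
  have "partial_char q H' f'"
    unfolding partial_char_def
  proof (intro conjI ballI allI impI)
    fix n assume "n \<in> H'"
    then obtain h i where hi: "h \<in> H" "[h * g ^ i = n] (mod q)" by (auto simp: H'_def)
    have "coprime (h * g ^ i) q" using Hcop hi g by auto
    thus "coprime n q" using hi(2) cong_imp_coprime by blast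
  next
    show "1 \<in> H'" unfolding H'_def using H1 by (auto intro!: bexI[of _ 1] exI[of _ 0])
  next
    show "f' 1 = 1" using f'eq[of 1 0 1] H1 f1 by simp
  next
    fix a b assume "a \<in> H'" "b \<in> H'"
    then obtain h i h' i' where hi: "h \<in> H" "[h * g ^ i = a] (mod q)" "h' \<in> H" "[h' * g ^ i' = b] (mod q)"
      by (auto simp: H'_def)
    have c: "[(h * h') * g ^ (i + i') = a * b] (mod q)"
      using cong_mult[OF hi(2) hi(4)] by (simp add: power_add mult_ac)
    show "a * b \<in> H'" unfolding H'_def using c Hmult hi by blast
    show "f' (a * b) = f' a * f' b"
      using f'eq[OF _ c] f'eq[OF hi(1,2)] f'eq[OF hi(3,4)] Hmult hi fmult by (simp add: power_add)
  next
    fix a b assume "a \<in> H'" and ab: "[a = b] (mod q)"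
    then obtain h i where hi: "h \<in> H" "[h * g ^ i = a] (mod q)" by (auto simp: H'_def)
    have hb: "[h * g ^ i = b] (mod q)" using hi ab cong_trans by blast
    show "b \<in> H'" using hi hb by (auto simp: H'_def)
    show "f' a = f' b" using f'eq[OF hi] f'eq[OF hi(1) hb] by simp
  qed
  moreover have "H \<subseteq> H'"
  proof
    fix h assume "h \<in> H"
    thus "h \<in> H'" unfolding H'_def by (auto intro!: bexI[of _ h] exI[of _ 0])
  qed
  moreover have "g \<in> H'" unfolding H'_def using H1 by (auto intro!: bexI[of _ 1] exI[of _ 1])
  moreover have "f' n = f n" if "n \<in> H" for n using f'eq[of n 0 n] that by simp
  moreover have "f' g = z" using f'eq[of 1 1 g] H1 f1 by simp
  ultimately show ?thesis by blast
qed

text \<open>Adjoining a unit outside \<open>H\<close> strictly decreases the number of reduced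
  residues missing from \<open>H\<close>; when none is missing, extension by 0 gives a Dirichlet
  character.\<close>

lemma partial_char_extend_full:
  assumes q: "q > 0" and f: "partial_char q H f"
  shows "\<exists>chi. dcharacter q chi \<and> (\<forall>n\<in>H. chi n = f n)"
  using f
proof (induction "card ({n. coprime n q} \<inter> {..<q} - H)" arbitrary: H f rule: less_induct)
  case less
  note f = \<open>partial_char q H f\<close>
  show ?case
  proof (cases "{n. coprime n q} \<subseteq> H")
    case True
    hence H: "H = {n. coprime n q}" using f by (auto simp: partial_char_def)
    have nz: "f n \<noteq> 0" if "coprime n q" for n
    proof
      assume "f n = 0"
      hence "f (n ^ totient q) = 0"
        using partial_char_power[OF f, of n] that H q by simp
      moreover have "f (n ^ totient q) = f 1"
        using f euler_theorem[OF that] H that unfolding partial_char_def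
        by (metis mem_Collect_eq coprime_power_left_iff)
      ultimately show False using f by (simp add: partial_char_def)
    qed
    define chi where "chi n = (if coprime n q then f n else 0)" for n
    have "dcharacter q chi"
      unfolding dcharacter_def
    proof (intro conjI allI)
      fix n
      have "coprime (n + q) q \<longleftrightarrow> coprime n q" by (rule coprime_add_self)
      moreover have "[n = n + q] (mod q)" by (simp add: cong_def)
      ultimately show "chi (n + q) = chi n"
        using f H unfolding chi_def partial_char_def by (metis mem_Collect_eq)
    qed (use f H nz in \<open>auto simp: chi_def partial_char_def\<close>)
    thus ?thesis using H by (intro exI[of _ chi]) (auto simp: chi_def)
  next
    case False
    then obtain g where g: "coprime g q" "g \<notin> H" by auto
    define m where "m = (LEAST m. m > 0 \<and> g ^ m \<in> H)"
    have "[1 = g ^ totient q] (mod q)" using euler_theorem[OF g(1)] cong_sym by blast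
    hence "g ^ totient q \<in> H"
      using f unfolding partial_char_def by blast
    hence ex: "totient q > 0 \<and> g ^ totient q \<in> H" using q by simp
    have m: "m > 0" 
      using LeastI[of "\<lambda>m. m > 0 \<and> g ^ m \<in> H", OF ex] by (auto simp: m_def)
    obtain z where z: "z ^ m = f (g ^ m)"
      using exists_complex_root[of m "f (g ^ m)"] m by (metis neq0_conv)
    obtain H' f' where *: "partial_char q H' f'" "H \<subseteq> H'" "g \<in> H'" "\<forall>n\<in>H. f' n = f n"
      using partial_char_extend[OF q f g(1)] z unfolding m_def by blast
    have g': "[g = g mod q] (mod q)" by (simp add: cong_def)
    have "g mod q \<in> H'" using *(1,3) g' by (auto simp: partial_char_def)
    moreover have "g mod q \<notin> H"
      using f g' g(2) unfolding partial_char_def by (metis cong_sym)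
    moreover have "coprime (g mod q) q" using g(1) q by simp
    ultimately have "({n. coprime n q} \<inter> {..<q} - H') \<subset> ({n. coprime n q} \<inter> {..<q} - H)"
      using *(2) q by (intro psubsetI) (auto simp: set_eq_iff intro!: exI[of _ "g mod q"])
    hence "card ({n. coprime n q} \<inter> {..<q} - H') < card ({n. coprime n q} \<inter> {..<q} - H)"
      by (intro psubset_card_mono) auto
    from less(1)[OF this *(1)] obtain chi where "dcharacter q chi" "\<forall>n\<in>H'. chi n = f' n" by blast
    thus ?thesis using *(2,4) by (intro exI[of _ chi]) auto
  qed
qed

text \<open>Relative to the trivial subgroup, \<open>x\<close> has order m > 1, so an m-th root of
  unity other than 1 is an admissible value at \<open>x\<close>.\<close>

lemma dcharacter_separates:
  fixes x q :: nat
  assumes q: "q > 0" and x: "coprime x q" "\<not> [x = 1] (mod q)"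
  shows "\<exists>chi. dcharacter q chi \<and> chi x \<noteq> 1"
proof -
  define H where "H = {n. [n = 1] (mod q)}"
  have f: "partial_char q H (\<lambda>_. 1)"
    unfolding partial_char_def H_def
    by (auto dest: cong_imp_coprime [OF cong_sym] cong_mult intro: cong_trans cong_sym)
  define m where "m = (LEAST m. m > 0 \<and> x ^ m \<in> H)"
  have "totient q > 0 \<and> x ^ totient q \<in> H" using q euler_theorem[OF x(1)] by (auto simp: H_def)
  from LeastI[of "\<lambda>m. m > 0 \<and> x ^ m \<in> H", OF this] have m: "m > 0" "x ^ m \<in> H"
    by (auto simp: m_def)
  have "m \<noteq> 1" using m(2) x(2) by (auto simp: H_def)
  hence m2: "m > 1" using m(1) by simp
  have "card {z::complex. z ^ m = 1} = m" using m by (simp add: card_roots_unity_eq)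
  hence "\<not> {z::complex. z ^ m = 1} \<subseteq> {1}"
    using m2 card_mono[of "{1::complex}" "{z::complex. z ^ m = 1}"] by auto
  then obtain z :: complex where z: "z ^ m = 1" "z \<noteq> 1" by auto
  obtain H' f' where *: "partial_char q H' f'" "x \<in> H'" "f' x = z"
    using partial_char_extend[OF q f x(1)] z(1) unfolding m_def by blast
  from partial_char_extend_full[OF q *(1)] show ?thesis using * z(2) by auto
qed

text \<open>Multiplication by a character \<open>psi\<close> with \<open>psi x\<close> different
  from 1 permutes the characters, so the sum equals \<open>psi x\<close> times itself.\<close>

lemma sum_dcharacters:
  assumes q: "q > 0" and x: "coprime x q" "\<not> [x = 1] (mod q)"
  shows "(\<Sum>chi | dcharacter q chi. chi x) = 0"
proof -
  obtain psi where psi: "dcharacter q psi" "psi x \<noteq> 1"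
    using dcharacter_separates[OF assms] by blast
  have inv: "cnj (psi n) * (psi n * chi n) = chi n" "psi n * (cnj (psi n) * chi n) = chi n" 
    if "dcharacter q chi" for chi n
  proof -
    have "cnj (psi n) * psi n * chi n = chi n"
      using dcharacter_cnj_mult[OF psi(1) q, of n] that by (simp add: dcharacter_def)
    thus "cnj (psi n) * (psi n * chi n) = chi n" "psi n * (cnj (psi n) * chi n) = chi n"
      by (simp_all only: mult_ac)
  qed
  have "(\<Sum>chi | dcharacter q chi. chi x) = (\<Sum>chi | dcharacter q chi. psi x * chi x)"
    by (rule sum.reindex_bij_witness[of _ "\<lambda>chi n. psi n * chi n" "\<lambda>chi n. cnj (psi n) * chi n"])
       (use inv psi in \<open>auto intro: dcharacter_mult dcharacter_cnj\<close>)
  also have "\<dots> = psi x * (\<Sum>chi | dcharacter q chi. chi x)" by (simp add: sum_distrib_left)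
  finally show ?thesis using psi(2) by (metis mult_cancel_right1)
qed

text \<open>The dual argument: multiplication by a unit \<open>a\<close> with \<open>chi a\<close>
  different from 1 permutes the residues.\<close>

lemma sum_dcharacter_period:
  assumes q: "q > 0" and chi: "dcharacter q chi" "chi \<noteq> principal_char q"
  shows "(\<Sum>n<q. chi n) = 0"
proof -
  obtain a where a: "coprime a q" "chi a \<noteq> 1"
  proof -
    obtain a where "chi a \<noteq> principal_char q a" using chi(2) by auto
    hence "coprime a q" "chi a \<noteq> 1" using chi(1) by (auto simp: principal_char_def dcharacter_def split: if_splits)
    thus ?thesis using that by blast
  qed
  have inj: "inj_on (\<lambda>n. a * n mod q) {..<q}"
  proof (rule inj_onI)
    fix m n assume "m \<in> {..<q}" "n \<in> {..<q}" "a * m mod q = a * n mod q"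
    thus "m = n" using a(1) cong_mult_lcancel_nat[of a q m n]
      by (auto simp: cong_def coprime_commute)
  qed
  have img: "(\<lambda>n. a * n mod q) ` {..<q} = {..<q}"
    by (rule endo_inj_surj) (use q inj in auto)
  have "(\<Sum>n<q. chi n) = (\<Sum>n<q. chi (a * n mod q))"
    using sum.reindex[OF inj, of chi] img by (simp add: o_def)
  also have "\<dots> = chi a * (\<Sum>n<q. chi n)"
    using chi(1) by (simp add: dcharacter_mod sum_distrib_left) (simp add: dcharacter_def)
  finally show ?thesis using a(2) by (metis mult_cancel_right1)
qed

lemma sum_coprime_eq_totient:
  assumes "q > 0"
  shows "(\<Sum>n<q. if coprime n q then 1 else (0::complex)) = of_nat (totient q)"
proof (cases "q = 1")
  case False
  have "{n. n < q \<and> coprime n q} = totatives q"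
    using assms False by (auto simp: totatives_def intro: Nat.gr0I le_neq_implies_less)
  thus ?thesis
    by (simp add: totient_def sum.If_cases Int_def)
qed auto

text \<open>Double counting of the sum of \<open>chi n\<close> over residues and characters: summed
  over characters first, only the residue of 1 survives; summed over residues first, only the
  principal character does.\<close>

lemma card_dcharacter:
  assumes q: "q > 0"
  shows "card {chi. dcharacter q chi} = totient q"
proof -
  let ?X = "{chi. dcharacter q chi}"
  have fin: "finite ?X" by (rule finite_dcharacter[OF q])
  \<comment> \<open>Writing \<open>1 mod q\<close> instead of 1 covers \<open>q = 1\<close>, where
    the only residue is 0.\<close>
  have "(\<Sum>n<q. \<Sum>chi\<in>?X. chi n) = (\<Sum>n<q. if n = 1 mod q then of_nat (card ?X) else 0)"
  proof (intro sum.cong refl)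
    fix n assume n: "n \<in> {..<q}"
    show "(\<Sum>chi\<in>?X. chi n) = (if n = 1 mod q then of_nat (card ?X) else 0)"
    proof (cases "coprime n q")
      case True
      have "[n = 1] (mod q) \<longleftrightarrow> n = 1 mod q" using n by (simp add: cong_def)
      moreover have "chi (1 mod q) = 1" if "dcharacter q chi" for chi
        using that dcharacter_mod[OF that, of 1] by (simp only: dcharacter_def)
      hence "n = 1 mod q \<Longrightarrow> (\<Sum>chi\<in>?X. chi n) = (\<Sum>chi\<in>?X. 1)"
        by (intro sum.cong) auto
      ultimately show ?thesis using sum_dcharacters[OF q True] by auto
    next
      case False
      hence "n \<noteq> 1 mod q" by auto
      moreover have "(\<Sum>chi\<in>?X. chi n) = 0" using False by (intro sum.neutral) (auto simp: dcharacter_def)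
      ultimately show ?thesis by simp
    qed
  qed
  also have "\<dots> = of_nat (card ?X)" using q by simp
  finally have 1: "(\<Sum>n<q. \<Sum>chi\<in>?X. chi n) = of_nat (card ?X)" .
  have "(\<Sum>n<q. \<Sum>chi\<in>?X. chi n) = (\<Sum>chi\<in>?X. \<Sum>n<q. chi n)" by (rule sum.swap)
  also have "\<dots> = (\<Sum>chi\<in>?X. if chi = principal_char q then of_nat (totient q) else 0)"
    using sum_dcharacter_period[OF q] sum_coprime_eq_totient[OF q]
    by (intro sum.cong) (auto simp: principal_char_def [abs_def])
  also have "\<dots> = of_nat (totient q)" using fin dcharacter_principal[OF q] by simp
  finally show ?thesis using 1 by (metis of_nat_eq_iff)
qed

theorem dcharacter_orthogonality:
  assumes q: "q > 0"
  shows "(\<Sum>chi | dcharacter q chi. chi m * cnj (chi n)) =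
           (if coprime n q \<and> [m = n] (mod q) then of_nat (totient q) else 0)"
proof (cases "coprime m q \<and> coprime n q")
  case False
  have "coprime n q \<and> [m = n] (mod q) \<Longrightarrow> coprime m q"
    using cong_imp_coprime cong_sym by blast
  moreover have "(\<Sum>chi | dcharacter q chi. chi m * cnj (chi n)) = 0"
    using False by (intro sum.neutral) (auto simp: dcharacter_def)
  ultimately show ?thesis using False by auto
next
  case True
  \<comment> \<open>\<open>x\<close> represents m/n modulo \<open>q\<close>; by Euler's theorem the
    inverse of \<open>n\<close> is a power of \<open>n\<close>.\<close>
  define x where "x = m * n ^ (totient q - 1)"
  have tq: "totient q > 0" using q by simp
  have xn: "x * n = m * n ^ totient q"
    unfolding x_def using tq by (simp only: mult.assoc power_minus_mult)
  have nn: "[m * n ^ totient q = m * 1] (mod q)"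
    using True by (intro cong_mult euler_theorem) auto
  have cx: "coprime x q" using True by (simp add: x_def)
  have eq: "chi m * cnj (chi n) = chi x" if "dcharacter q chi" for chi
  proof -
    have "chi x * chi n = chi m"
      using that nn xn by (metis dcharacter_cong dcharacter_def mult.right_neutral)
    moreover have "cnj (chi n) * chi n = 1" using dcharacter_cnj_mult[OF that q] True by simp
    ultimately show ?thesis by (metis mult.assoc mult.commute mult.right_neutral)
  qed
  have "[x = 1] (mod q) \<longleftrightarrow> [x * n = 1 * n] (mod q)"
    using True cong_mult_rcancel_nat[of n q x 1] by (simp add: coprime_commute)
  also have "\<dots> \<longleftrightarrow> [m = n] (mod q)"
    using nn xn by (simp add: cong_def)
  finally have iff: "[x = 1] (mod q) \<longleftrightarrow> [m = n] (mod q)" .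
  have "(\<Sum>chi | dcharacter q chi. chi m * cnj (chi n)) = (\<Sum>chi | dcharacter q chi. chi x)"
    by (intro sum.cong) (auto simp: eq)
  also have "\<dots> = (if [m = n] (mod q) then of_nat (totient q) else 0)"
  proof (cases "[m = n] (mod q)")
    case c: True
    have "chi x = 1" if "dcharacter q chi" for chi
      using c iff dcharacter_cong[OF that, of x 1] that by (auto simp: dcharacter_def)
    hence "(\<Sum>chi | dcharacter q chi. chi x) = (\<Sum>chi | dcharacter q chi. 1)"
      by (intro sum.cong) auto
    thus ?thesis using c card_dcharacter[OF q] by simp
  qed (use sum_dcharacters[OF q cx] iff in auto)
  finally show ?thesis using True by simp
qed

section \<open>Euler products\<close>

lemmas abs_summable_comparison = Infinite_Sum.abs_summable_on_comparison_test'

text \<open>The sets \<open>B N\<close> may be infinite: a finite subset of \<open>B N\<close> on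
  which the sum is close to both limits compares them. Euler products need this with
  \<open>B N\<close> the positive integers free of primes above N.\<close>

lemma has_sum_exhaustion:
  fixes f :: "'a \<Rightarrow> 'b::real_normed_vector"
  assumes S: "(f has_sum S) A" and s: "\<And>N::nat. (f has_sum s N) (B N)"
    and sub: "\<And>N. B N \<subseteq> A" and ev: "\<And>F. finite F \<Longrightarrow> F \<subseteq> A \<Longrightarrow> \<forall>\<^sub>F N in sequentially. F \<subseteq> B N"
  shows "s \<longlonglongrightarrow> S"
proof (rule tendstoI)
  fix e :: real assume e: "e > 0"
  hence "\<forall>\<^sub>F F in finite_subsets_at_top A. dist (sum f F) S < e / 2"
    using S unfolding has_sum_def by (intro tendstoD) auto
  hence "\<exists>X. finite X \<and> X \<subseteq> A \<and> (\<forall>Y. finite Y \<and> X \<subseteq> Y \<and> Y \<subseteq> A \<longrightarrow> dist (sum f Y) S < e / 2)"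
    by (simp only: eventually_finite_subsets_at_top)
  then obtain F where F: "finite F" "F \<subseteq> A"
    and F3: "\<forall>Y. finite Y \<and> F \<subseteq> Y \<and> Y \<subseteq> A \<longrightarrow> dist (sum f Y) S < e / 2"
    by blast
  show "\<forall>\<^sub>F N in sequentially. dist (s N) S < e"
    using ev[OF F(1,2)]
  proof eventually_elim
    case (elim N)
    have "\<forall>\<^sub>F G in finite_subsets_at_top (B N). dist (sum f G) (s N) < e / 2"
      using s[of N] e unfolding has_sum_def by (intro tendstoD) auto
    hence "\<exists>X. finite X \<and> X \<subseteq> B N \<and> (\<forall>Y. finite Y \<and> X \<subseteq> Y \<and> Y \<subseteq> B N \<longrightarrow> dist (sum f Y) (s N) < e / 2)"
      by (simp only: eventually_finite_subsets_at_top)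
    then obtain G where G: "finite G" "G \<subseteq> B N"
      and G3: "\<forall>Y. finite Y \<and> G \<subseteq> Y \<and> Y \<subseteq> B N \<longrightarrow> dist (sum f Y) (s N) < e / 2"
      by blast
    have "dist (sum f (F \<union> G)) (s N) < e / 2" using F G elim by (intro G3[rule_format]) auto
    moreover have "dist (sum f (F \<union> G)) S < e / 2"
      using F G subset_trans[OF G(2) sub[of N]] by (intro F3[rule_format]) auto
    ultimately show ?case
      using dist_triangle_half_r[of "sum f (F \<union> G)" "s N" e S] by simp
  qed
qed

lemma eventually_finite_subset_atMost:
  fixes F :: "nat set"
  assumes "finite F"
  shows "\<forall>\<^sub>F N in sequentially. F \<subseteq> {..N}"
  using eventually_ge_at_top[of "Max (insert 0 F)"]
  by eventually_elim (use assms in \<open>auto dest: Max_ge[of "insert 0 F", rotated]\<close>)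

text \<open>Splitting off the exact power of \<open>p\<close> drives the induction over the set of
  primes in the finite Euler product.\<close>

lemma bij_betw_prime_power_times:
  fixes p :: nat
  assumes p: "prime p" and P: "p \<notin> P"
  shows "bij_betw (\<lambda>(j, m). p ^ j * m) (UNIV \<times> {n. n > 0 \<and> prime_factors n \<subseteq> P})
           {n. n > 0 \<and> prime_factors n \<subseteq> insert p P}"
proof (rule bij_betwI[where g = "\<lambda>n. (multiplicity p n, n div p ^ multiplicity p n)"])
  show "(\<lambda>(j, m). p ^ j * m) \<in> UNIV \<times> {n. n > 0 \<and> prime_factors n \<subseteq> P} \<rightarrow>
          {n. n > 0 \<and> prime_factors n \<subseteq> insert p P}"
    using p by (auto simp: prime_factors_product prime_factorization_prime_power prime_gt_0_nat
        prime_factors_power prime_prime_factors split: if_splits)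
next
  show "(\<lambda>n. (multiplicity p n, n div p ^ multiplicity p n)) \<in>
          {n. n > 0 \<and> prime_factors n \<subseteq> insert p P} \<rightarrow> UNIV \<times> {n. n > 0 \<and> prime_factors n \<subseteq> P}"
  proof (rule funcsetI)
    fix n assume "n \<in> {n. n > 0 \<and> prime_factors n \<subseteq> insert p P}"
    hence n: "0 < n" "prime_factors n \<subseteq> insert p P" by auto
    have dvd: "p ^ multiplicity p n dvd n" by (rule multiplicity_dvd)
    hence le: "p ^ multiplicity p n \<le> n" using n by (intro dvd_imp_le) auto
    have pos: "n div p ^ multiplicity p n > 0"
      using le p by (simp add: div_greater_zero_iff prime_gt_0_nat)
    have "\<not> p dvd n div p ^ multiplicity p n"
      using p n by (intro multiplicity_decompose) auto
    hence "p \<notin> prime_factors (n div p ^ multiplicity p n)" by auto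
    moreover have "prime_factors (n div p ^ multiplicity p n) \<subseteq> prime_factors n"
    proof (rule dvd_prime_factors)
      show "n div p ^ multiplicity p n dvd n"
        using dvd by (metis dvd_mult_div_cancel dvd_triv_right)
    qed (use n in auto)
    ultimately show "(multiplicity p n, n div p ^ multiplicity p n) \<in> UNIV \<times> {n. n > 0 \<and> prime_factors n \<subseteq> P}"
      using n pos by auto
  qed
next
  fix x :: "nat \<times> nat" assume "x \<in> UNIV \<times> {n. n > 0 \<and> prime_factors n \<subseteq> P}"
  then obtain j :: nat and m where x: "x = (j, m)" "m > 0" "prime_factors m \<subseteq> P" by auto
  have "\<not> p dvd m" using x P p by (auto simp: in_prime_factors_iff)
  hence "multiplicity p (p ^ j * m) = j"
    using p x by (subst prime_elem_multiplicity_mult_distrib) (auto simp: not_dvd_imp_multiplicity_0)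
  thus "(case case x of (j, m) \<Rightarrow> p ^ j * m of n \<Rightarrow> (multiplicity p n, n div p ^ multiplicity p n)) = x"
    using x p by (simp add: prime_gt_0_nat)
next
  fix n assume "n \<in> {n. n > 0 \<and> prime_factors n \<subseteq> insert p P}"
  thus "(case (multiplicity p n, n div p ^ multiplicity p n) of (j, m) \<Rightarrow> p ^ j * m) = n"
    by (simp add: multiplicity_dvd)
qed

context
  fixes f :: "nat \<Rightarrow> 'a::{banach, real_normed_field}"
  assumes f1: "f 1 = 1" and fmult: "\<And>m n. coprime m n \<Longrightarrow> f (m * n) = f m * f n"
    and summ: "(\<lambda>n. norm (f n)) summable_on {0<..}"
begin

lemma has_sum_prime_powers:
  assumes "prime p"
  shows "((\<lambda>j. f (p ^ j)) has_sum (\<Sum>\<^sub>\<infinity>j. f (p ^ j))) UNIV"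
proof -
  have inj: "inj_on (\<lambda>j. p ^ j) UNIV"
    using assms prime_power_inj by (auto intro!: inj_onI)
  have "(f \<circ> (\<lambda>j. p ^ j)) summable_on UNIV"
    unfolding summable_on_reindex[OF inj, symmetric]
    by (rule summable_on_subset_banach[OF abs_summable_summable[OF summ]])
       (use assms prime_gt_0_nat in auto)
  thus ?thesis by (simp add: o_def)
qed

lemma has_sum_euler_finite:
  assumes "finite P" "\<And>p. p \<in> P \<Longrightarrow> prime p"
  shows "(f has_sum (\<Prod>p\<in>P. \<Sum>\<^sub>\<infinity>j. f (p ^ j))) {n. n > 0 \<and> prime_factors n \<subseteq> P}"
  using assms
proof (induction P rule: finite_induct)
  case empty
  have "{n::nat. n > 0 \<and> prime_factors n \<subseteq> {}} = {1}"
    by (auto simp: prime_factorization_empty_iff)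
  moreover have "(f has_sum 1) {1}" using f1 by (intro has_sum_finiteI) simp_all
  ultimately show ?case by simp
next
  case (insert p P)
  define A where "A P = {n::nat. n > 0 \<and> prime_factors n \<subseteq> P}" for P
  have p: "prime p" using insert by auto
  have bij: "bij_betw (\<lambda>(j, m). p ^ j * m) (UNIV \<times> A P) (A (insert p P))"
    unfolding A_def by (rule bij_betw_prime_power_times) (use insert p in auto)
  have "f summable_on A (insert p P)"
    by (rule summable_on_subset_banach[OF abs_summable_summable[OF summ]]) (auto simp: A_def)
  hence sm: "(\<lambda>x. f ((\<lambda>(j, m). p ^ j * m) x)) summable_on UNIV \<times> A P"
    using summable_on_reindex_bij_betw[OF bij, of f] by blast
  have eq: "f ((\<lambda>(j, m). p ^ j * m) x) = f (p ^ fst x) * f (snd x)" if "x \<in> UNIV \<times> A P" for x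
  proof -
    have "p \<notin> prime_factors (snd x)" "snd x > 0" using that insert by (auto simp: A_def)
    hence "\<not> p dvd snd x" using p by (simp add: in_prime_factors_iff)
    hence "coprime (p ^ fst x) (snd x)" using p by (simp add: prime_imp_coprime)
    thus ?thesis by (simp add: case_prod_unfold fmult)
  qed
  have sm': "(\<lambda>x. f (p ^ fst x) * f (snd x)) summable_on UNIV \<times> A P"
    using sm by (subst (asm) summable_on_cong[OF eq]) auto
  have "((\<lambda>x. f (p ^ fst x) * f (snd x)) has_sum ((\<Sum>\<^sub>\<infinity>j. f (p ^ j)) * (\<Prod>p\<in>P. \<Sum>\<^sub>\<infinity>j. f (p ^ j)))) (UNIV \<times> A P)"
  proof (rule has_sum_SigmaI[OF _ _ sm'])
    fix j :: nat
    show "((\<lambda>m. f (p ^ fst (j, m)) * f (snd (j, m))) has_sum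
             (f (p ^ j) * (\<Prod>p\<in>P. \<Sum>\<^sub>\<infinity>j. f (p ^ j)))) (A P)"
      using has_sum_cmult_right[OF insert.IH, of "f (p ^ j)"] insert by (simp add: A_def)
    show "((\<lambda>j. f (p ^ j) * (\<Prod>p\<in>P. \<Sum>\<^sub>\<infinity>j. f (p ^ j))) has_sum
             ((\<Sum>\<^sub>\<infinity>j. f (p ^ j)) * (\<Prod>p\<in>P. \<Sum>\<^sub>\<infinity>j. f (p ^ j)))) UNIV"
      by (intro has_sum_cmult_left has_sum_prime_powers p)
  qed
  hence "((\<lambda>x. f ((\<lambda>(j, m). p ^ j * m) x)) has_sum ((\<Sum>\<^sub>\<infinity>j. f (p ^ j)) * (\<Prod>p\<in>P. \<Sum>\<^sub>\<infinity>j. f (p ^ j)))) (UNIV \<times> A P)"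
    by (subst has_sum_cong[OF eq]) auto
  hence "(f has_sum ((\<Sum>\<^sub>\<infinity>j. f (p ^ j)) * (\<Prod>p\<in>P. \<Sum>\<^sub>\<infinity>j. f (p ^ j)))) (A (insert p P))"
    using has_sum_reindex_bij_betw[OF bij, of f] by blast
  thus ?case using insert by (simp add: A_def)
qed

text \<open>A finite set of positive integers up to N involves only primes up to N, so the N-smooth
  numbers exhaust the positive integers.\<close>

theorem euler_product:
  "(\<lambda>N. \<Prod>p | prime p \<and> p \<le> N. \<Sum>\<^sub>\<infinity>j. f (p ^ j)) \<longlonglongrightarrow> (\<Sum>\<^sub>\<infinity>n\<in>{0<..}. f n)"
proof (rule has_sum_exhaustion)
  show "(f has_sum (\<Sum>\<^sub>\<infinity>n\<in>{0<..}. f n)) {0<..}"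
    by (rule has_sum_infsum[OF abs_summable_summable[OF summ]])
  show "(f has_sum (\<Prod>p | prime p \<and> p \<le> N. \<Sum>\<^sub>\<infinity>j. f (p ^ j))) {n. n > 0 \<and> prime_factors n \<subseteq> {p. prime p \<and> p \<le> N}}" for N
    by (rule has_sum_euler_finite) auto
  show "{n. 0 < n \<and> prime_factors n \<subseteq> {p. prime p \<and> p \<le> N}} \<subseteq> {0<..}" for N by auto
  fix F :: "nat set" assume F: "finite F" "F \<subseteq> {0<..}"
  show "\<forall>\<^sub>F N in sequentially. F \<subseteq> {n. 0 < n \<and> prime_factors n \<subseteq> {p. prime p \<and> p \<le> N}}"
    using eventually_finite_subset_atMost[OF F(1)]
  proof eventually_elim
    case (elim N)
    show ?case
    proof (rule subsetI, clarify, intro conjI subsetI)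
      fix n assume n: "n \<in> F"
      show "0 < n" using n F by auto
      fix p assume p: "p \<in> prime_factors n"
      have "p \<le> n" using p \<open>0 < n\<close> by (auto simp: in_prime_factors_iff dvd_imp_le)
      moreover have "n \<le> N" using elim n by auto
      ultimately show "p \<in> {p. prime p \<and> p \<le> N}" using p by auto
    qed
  qed
qed

end

section \<open>Completely multiplicative functions and logarithms of their sums\<close>

lemma inj_on_prime_power:
  "inj_on (\<lambda>(p, j). p ^ j) ({p::nat. prime p} \<times> {0<..})"
  by (auto simp: inj_on_def prime_power_inj'')

context
  fixes h :: "nat \<Rightarrow> complex"
  assumes h1: "h 1 = 1" and hmult: "\<And>m n. h (m * n) = h m * h n"
    and hsumm: "(\<lambda>n. norm (h n)) summable_on {0<..}"
begin

lemma completely_mult_power: "h (p ^ j) = h p ^ j"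
  using h1 by (induction j) (auto simp: hmult)

text \<open>The values at the powers of \<open>p\<close> form a geometric subseries of an absolutely
  convergent series.\<close>

lemma completely_mult_norm_less_1:
  assumes p: "prime p"
  shows "norm (h p) < 1"
proof -
  have "(\<lambda>j. h (p ^ j)) summable_on UNIV"
    using has_sum_prime_powers[OF h1 _ hsumm p] hmult by (auto dest: has_sum_imp_summable)
  hence "summable (\<lambda>j. h p ^ j)"
    unfolding completely_mult_power by (rule summable_on_imp_summable)
  thus ?thesis by (simp add: summable_geometric_iff)
qed

lemma completely_mult_infsum_powers:
  assumes p: "prime p"
  shows "(\<Sum>\<^sub>\<infinity>j. h (p ^ j)) = 1 / (1 - h p)"
proof -
  have "((\<lambda>j. h p ^ j) has_sum (1 / (1 - h p))) UNIV"
    using completely_mult_norm_less_1[OF p]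
    by (intro norm_summable_imp_has_sum geometric_sums) (auto simp: norm_power)
  thus ?thesis by (simp add: completely_mult_power infsumI)
qed

lemma completely_mult_euler:
  "(\<lambda>N. \<Prod>p | prime p \<and> p \<le> N. 1 / (1 - h p)) \<longlonglongrightarrow> (\<Sum>\<^sub>\<infinity>n\<in>{0<..}. h n)"
proof -
  have "(\<Prod>p | prime p \<and> p \<le> N. \<Sum>\<^sub>\<infinity>j. h (p ^ j)) = (\<Prod>p | prime p \<and> p \<le> N. 1 / (1 - h p))" for N
    by (intro prod.cong) (auto simp: completely_mult_infsum_powers)
  thus ?thesis using euler_product[OF h1 _ hsumm] hmult by simp
qed

lemma completely_mult_log_summable:
  "(\<lambda>x. norm (case x of (p, j) \<Rightarrow> h p ^ j / of_nat j)) summable_on {p. prime p} \<times> {0<..}"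
proof (rule Infinite_Sum.abs_summable_on_comparison_test)
  have "(\<lambda>n. norm (h n)) summable_on (\<lambda>(p, j). p ^ j) ` ({p::nat. prime p} \<times> {0<..})"
    by (rule summable_on_subset_banach[OF hsumm]) (auto simp: prime_gt_0_nat)
  hence "((\<lambda>n. norm (h n)) \<circ> (\<lambda>(p, j). p ^ j)) summable_on ({p::nat. prime p} \<times> {0<..})"
    by (subst (asm) summable_on_reindex[OF inj_on_prime_power])
  thus "(\<lambda>x. norm (case x of (p, j) \<Rightarrow> h p ^ j)) summable_on {p. prime p} \<times> {0<..}"
    by (simp add: o_def case_prod_unfold completely_mult_power)
  fix x :: "nat \<times> nat" assume "x \<in> {p. prime p} \<times> {0<..}"
  then obtain p j where x: "x = (p, j)" "j > 0" by auto
  have "norm (h p) ^ j / real j \<le> norm (h p) ^ j / 1"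
    using x by (intro divide_left_mono) auto
  thus "norm (case x of (p, j) \<Rightarrow> h p ^ j / of_nat j) \<le> norm (case x of (p, j) \<Rightarrow> h p ^ j)"
    by (simp add: x norm_divide norm_power)
qed

text \<open>The exponent is assembled from principal logarithms of single Euler factors, each given
  by its power series, so no branch of the logarithm of the whole product has to be chosen. An
  exponential of a series over prime powers is the form that \<open>Landau_exp\<close>
  takes.\<close>

theorem completely_mult_eq_exp:
  "(\<Sum>\<^sub>\<infinity>n\<in>{0<..}. h n) = exp (\<Sum>\<^sub>\<infinity>(p, j)\<in>{p. prime p} \<times> {0<..}. h p ^ j / of_nat j)"
proof -
  let ?f = "\<lambda>(p, j). h p ^ j / of_nat j" and ?I = "\<lambda>N. {p. prime p \<and> p \<le> N} \<times> {0<..}"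
  have sm: "?f summable_on {p. prime p} \<times> {0<..}"
    by (rule abs_summable_summable[OF completely_mult_log_summable])
  have inner: "((\<lambda>j. ?f (p, j)) has_sum - Ln (1 - h p)) {0<..}" if p: "prime p" for p
  proof -
    have n: "norm (- h p) < 1" using completely_mult_norm_less_1[OF p] by simp
    have "((\<lambda>j. h p ^ j / of_nat j) has_sum - Ln (1 - h p)) UNIV"
    proof (rule norm_summable_imp_has_sum)
      have "(\<lambda>j. - (- (h p ^ j) / of_nat j)) sums - Ln (1 + - h p)"
        using Ln_series'[OF n] by (intro sums_minus) simp
      thus "(\<lambda>j. h p ^ j / of_nat j) sums - Ln (1 - h p)" by simp
      show "summable (\<lambda>j. norm (h p ^ j / of_nat j))"
      proof (rule summable_comparison_test)
        show "\<exists>N. \<forall>n\<ge>N. norm (norm (h p ^ n / of_nat n)) \<le> norm (h p) ^ n"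
          by (intro exI[of _ 1] allI impI) (simp add: norm_divide norm_power divide_le_eq mult_left_le mult_le_cancel_left1)
        show "summable (\<lambda>n. norm (h p) ^ n)" using n by simp
      qed
    qed
    thus ?thesis by (subst has_sum_cong_neutral[where T = UNIV]) auto
  qed
  have "(\<lambda>N. \<Sum>p | prime p \<and> p \<le> N. - Ln (1 - h p)) \<longlonglongrightarrow> infsum ?f ({p. prime p} \<times> {0<..})"
  proof (rule has_sum_exhaustion[where f = ?f and B = ?I])
    show "(?f has_sum infsum ?f ({p. prime p} \<times> {0<..})) ({p. prime p} \<times> {0<..})" using sm by simp
    show "(?f has_sum (\<Sum>p | prime p \<and> p \<le> N. - Ln (1 - h p))) (?I N)" for N
    proof (rule has_sum_SigmaI)
      show "((\<lambda>j. ?f (p, j)) has_sum - Ln (1 - h p)) {0<..}" if "p \<in> {p. prime p \<and> p \<le> N}" for p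
        using inner[of p] that by simp
      show "?f summable_on ?I N" by (rule summable_on_subset_banach[OF sm]) auto
      show "((\<lambda>p. - Ln (1 - h p)) has_sum (\<Sum>p | prime p \<and> p \<le> N. - Ln (1 - h p))) {p. prime p \<and> p \<le> N}"
        by (rule has_sum_finite) simp
    qed
    show "?I N \<subseteq> {p. prime p} \<times> {0<..}" for N by auto
    fix F :: "(nat \<times> nat) set" assume F: "finite F" "F \<subseteq> {p. prime p} \<times> {0<..}"
    show "\<forall>\<^sub>F N in sequentially. F \<subseteq> ?I N"
      using eventually_finite_subset_atMost[OF finite_imageI[OF F(1), of fst]]
    proof eventually_elim
      case (elim N)
      show ?case
      proof
        fix x assume "x \<in> F"
        hence "fst x \<le> N" "x \<in> {p. prime p} \<times> {0<..}" using elim F(2) by auto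
        thus "x \<in> ?I N" by auto
      qed
    qed
  qed
  hence "(\<lambda>N. exp (\<Sum>p | prime p \<and> p \<le> N. - Ln (1 - h p))) \<longlonglongrightarrow> exp (infsum ?f ({p. prime p} \<times> {0<..}))"
    by (intro tendsto_intros)
  moreover have "exp (\<Sum>p | prime p \<and> p \<le> N. - Ln (1 - h p)) = (\<Prod>p | prime p \<and> p \<le> N. 1 / (1 - h p))" for N
  proof -
    have "exp (- Ln (1 - h p)) = 1 / (1 - h p)" if "prime p" for p
    proof -
      have "1 - h p \<noteq> 0" using completely_mult_norm_less_1[OF that] by auto
      thus ?thesis by (simp add: exp_minus inverse_eq_divide)
    qed
    thus ?thesis by (simp add: exp_sum)
  qed
  ultimately show ?thesis using completely_mult_euler LIMSEQ_unique by auto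
qed

end

section \<open>Coefficients of powers of the inverse zeta function\<close>

text \<open>The coefficients of \<open>\<zeta>(s)\<^sup>-\<^sup>k\<close>.\<close>

definition zeta_inv_coeff :: "nat \<Rightarrow> nat \<Rightarrow> real" where
  "zeta_inv_coeff k n =
     (\<Prod>p\<in>prime_factors n. (-1) ^ multiplicity p n * real (k choose multiplicity p n))"

lemma zeta_inv_coeff_1 [simp]: "zeta_inv_coeff k (Suc 0) = 1"
  by (simp add: zeta_inv_coeff_def)

lemma zeta_inv_coeff_mult:
  assumes "coprime m n"
  shows "zeta_inv_coeff k (m * n) = zeta_inv_coeff k m * zeta_inv_coeff k n"
proof (cases "m = 0 \<or> n = 0")
  case True
  thus ?thesis using assms by (auto simp: zeta_inv_coeff_def)
next
  case False
  have disj: "prime_factors m \<inter> prime_factors n = {}"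
    using assms by (auto simp: in_prime_factors_iff coprime_def dest: not_prime_unit)
  have "multiplicity p (m * n) = multiplicity p m" if "p \<in> prime_factors m" for p
    using that disj False
    by (subst prime_elem_multiplicity_mult_distrib)
       (auto simp: in_prime_factors_iff intro!: not_dvd_imp_multiplicity_0)
  moreover have "multiplicity p (m * n) = multiplicity p n" if "p \<in> prime_factors n" for p
    using that disj False
    by (subst prime_elem_multiplicity_mult_distrib)
       (auto simp: in_prime_factors_iff intro!: not_dvd_imp_multiplicity_0)
  ultimately show ?thesis
    unfolding zeta_inv_coeff_def using False disj
    by (simp add: prime_factors_product prod.union_disjoint)
qed

lemma zeta_inv_coeff_prime_power:
  assumes "prime p"
  shows "zeta_inv_coeff k (p ^ j) = (-1) ^ j * real (k choose j)"
proof (cases "j = 0")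
  case False
  hence "prime_factors (p ^ j) = {p}" using assms by (simp add: prime_factors_power prime_prime_factors)
  thus ?thesis using assms by (simp add: zeta_inv_coeff_def)
qed auto

text \<open>A prime \<open>p\<close> with \<open>p powr eta\<close> at least \<open>B\<close> pays
  for its own factor \<open>B\<close>; the primes below \<open>Q\<close> together cost at most
  \<open>B ^ Q\<close>. The same bound controls the size of the coefficients and the totient from
  below.\<close>

lemma power_card_prime_factors_bound:
  fixes B eta :: real
  assumes B: "B \<ge> 1" and eta: "eta > 0"
  shows "\<exists>C>0. \<forall>n>0. B ^ card (prime_factors n) \<le> C * real n powr eta"
proof -
  define Q where "Q = nat \<lceil>B powr (1 / eta)\<rceil>"
  have Q: "B \<le> real p powr eta" if "p \<ge> Q" for p :: nat
  proof -
    have "B powr (1 / eta) \<le> real p" using that unfolding Q_def by linarith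
    hence "(B powr (1 / eta)) powr eta \<le> real p powr eta" using eta by (intro powr_mono2) auto
    thus ?thesis using B eta by (simp add: powr_powr)
  qed
  have "B ^ card (prime_factors n) \<le> B ^ Q * real n powr eta" if n: "n > 0" for n :: nat
  proof -
    have "B ^ card (prime_factors n) = (\<Prod>p\<in>prime_factors n. B)" by simp
    also have "\<dots> \<le> (\<Prod>p\<in>prime_factors n. (if p < Q then B else 1) * real p powr eta)"
    proof (rule prod_mono, intro conjI)
      fix p assume "p \<in> prime_factors n"
      hence "p \<ge> 1" using prime_ge_1_nat by auto
      hence "real p powr eta \<ge> 1" using eta by (intro ge_one_powr_ge_zero) auto
      thus "B \<le> (if p < Q then B else 1) * real p powr eta" using B Q[of p] by auto
    qed (use B in auto)
    also have "\<dots> = (\<Prod>p\<in>prime_factors n. if p < Q then B else 1) * (\<Prod>p\<in>prime_factors n. real p powr eta)"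
      by (rule prod.distrib)
    also have "\<dots> \<le> B ^ Q * real n powr eta"
    proof (rule mult_mono)
      have "(\<Prod>p\<in>prime_factors n. if p < Q then B else 1) = B ^ card (prime_factors n \<inter> {p. p < Q})"
        by (simp add: prod.If_cases)
      also have "card (prime_factors n \<inter> {p. p < Q}) \<le> card {..<Q}" by (rule card_mono) auto
      hence "B ^ card (prime_factors n \<inter> {p. p < Q}) \<le> B ^ Q" using B by (intro power_increasing) auto
      finally show "(\<Prod>p\<in>prime_factors n. if p < Q then B else 1) \<le> B ^ Q" .
      have "(\<Prod>p\<in>prime_factors n. real p) \<le> (\<Prod>p\<in>prime_factors n. real (p ^ multiplicity p n))"
      proof (rule prod_mono, intro conjI)
        fix p assume p: "p \<in> prime_factors n"
        hence "p \<ge> 1" "multiplicity p n \<ge> 1" using prime_ge_1_nat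
          by (auto simp: prime_factors_multiplicity Suc_le_eq)
        hence "p ^ 1 \<le> p ^ multiplicity p n" by (intro power_increasing) auto
        thus "real p \<le> real (p ^ multiplicity p n)" by (simp only: of_nat_le_iff power_one_right)
      qed auto
      also have "\<dots> = real n" using prime_factorization_nat[OF n] by (metis of_nat_prod)
      finally have le: "(\<Prod>p\<in>prime_factors n. real p) \<le> real n" .
      have "(\<Prod>p\<in>prime_factors n. real p powr eta) = (\<Prod>p\<in>prime_factors n. real p) powr eta"
        by (simp add: prod_powr_distrib)
      also have "\<dots> \<le> real n powr eta" using le eta by (intro powr_mono2 prod_nonneg) auto
      finally show "(\<Prod>p\<in>prime_factors n. real p powr eta) \<le> real n powr eta" .
    qed (use B in \<open>auto intro!: prod_nonneg\<close>)
    finally show ?thesis .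
  qed
  thus ?thesis using B by (intro exI[of _ "B ^ Q"]) auto
qed

lemma zeta_inv_coeff_bound:
  assumes eta: "eta > 0"
  shows "\<exists>C>0. \<forall>n>0. \<bar>zeta_inv_coeff k n\<bar> \<le> C * real n powr eta"
proof -
  obtain C where C: "C > 0" "\<And>n. n > 0 \<Longrightarrow> (2 ^ k) ^ card (prime_factors n) \<le> C * real n powr eta"
    using power_card_prime_factors_bound[of "2 ^ k" eta] eta by auto
  have "\<bar>zeta_inv_coeff k n\<bar> \<le> (2 ^ k) ^ card (prime_factors n)" for n
  proof -
    have "\<bar>zeta_inv_coeff k n\<bar> = (\<Prod>p\<in>prime_factors n. real (k choose multiplicity p n))"
      by (simp add: zeta_inv_coeff_def abs_prod abs_mult power_abs)
    also have "\<dots> \<le> (\<Prod>p\<in>prime_factors n. 2 ^ k)"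
    proof (rule prod_mono, intro conjI)
      fix p
      have "k choose multiplicity p n \<le> 2 ^ k" by (rule binomial_le_pow2)
      hence "real (k choose multiplicity p n) \<le> real (2 ^ k)" by (simp only: of_nat_le_iff)
      thus "real (k choose multiplicity p n) \<le> 2 ^ k" by simp
    qed auto
    finally show ?thesis by simp
  qed
  thus ?thesis using C order_trans by (intro exI[of _ C]) blast
qed

text \<open>The quotient phi(q)/q is a product of factors 1 - 1/p, each at least 1/2, so the number
  of prime factors of \<open>q\<close> controls it.\<close>

lemma totient_lower_bound:
  assumes delta: "delta > 0"
  shows "\<exists>c>0. \<forall>q>0. c * real q powr (1 - delta) \<le> real (totient q)"
proof -
  obtain C where C: "C > 0" "\<And>n. n > 0 \<Longrightarrow> 2 ^ card (prime_factors n) \<le> C * real n powr delta"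
    using power_card_prime_factors_bound[of 2 delta] delta by auto
  have "1 / C * real q powr (1 - delta) \<le> real (totient q)" if q: "q > 0" for q :: nat
  proof -
    have "(\<Prod>p\<in>prime_factors q. 1 / 2 :: real) \<le> (\<Prod>p\<in>prime_factors q. 1 - 1 / real p)"
    proof (rule prod_mono, intro conjI)
      fix p assume "p \<in> prime_factors q"
      hence "p \<ge> 2" using prime_ge_2_nat by auto
      thus "1 / 2 \<le> 1 - 1 / real p" by (simp add: field_simps)
    qed auto
    hence "real q * (1 / 2) ^ card (prime_factors q) \<le> real (totient q)"
      unfolding totient_formula2 by (simp add: mult_left_mono)
    moreover have "1 / C * real q powr (1 - delta) \<le> real q * (1 / 2) ^ card (prime_factors q)"
      using C(1) C(2)[OF q] q
      by (simp add: powr_diff power_divide field_simps)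
    ultimately show ?thesis by linarith
  qed
  thus ?thesis using C(1) by (intro exI[of _ "1 / C"]) auto
qed

section \<open>Dirichlet series of the coefficients\<close>

lemma summable_on_nat_powr:
  assumes "\<sigma> > 1"
  shows "(\<lambda>n. real n powr (-\<sigma>)) summable_on A"
proof -
  have "(\<lambda>n. real n powr (-\<sigma>)) summable_on UNIV"
    using assms by (subst summable_on_UNIV_nonneg_real_iff) (auto simp: summable_real_powr_iff)
  thus ?thesis by (rule summable_on_subset_banach) auto
qed

lemma summable_on_zeta_inv_coeff:
  assumes \<sigma>: "\<sigma> > 1"
  shows "(\<lambda>n. \<bar>zeta_inv_coeff k n\<bar> * real n powr (-\<sigma>)) summable_on {0<..}"
proof -
  define eta where "eta = (\<sigma> - 1) / 2"
  obtain C where C: "C > 0" "\<And>n. n > 0 \<Longrightarrow> \<bar>zeta_inv_coeff k n\<bar> \<le> C * real n powr eta"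
    using zeta_inv_coeff_bound[of eta k] \<sigma> by (auto simp: eta_def)
  have "(\<lambda>n. norm (\<bar>zeta_inv_coeff k n\<bar> * real n powr (-\<sigma>))) summable_on {0<..}"
  proof (rule abs_summable_comparison)
    show "(\<lambda>n. C * real n powr (-(1 + eta))) summable_on {0<..}"
      using \<sigma> by (intro summable_on_cmult_right summable_on_nat_powr) (auto simp: eta_def)
    fix n :: nat assume n: "n \<in> {0<..}"
    have "\<bar>zeta_inv_coeff k n\<bar> * real n powr (-\<sigma>) \<le> C * real n powr eta * real n powr (-\<sigma>)"
      using n by (intro mult_right_mono C) auto
    also have "\<dots> = C * real n powr (eta + -\<sigma>)"
      by (simp only: mult.assoc powr_add)
    also have "eta + -\<sigma> = -(1 + eta)" by (simp add: eta_def field_simps)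
    finally show "norm (\<bar>zeta_inv_coeff k n\<bar> * real n powr (-\<sigma>)) \<le> C * real n powr (-(1 + eta))" by simp
  qed
  thus ?thesis by simp
qed

lemma summable_on_zeta_inv_coeff_sq:
  assumes \<sigma>: "\<sigma> > 1"
  shows "(\<lambda>n. zeta_inv_coeff k n ^ 2 * real n powr (-\<sigma>)) summable_on {0<..}"
proof -
  \<comment> \<open>The quarter leaves room for squaring: the squared coefficients contribute the
    exponent 2 eta, and -(1 + 2 eta) remains.\<close>
  define eta where "eta = (\<sigma> - 1) / 4"
  obtain C where C: "C > 0" "\<And>n. n > 0 \<Longrightarrow> \<bar>zeta_inv_coeff k n\<bar> \<le> C * real n powr eta"
    using zeta_inv_coeff_bound[of eta k] \<sigma> by (auto simp: eta_def)
  have "(\<lambda>n. norm (zeta_inv_coeff k n ^ 2 * real n powr (-\<sigma>))) summable_on {0<..}"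
  proof (rule abs_summable_comparison)
    show "(\<lambda>n. C ^ 2 * real n powr (-(1 + 2 * eta))) summable_on {0<..}"
      using \<sigma> by (intro summable_on_cmult_right summable_on_nat_powr) (auto simp: eta_def)
    fix n :: nat assume n: "n \<in> {0<..}"
    have "zeta_inv_coeff k n ^ 2 \<le> (C * real n powr eta) ^ 2"
      using C(2)[of n] n by (intro power2_le_iff_abs_le[THEN iffD2]) auto
    also have "(C * real n powr eta) ^ 2 = C ^ 2 * real n powr (2 * eta)"
      by (simp add: power2_eq_square powr_add [symmetric] mult_ac)
    finally have "zeta_inv_coeff k n ^ 2 * real n powr (-\<sigma>) \<le> C ^ 2 * real n powr (2 * eta) * real n powr (-\<sigma>)"
      by (intro mult_right_mono) auto
    also have "\<dots> = C ^ 2 * real n powr (2 * eta + -\<sigma>)"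
      by (simp only: mult.assoc powr_add)
    also have "2 * eta + -\<sigma> = -(1 + 2 * eta)" by (simp add: eta_def field_simps)
    finally show "norm (zeta_inv_coeff k n ^ 2 * real n powr (-\<sigma>)) \<le> C ^ 2 * real n powr (-(1 + 2 * eta))"
      by simp
  qed
  thus ?thesis by simp
qed

text \<open>By the binomial theorem the factor at \<open>p\<close> of the first series is
  \<open>(1 - h p) ^ k\<close>, which cancels the k-th power of the factor of \<open>h\<close>.
  Stated as a product equal to 1, the result also yields non-vanishing.\<close>

lemma zeta_inv_coeff_inverse:
  fixes h :: "nat \<Rightarrow> complex"
  assumes h1: "h 1 = 1" and hmult: "\<And>m n. h (m * n) = h m * h n"
    and \<sigma>: "\<sigma> > 1" and hbound: "\<And>n. n > 0 \<Longrightarrow> norm (h n) \<le> real n powr (-\<sigma>)"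
  shows "(\<Sum>\<^sub>\<infinity>n\<in>{0<..}. of_real (zeta_inv_coeff k n) * h n) * (\<Sum>\<^sub>\<infinity>n\<in>{0<..}. h n) ^ k = 1"
proof -
  have hs: "(\<lambda>n. norm (h n)) summable_on {0<..}"
    by (rule abs_summable_comparison[OF summable_on_nat_powr[OF \<sigma>]]) (use hbound in auto)
  let ?f = "\<lambda>n. of_real (zeta_inv_coeff k n) * h n"
  have fs: "(\<lambda>n. norm (?f n)) summable_on {0<..}"
    by (rule abs_summable_comparison[OF summable_on_zeta_inv_coeff[OF \<sigma>]])
       (use hbound in \<open>auto simp: norm_mult intro!: mult_left_mono\<close>)
  have f1: "?f 1 = 1" using h1 by simp
  have "(\<lambda>N. \<Prod>p | prime p \<and> p \<le> N. \<Sum>\<^sub>\<infinity>j. ?f (p ^ j)) \<longlonglongrightarrow> (\<Sum>\<^sub>\<infinity>n\<in>{0<..}. ?f n)"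
    by (rule euler_product[OF f1 _ fs]) (simp add: zeta_inv_coeff_mult hmult)
  moreover have "(\<Sum>\<^sub>\<infinity>j. ?f (p ^ j)) = (1 - h p) ^ k" if p: "prime p" for p
  proof -
    have "(\<Sum>\<^sub>\<infinity>j. ?f (p ^ j)) = (\<Sum>\<^sub>\<infinity>j\<in>{..k}. ?f (p ^ j))"
      by (rule infsum_cong_neutral) (auto simp: zeta_inv_coeff_prime_power[OF p])
    also have "\<dots> = (\<Sum>j\<le>k. of_nat (k choose j) * (- h p) ^ j * 1 ^ (k - j))"
      using completely_mult_power[OF h1 hmult hs]
      by (simp add: zeta_inv_coeff_prime_power[OF p] power_minus [of "h p"] mult_ac)
    also have "\<dots> = (- h p + 1) ^ k" by (rule binomial_ring [symmetric])
    finally show ?thesis by simp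
  qed
  hence "(\<Prod>p | prime p \<and> p \<le> N. \<Sum>\<^sub>\<infinity>j. ?f (p ^ j)) = (\<Prod>p | prime p \<and> p \<le> N. (1 - h p) ^ k)" for N
    by (intro prod.cong) auto
  ultimately have lim: "(\<lambda>N. (\<Prod>p | prime p \<and> p \<le> N. (1 - h p) ^ k) * (\<Prod>p | prime p \<and> p \<le> N. 1 / (1 - h p)) ^ k)
      \<longlonglongrightarrow> (\<Sum>\<^sub>\<infinity>n\<in>{0<..}. ?f n) * (\<Sum>\<^sub>\<infinity>n\<in>{0<..}. h n) ^ k"
    using completely_mult_euler[OF h1 hmult hs] by (intro tendsto_intros) auto
  have "(\<Prod>p | prime p \<and> p \<le> N. (1 - h p) ^ k) * (\<Prod>p | prime p \<and> p \<le> N. 1 / (1 - h p)) ^ k = 1" for N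
  proof -
    have "(\<Prod>p | prime p \<and> p \<le> N. (1 - h p) ^ k) * (\<Prod>p | prime p \<and> p \<le> N. 1 / (1 - h p)) ^ k
        = (\<Prod>p | prime p \<and> p \<le> N. ((1 - h p) * (1 / (1 - h p))) ^ k)"
      by (simp only: prod_power_distrib power_mult_distrib prod.distrib)
    also have "\<dots> = (\<Prod>p | prime p \<and> p \<le> N. 1)"
    proof (intro prod.cong refl)
      fix p assume "p \<in> {p. prime p \<and> p \<le> N}"
      hence "norm (h p) < 1" using completely_mult_norm_less_1[OF h1 hmult hs, of p] by simp
      hence "1 - h p \<noteq> 0" by auto
      thus "((1 - h p) * (1 / (1 - h p))) ^ k = 1" by simp
    qed
    finally show ?thesis by simp
  qed
  with lim show ?thesis by (simp add: LIMSEQ_const_iff)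
qed

section \<open>The Euler product of the main term\<close>

lemma local_factor_ge_1: "local_factor k p \<ge> 1"
proof -
  have "(\<Sum>j\<in>{0}. real (k choose j) ^ 2 / real p ^ (2 * j)) \<le> local_factor k p"
    unfolding local_factor_def by (intro sum_mono2) auto
  thus ?thesis by simp
qed

text \<open>The limit of the diagonal of the second moment as the Poisson weights tend to 1; it is
  the main term divided by the totient.\<close>

definition coprime_mass :: "nat \<Rightarrow> nat \<Rightarrow> real" where
  "coprime_mass k q = (\<Sum>\<^sub>\<infinity>n\<in>{0<..}. if coprime n q then zeta_inv_coeff k n ^ 2 / real n ^ 2 else 0)"

lemma summable_on_coprime_mass:
  "(\<lambda>n. if coprime n q then zeta_inv_coeff k n ^ 2 / real n ^ 2 else 0) summable_on {0<..}"
proof -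
  have "(\<lambda>n. norm (if coprime n q then zeta_inv_coeff k n ^ 2 / real n ^ 2 else 0)) summable_on {0<..}"
  proof (rule abs_summable_comparison)
    show "(\<lambda>n. zeta_inv_coeff k n ^ 2 * real n powr (-2)) summable_on {0<..}"
      by (rule summable_on_zeta_inv_coeff_sq) simp
  qed (auto simp: powr_minus powr_numeral divide_inverse)
  thus ?thesis by (rule abs_summable_summable)
qed

lemma coprime_mass_ge_1: "coprime_mass k q \<ge> 1"
proof -
  have "(\<Sum>n\<in>{1}. if coprime n q then zeta_inv_coeff k n ^ 2 / real n ^ 2 else 0) \<le> coprime_mass k q"
    unfolding coprime_mass_def
    by (rule finite_sum_le_infsum[OF summable_on_coprime_mass]) auto
  thus ?thesis by simp
qed

text \<open>Squaring removes the signs, so a prime not dividing \<open>q\<close> contributes the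
  finite sum in \<open>local_factor\<close>, while a prime dividing \<open>q\<close> keeps only its
  zeroth power.\<close>

lemma coprime_mass_euler:
  "(\<lambda>N. \<Prod>p | prime p \<and> p \<le> N. if p dvd q then 1 else local_factor k p) \<longlonglongrightarrow> coprime_mass k q"
proof -
  let ?f = "\<lambda>n. if coprime n q then zeta_inv_coeff k n ^ 2 / real n ^ 2 else 0"
  have "(\<lambda>N. \<Prod>p | prime p \<and> p \<le> N. \<Sum>\<^sub>\<infinity>j. ?f (p ^ j)) \<longlonglongrightarrow> (\<Sum>\<^sub>\<infinity>n\<in>{0<..}. ?f n)"
  proof (rule euler_product)
    show "(\<lambda>n. norm (?f n)) summable_on {0<..}"
      using summable_on_coprime_mass[of q k] by (subst (asm) summable_on_iff_abs_summable_on_real)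
  qed (auto simp: zeta_inv_coeff_mult power_mult_distrib)
  moreover have "(\<Sum>\<^sub>\<infinity>j. ?f (p ^ j)) = (if p dvd q then 1 else local_factor k p)" if p: "prime p" for p
  proof (cases "p dvd q")
    case True
    have "coprime (p ^ j) q \<longleftrightarrow> j = 0" for j
      using True p by (auto simp: coprime_power_left_iff dest: coprime_common_divisor [of p q p])
    hence "(\<Sum>\<^sub>\<infinity>j. ?f (p ^ j)) = (\<Sum>\<^sub>\<infinity>j\<in>{0}. ?f (p ^ j))"
      by (intro infsum_cong_neutral) auto
    thus ?thesis using True by simp
  next
    case False
    hence cop: "coprime p q" using p by (simp add: prime_imp_coprime)
    have "(\<Sum>\<^sub>\<infinity>j. ?f (p ^ j)) = (\<Sum>\<^sub>\<infinity>j\<in>{0..k}. ?f (p ^ j))"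
      by (rule infsum_cong_neutral) (auto simp: zeta_inv_coeff_prime_power[OF p])
    also have "\<dots> = local_factor k p"
      by (simp add: local_factor_def cop zeta_inv_coeff_prime_power[OF p] power_mult_distrib
            power_mult [symmetric] mult.commute [of 2])
    finally show ?thesis using False by simp
  qed
  hence "(\<Prod>p | prime p \<and> p \<le> N. \<Sum>\<^sub>\<infinity>j. ?f (p ^ j)) =
           (\<Prod>p | prime p \<and> p \<le> N. if p dvd q then 1 else local_factor k p)" for N
    by (intro prod.cong) auto
  ultimately show ?thesis unfolding coprime_mass_def by simp
qed

text \<open>\<open>prodinf\<close> carries information only for a convergent product, and
  convergence of a product includes a nonzero limit; \<open>coprime_mass_ge_1\<close> supplies
  this.\<close>

lemma C_const_eq: "C_const k = coprime_mass k 1"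
proof -
  let ?g = "\<lambda>n. if prime n then local_factor k n else 1"
  have "(\<Prod>n\<le>N. ?g n) = (\<Prod>p | prime p \<and> p \<le> N. if p dvd 1 then 1 else local_factor k p)" for N
  proof -
    have "(\<Prod>n\<le>N. ?g n) = (\<Prod>p | prime p \<and> p \<le> N. ?g p)"
      by (rule prod.mono_neutral_right) auto
    also have "\<dots> = (\<Prod>p | prime p \<and> p \<le> N. if p dvd 1 then 1 else local_factor k p)"
      by (intro prod.cong) auto
    finally show ?thesis .
  qed
  hence lim: "(\<lambda>N. \<Prod>n\<le>N. ?g n) \<longlonglongrightarrow> coprime_mass k 1"
    using coprime_mass_euler[of 1 k] by simp
  have nz: "?g n \<noteq> 0" for n using local_factor_ge_1[of k n] by auto
  have "convergent_prod ?g"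
    using lim coprime_mass_ge_1[of k 1] by (subst convergent_prod_iff_nz_lim[OF nz]) force
  hence "(\<lambda>N. \<Prod>n\<le>N. ?g n) \<longlonglongrightarrow> prodinf ?g" by (rule convergent_prod_LIMSEQ)
  thus ?thesis unfolding C_const_def using lim LIMSEQ_unique by blast
qed

text \<open>Once N is at least \<open>q\<close>, the finite product over the primes dividing
  \<open>q\<close> restores exactly the factors missing from the partial product.\<close>

lemma coprime_mass_eq:
  assumes q: "q > 0"
  shows "coprime_mass k q = C_const k / (\<Prod>p\<in>prime_factors q. local_factor k p)"
proof -
  let ?P = "\<Prod>p\<in>prime_factors q. local_factor k p"
  have "(\<lambda>N. (\<Prod>p | prime p \<and> p \<le> N. if p dvd q then 1 else local_factor k p) * ?P)
      \<longlonglongrightarrow> coprime_mass k q * ?P"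
    by (intro tendsto_intros coprime_mass_euler)
  moreover have "\<forall>\<^sub>F N in sequentially.
      (\<Prod>p | prime p \<and> p \<le> N. if p dvd q then 1 else local_factor k p) * ?P =
      (\<Prod>p | prime p \<and> p \<le> N. if p dvd 1 then 1 else local_factor k p)"
    using eventually_ge_at_top[of q]
  proof eventually_elim
    case (elim N)
    have sub: "prime_factors q \<subseteq> {p. prime p \<and> p \<le> N}"
      using q elim by (auto simp: in_prime_factors_iff intro: order_trans dvd_imp_le)
    have "?P = (\<Prod>p | prime p \<and> p \<le> N. if p dvd q then local_factor k p else 1)"
      using sub q by (intro prod.mono_neutral_cong_left) (auto simp: in_prime_factors_iff)
    hence "(\<Prod>p | prime p \<and> p \<le> N. if p dvd q then 1 else local_factor k p) * ?P =
       (\<Prod>p | prime p \<and> p \<le> N. (if p dvd q then 1 else local_factor k p) * (if p dvd q then local_factor k p else 1))"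
      by (simp add: prod.distrib)
    also have "\<dots> = (\<Prod>p | prime p \<and> p \<le> N. if p dvd 1 then 1 else local_factor k p)"
      by (intro prod.cong) auto
    finally show ?case .
  qed
  ultimately have "(\<lambda>N. \<Prod>p | prime p \<and> p \<le> N. if p dvd 1 then 1 else local_factor k p)
      \<longlonglongrightarrow> coprime_mass k q * ?P"
    by (rule Lim_transform_eventually)
  hence "coprime_mass k q * ?P = C_const k"
    using coprime_mass_euler[of 1 k] LIMSEQ_unique unfolding C_const_eq by blast
  moreover have "?P > 0"
    using local_factor_ge_1 by (intro prod_pos) (meson less_le_trans zero_less_one)
  ultimately show ?thesis by (metis nonzero_eq_divide_eq less_irrefl)
qed

section \<open>Analytic continuation by partial summation\<close>

lemma norm_nat_powr: "n > 0 \<Longrightarrow> norm (of_nat n powr (s::complex)) = real n powr Re s"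
  by (simp add: norm_powr_real_powr)

lemma summable_nat_powr:
  assumes "\<sigma> > 1"
  shows "summable (\<lambda>n. real n powr (-\<sigma>))"
  using assms by (simp add: summable_real_powr_iff)

text \<open>Mean value inequality along a segment of the positive real axis, where the modulus of
  the derivative is largest at the left end \<open>n\<close>.\<close>

lemma norm_powr_diff_le:
  assumes n: "n > 0" and x: "real n \<le> x" "x \<le> real n + 1" and s: "Re s > 0"
  shows "norm (of_real x powr (-s) - of_nat n powr (-s)) \<le> norm s * real n powr (-Re s - 1)"
proof -
  let ?S = "closed_segment (of_nat n) (of_real x) :: complex set"
  have "norm (of_real x powr (-s) - of_nat n powr (-s)) \<le>
          norm s * real n powr (-Re s - 1) * norm (of_real x - of_nat n :: complex)"
  proof (rule field_differentiable_bound[of ?S])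
    fix z assume "z \<in> ?S"
    hence "z \<in> closed_segment (of_real (real n)) (of_real x)" by simp
    then obtain y where y: "z = of_real y" "real n \<le> y" "y \<le> x"
      unfolding closed_segment_of_real using x by (auto simp: closed_segment_eq_real_ivl)
    have y0: "y > 0" using y n by simp
    have zn: "z \<notin> \<real>\<^sub>\<le>\<^sub>0" using y y0 by (simp add: complex_nonpos_Reals_iff)
    show "((\<lambda>z. z powr (-s)) has_field_derivative -s * z powr (-s - 1)) (at z within ?S)"
      using zn by (auto intro!: derivative_eq_intros)
    have "norm (-s * z powr (-s - 1)) = norm s * y powr (-Re s - 1)"
      using y y0 by (simp add: norm_mult norm_powr_real_powr)
    also have "\<dots> \<le> norm s * real n powr (-Re s - 1)"
      using y n s by (intro mult_left_mono powr_mono2') auto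
    finally show "norm (-s * z powr (-s - 1)) \<le> norm s * real n powr (-Re s - 1)" .
  qed auto
  also have "norm (of_real x - of_nat n :: complex) = x - real n"
  proof -
    have "(of_real x - of_nat n :: complex) = of_real (x - real n)" by simp
    thus ?thesis using x by (metis norm_of_real abs_of_nonneg diff_ge_0_iff_ge)
  qed
  also have "norm s * real n powr (-Re s - 1) * (x - real n) \<le> norm s * real n powr (-Re s - 1) * 1"
    using x by (intro mult_left_mono) auto
  finally show ?thesis by simp
qed

text \<open>Polynomial growth in \<open>s\<close> is harmless, since uniform convergence is needed
  only on small closed discs. Degree 2 is what \<open>zeta_term\<close> requires.\<close>

lemma holomorphic_on_suminf_half_plane:
  fixes t :: "nat \<Rightarrow> complex \<Rightarrow> complex"
  assumes hol: "\<And>n. t n holomorphic_on {s. Re s > 0}"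
    and bound: "\<And>n s. Re s > 0 \<Longrightarrow> norm (t n s) \<le> B * (1 + norm s) ^ 2 * real n powr (-Re s - 1)"
    and B: "B \<ge> 0"
  shows "(\<lambda>s. \<Sum>n. t n s) holomorphic_on {s. Re s > 0}"
proof (rule holomorphic_uniform_sequence[where f = "\<lambda>N s. \<Sum>n<N. t n s"])
  show "open {s. 0 < Re s}" by (rule open_halfspace_Re_gt)
  show "(\<lambda>s. \<Sum>n<N. t n s) holomorphic_on {s. Re s > 0}" for N
    by (intro holomorphic_intros hol)
  fix x :: complex assume "x \<in> {s. 0 < Re s}"
  hence x: "Re x > 0" by simp
  define d where "d = Re x / 2"
  have d: "d > 0" using x by (simp add: d_def)
  have Re: "Re s \<ge> d" if "s \<in> cball x d" for s
  proof -
    have "\<bar>Re (x - s)\<bar> \<le> d" using that abs_Re_le_cmod[of "x - s"] by (simp add: dist_norm)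
    hence "Re x - Re s \<le> d" by simp
    thus ?thesis unfolding d_def by linarith
  qed
  define M where "M = B * (1 + (norm x + d)) ^ 2"
  have "uniform_limit (cball x d) (\<lambda>N s. \<Sum>n<N. t n s) (\<lambda>s. \<Sum>n. t n s) sequentially"
  proof (rule Weierstrass_m_test)
    show "summable (\<lambda>n. M * real n powr (-(d + 1)))"
      using d by (intro summable_mult summable_nat_powr) auto
    fix n s assume s: "s \<in> cball x d"
    have "norm s \<le> norm x + d"
      using s norm_triangle_ineq2[of s x] by (simp add: dist_norm norm_minus_commute)
    hence 1: "B * (1 + norm s) ^ 2 \<le> M"
      unfolding M_def using B by (intro mult_left_mono power_mono) auto
    have 2: "real n powr (-Re s - 1) \<le> real n powr (-(d + 1))"
    proof (cases "n = 0")
      case False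
      thus ?thesis using Re[OF s] by (intro powr_mono) auto
    qed auto
    have "norm (t n s) \<le> B * (1 + norm s) ^ 2 * real n powr (-Re s - 1)"
      using Re[OF s] d by (intro bound) auto
    also have "\<dots> \<le> M * real n powr (-(d + 1))"
      using 1 2 B by (intro mult_mono) (auto simp: M_def)
    finally show "norm (t n s) \<le> M * real n powr (-(d + 1))" .
  qed
  moreover have "cball x d \<subseteq> {s. Re s > 0}" using Re d by fastforce
  ultimately show "\<exists>d>0. cball x d \<subseteq> {s. 0 < Re s} \<and>
      uniform_limit (cball x d) (\<lambda>N s. \<Sum>n<N. t n s) (\<lambda>s. \<Sum>n. t n s) sequentially"
    using d by blast
qed

text \<open>Partial summation turns a Dirichlet series with bounded partial coefficient sums
  into a series that converges absolutely for \<open>Re s > 0\<close>.\<close>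

definition abel_term :: "(nat \<Rightarrow> complex) \<Rightarrow> nat \<Rightarrow> complex \<Rightarrow> complex" where
  "abel_term c n s = (\<Sum>r=1..n. c r) * (of_nat n powr (-s) - of_nat (Suc n) powr (-s))"

context
  fixes c :: "nat \<Rightarrow> complex" and K :: real
  assumes K: "\<And>n. norm (\<Sum>r=1..n. c r) \<le> K"
begin

lemma norm_abel_term:
  assumes s: "Re s > 0"
  shows "norm (abel_term c n s) \<le> K * norm s * real n powr (-Re s - 1)"
proof (cases "n = 0")
  case False
  have "norm (of_nat n powr (-s) - of_nat (Suc n) powr (-s)) \<le> norm s * real n powr (-Re s - 1)"
    using norm_powr_diff_le[of n "real n + 1" s] False s
    by (simp add: norm_minus_commute add.commute)
  hence "norm (abel_term c n s) \<le> K * (norm s * real n powr (-Re s - 1))"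
    unfolding abel_term_def norm_mult using K[of 0] by (intro mult_mono K) auto
  thus ?thesis by (simp add: mult.assoc)
qed (simp add: abel_term_def)

lemma summable_norm_abel_term: "Re s > 0 \<Longrightarrow> summable (\<lambda>n. norm (abel_term c n s))"
proof (rule summable_comparison_test)
  assume s: "Re s > 0"
  show "\<exists>N. \<forall>n\<ge>N. norm (norm (abel_term c n s)) \<le> K * norm s * real n powr (-(Re s + 1))"
    using norm_abel_term[OF s] by (intro exI[of _ 0] allI impI) simp
  show "summable (\<lambda>n. K * norm s * real n powr (-(Re s + 1)))"
    using s by (intro summable_mult summable_nat_powr) auto
qed

lemma abel_sums:
  assumes s: "Re s > 0"
  shows "(\<lambda>N. \<Sum>n=1..N. c n * of_nat n powr (-s)) \<longlonglongrightarrow> (\<Sum>n. abel_term c n s)"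
proof -
  have eq: "(\<Sum>n=1..N. c n * of_nat n powr (-s)) =
      (\<Sum>n<Suc N. abel_term c n s) + (\<Sum>r=1..N. c r) * of_nat (Suc N) powr (-s)" for N
  proof (induction N)
    case 0
    show ?case by (simp add: abel_term_def)
  next
    case (Suc N)
    have "(\<Sum>n=1..Suc N. c n * of_nat n powr (-s)) =
        (\<Sum>n<Suc N. abel_term c n s) + (\<Sum>r=1..N. c r) * of_nat (Suc N) powr (-s) +
          c (Suc N) * of_nat (Suc N) powr (-s)"
      using Suc by simp
    also have "\<dots> = (\<Sum>n<Suc (Suc N). abel_term c n s) + (\<Sum>r=1..Suc N. c r) * of_nat (Suc (Suc N)) powr (-s)"
      by (simp add: abel_term_def algebra_simps)
    finally show ?case .
  qed
  have "(\<lambda>N. \<Sum>n<N. abel_term c n s) \<longlonglongrightarrow> (\<Sum>n. abel_term c n s)"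
    by (rule summable_LIMSEQ[OF summable_norm_cancel[OF summable_norm_abel_term[OF s]]])
  hence 1: "(\<lambda>N. \<Sum>n<Suc N. abel_term c n s) \<longlonglongrightarrow> (\<Sum>n. abel_term c n s)"
    by (rule LIMSEQ_Suc)
  have 2: "(\<lambda>N. (\<Sum>r=1..N. c r) * of_nat (Suc N) powr (-s)) \<longlonglongrightarrow> 0"
  proof (rule Lim_null_comparison)
    show "\<forall>\<^sub>F N in sequentially. norm ((\<Sum>r=1..N. c r) * of_nat (Suc N) powr (-s)) \<le> K * real (Suc N) powr (-Re s)"
    proof (intro always_eventually allI)
      fix N
      have "norm (of_nat (Suc N) powr (-s)) = real (Suc N) powr (-Re s)"
        by (subst norm_nat_powr) auto
      thus "norm ((\<Sum>r=1..N. c r) * of_nat (Suc N) powr (-s)) \<le> K * real (Suc N) powr (-Re s)"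
        using mult_right_mono[OF K[of N], of "real (Suc N) powr (-Re s)"]
        by (simp add: norm_mult del: of_nat_Suc)
    qed
    have "(\<lambda>N. K * real (Suc N) powr (-Re s)) \<longlonglongrightarrow> K * 0"
      using s by (intro tendsto_mult tendsto_const LIMSEQ_Suc tendsto_neg_powr filterlim_real_sequentially) auto
    thus "(\<lambda>N. K * real (Suc N) powr (-Re s)) \<longlonglongrightarrow> 0" by simp
  qed
  show ?thesis unfolding eq using tendsto_add[OF 1 2] by simp
qed

lemma holomorphic_abel: "(\<lambda>s. \<Sum>n. abel_term c n s) holomorphic_on {s. Re s > 0}"
proof (rule holomorphic_on_suminf_half_plane[where B = K])
  show "K \<ge> 0" using K[of 0] by simp
  fix n
  show "abel_term c n holomorphic_on {s. Re s > 0}"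
  proof (cases "n = 0")
    case True
    thus ?thesis by (simp add: abel_term_def [abs_def])
  next
    case False
    have "complex_of_nat n \<noteq> 0" "complex_of_nat (Suc n) \<noteq> 0" using False by (auto simp del: of_nat_Suc)
    thus ?thesis unfolding abel_term_def [abs_def] by (intro holomorphic_intros) auto
  qed
  fix s assume s: "Re s > 0"
  have "norm s \<le> (1 + norm s) ^ 2" by (simp add: power2_eq_square algebra_simps)
  hence "K * norm s * real n powr (-Re s - 1) \<le> K * (1 + norm s) ^ 2 * real n powr (-Re s - 1)"
    using \<open>K \<ge> 0\<close> by (intro mult_right_mono mult_left_mono) auto
  with norm_abel_term[OF s, of n] show "norm (abel_term c n s) \<le> K * (1 + norm s) ^ 2 * real n powr (-Re s - 1)"
    by linarith
qed

text \<open>To the right of Re s = 1/2 the exponent \<open>-Re s - 1\<close> is at most -3/2, so a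
  single constant serves. For characters this is the upper bound, linear in \<open>q\<close>, that
  enters the Borel-Caratheodory argument.\<close>

lemma norm_abel_le:
  assumes s: "Re s \<ge> 1 / 2"
  shows "norm (\<Sum>n. abel_term c n s) \<le> K * norm s * (\<Sum>n. real n powr (-(3/2)))"
proof -
  have K0: "K \<ge> 0" using K[of 0] by simp
  have sm: "summable (\<lambda>n. norm (abel_term c n s))" using s by (intro summable_norm_abel_term) auto
  have "norm (\<Sum>n. abel_term c n s) \<le> (\<Sum>n. norm (abel_term c n s))" by (rule summable_norm[OF sm])
  also have "\<dots> \<le> (\<Sum>n. K * norm s * real n powr (-(3/2)))"
  proof (rule suminf_le[OF _ sm])
    show "summable (\<lambda>n. K * norm s * real n powr (-(3/2)))"
      by (intro summable_mult summable_nat_powr) auto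
    fix n
    have "real n powr (-Re s - 1) \<le> real n powr (-(3/2))"
      using s by (cases "n = 0") (auto intro!: powr_mono)
    hence "K * norm s * real n powr (-Re s - 1) \<le> K * norm s * real n powr (-(3/2))"
      using K0 by (intro mult_left_mono) auto
    moreover have "norm (abel_term c n s) \<le> K * norm s * real n powr (-Re s - 1)"
      using s by (intro norm_abel_term) auto
    ultimately show "norm (abel_term c n s) \<le> K * norm s * real n powr (-(3/2))" by linarith
  qed
  also have "\<dots> = K * norm s * (\<Sum>n. real n powr (-(3/2)))"
    by (rule suminf_mult) (rule summable_nat_powr, simp)
  finally show ?thesis .
qed

end

text \<open>For n > 0 this is s - 1 times the integral of n^(-s) - x^(-s) over [n, n+1]. Comparison
  with the integral removes the pole of zeta and gives convergence for Re s > 0.\<close>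

definition zeta_term :: "nat \<Rightarrow> complex \<Rightarrow> complex" where
  "zeta_term n s = (if n = 0 then 0 else
     (s - 1) * of_nat n powr (-s) - (of_nat n powr (1 - s) - of_nat (Suc n) powr (1 - s)))"

text \<open>The function \<open>(s - 1) \<zeta>(s)\<close>, continued to \<open>Re s > 0\<close>.\<close>

definition zeta_reg :: "complex \<Rightarrow> complex" where
  "zeta_reg s = 1 + (\<Sum>n. zeta_term n s)"

lemma norm_zeta_term:
  assumes s: "Re s > 0"
  shows "norm (zeta_term n s) \<le> norm (s - 1) * norm s * real n powr (-Re s - 1)"
proof (cases "n = 0")
  case False
  \<comment> \<open>\<open>g\<close> is chosen so that its increment from n to n + 1 is the term,
    while its derivative vanishes at n.\<close>
  define g where "g z = z powr (1 - s) + (s - 1) * of_nat n powr (-s) * z" for z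
  let ?S = "closed_segment (of_nat n) (of_nat (Suc n)) :: complex set"
  have "norm (g (of_nat (Suc n)) - g (of_nat n)) \<le>
     norm (s - 1) * (norm s * real n powr (-Re s - 1)) * norm (of_nat (Suc n) - of_nat n :: complex)"
  proof (rule field_differentiable_bound[of ?S])
    fix z assume "z \<in> ?S"
    hence "z \<in> closed_segment (of_real (real n)) (of_real (real (Suc n)))" by simp
    then obtain y where y: "z = of_real y" "real n \<le> y" "y \<le> real n + 1"
      unfolding closed_segment_of_real by (auto simp: closed_segment_eq_real_ivl)
    have y0: "y > 0" using y False by simp
    have zn: "z \<notin> \<real>\<^sub>\<le>\<^sub>0" using y y0 by (simp add: complex_nonpos_Reals_iff)
    show "(g has_field_derivative (1 - s) * (z powr (-s) - of_nat n powr (-s))) (at z within ?S)"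
      unfolding g_def [abs_def] using zn by (auto intro!: derivative_eq_intros simp: algebra_simps)
    show "norm ((1 - s) * (z powr (-s) - of_nat n powr (-s))) \<le> norm (s - 1) * (norm s * real n powr (-Re s - 1))"
      unfolding norm_mult y(1) using norm_powr_diff_le[of n y s] y False s
      by (intro mult_mono) (auto simp: norm_minus_commute)
  qed auto
  moreover have "g (of_nat (Suc n)) - g (of_nat n) = zeta_term n s"
    using False by (simp add: g_def zeta_term_def algebra_simps)
  ultimately show ?thesis by (simp add: mult.assoc)
qed (simp add: zeta_term_def)

lemma holomorphic_zeta_reg: "zeta_reg holomorphic_on {s. Re s > 0}"
  unfolding zeta_reg_def [abs_def]
proof (intro holomorphic_intros holomorphic_on_suminf_half_plane[where B = 1])
  fix n
  show "zeta_term n holomorphic_on {s. Re s > 0}"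
  proof (cases "n = 0")
    case False
    have "complex_of_nat n \<noteq> 0" "complex_of_nat (Suc n) \<noteq> 0" using False by (auto simp del: of_nat_Suc)
    thus ?thesis using False unfolding zeta_term_def [abs_def] by (auto intro!: holomorphic_intros simp del: of_nat_Suc)
  qed (simp add: zeta_term_def [abs_def])
  fix s assume s: "Re s > 0"
  have "norm (s - 1) \<le> 1 + norm s" using norm_triangle_ineq4[of s 1] by simp
  hence "norm (s - 1) * norm s \<le> (1 + norm s) * (1 + norm s)" by (intro mult_mono) auto
  hence "norm (s - 1) * norm s * real n powr (-Re s - 1) \<le> (1 + norm s) ^ 2 * real n powr (-Re s - 1)"
    by (intro mult_right_mono) (auto simp: power2_eq_square)
  with norm_zeta_term[OF s, of n] show "norm (zeta_term n s) \<le> 1 * (1 + norm s) ^ 2 * real n powr (-Re s - 1)"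
    by simp
qed auto

lemma zeta_reg_eq:
  assumes s: "Re s > 1" and S: "(\<lambda>n. of_nat n powr (-s)) sums S"
  shows "zeta_reg s = (s - 1) * S"
proof -
  \<comment> \<open>Setting \<open>a 0\<close> equal to \<open>a 1\<close> makes the difference at n
    = 0 vanish like \<open>zeta_term 0 s\<close>; the telescoping sum is then 1, which the summand 1
    in \<open>zeta_reg\<close> compensates.\<close>
  define a where "a n = (if n = 0 then 1 else of_nat n powr (1 - s))" for n :: nat
  have lim: "a \<longlonglongrightarrow> 0"
  proof (rule Lim_null_comparison)
    show "\<forall>\<^sub>F n in sequentially. norm (a n) \<le> real n powr (1 - Re s)"
      using eventually_gt_at_top[of 0]
      by eventually_elim (simp add: a_def norm_nat_powr)
    show "(\<lambda>n. real n powr (1 - Re s)) \<longlonglongrightarrow> 0"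
      using s by (intro tendsto_neg_powr filterlim_real_sequentially) auto
  qed
  have "(\<lambda>n. a n - a (Suc n)) sums (a 0 - 0)" by (rule telescope_sums'[OF lim])
  hence "(\<lambda>n. (s - 1) * of_nat n powr (-s) - (a n - a (Suc n))) sums ((s - 1) * S - (a 0 - 0))"
    by (rule sums_diff[OF sums_mult[OF S]])
  moreover have "(s - 1) * of_nat n powr (-s) - (a n - a (Suc n)) = zeta_term n s" for n
    by (auto simp: zeta_term_def a_def)
  moreover have "a 0 = 1" by (simp add: a_def)
  ultimately have "(\<lambda>n. zeta_term n s) sums ((s - 1) * S - 1)" by simp
  thus ?thesis by (simp add: zeta_reg_def sums_unique [symmetric])
qed

section \<open>Taylor coefficients of general Dirichlet series\<close>

lemma power_series_coeff_unique:
  fixes F :: "complex \<Rightarrow> complex"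
  assumes "r > 0" and "\<And>u. norm u < r \<Longrightarrow> (\<lambda>j. b j * u ^ j) sums F u"
  shows "b j = (deriv ^^ j) F 0 / fact j"
proof -
  have "F has_fps_expansion Abs_fps b"
  proof (rule has_fps_expansionI)
    show "\<forall>\<^sub>F u in nhds 0. (\<lambda>n. fps_nth (Abs_fps b) n * u ^ n) sums F u"
      using eventually_nhds_in_open[of "ball 0 r" 0] assms(1)
      by (auto elim!: eventually_mono simp: assms(2))
  qed
  from fps_nth_fps_expansion[OF this, of j] show ?thesis by simp
qed

text \<open>Taylor coefficients at s = 2, in the variable u = 2 - s, of the general Dirichlet series
  with coefficients \<open>c i\<close> and frequencies \<open>lam i\<close>. With this sign of the
  variable, nonnegative \<open>c\<close> and \<open>lam\<close> give nonnegative Taylor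
  coefficients. The index type is free because both positive integers and prime powers are
  used.\<close>

definition dirichlet_taylor :: "'i set \<Rightarrow> ('i \<Rightarrow> complex) \<Rightarrow> ('i \<Rightarrow> real) \<Rightarrow> nat \<Rightarrow> complex" where
  "dirichlet_taylor I c lam j =
     (\<Sum>\<^sub>\<infinity>i\<in>I. c i * of_real (exp (-2 * lam i) * lam i ^ j / fact j))"

lemma has_sum_exp_real: "((\<lambda>j. x ^ j / fact j) has_sum exp (x::real)) UNIV"
proof (rule norm_summable_imp_has_sum)
  have "summable (\<lambda>j. \<bar>x\<bar> ^ j /\<^sub>R fact j)" by (rule summable_exp_generic)
  thus "summable (\<lambda>n. norm (x ^ n / fact n))" by (simp add: divide_inverse mult.commute power_abs abs_mult)
  show "(\<lambda>j. x ^ j / fact j) sums exp x"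
    using exp_converges[of x] by (simp add: divide_inverse mult.commute)
qed

lemma has_sum_exp_complex: "((\<lambda>j. x ^ j / fact j) has_sum exp (x::complex)) UNIV"
proof (rule norm_summable_imp_has_sum)
  have "summable (\<lambda>j. (norm x) ^ j /\<^sub>R fact j)" by (rule summable_exp_generic)
  thus "summable (\<lambda>n. norm (x ^ n / fact n))"
    by (simp add: divide_inverse mult.commute norm_mult norm_power norm_inverse)
  show "(\<lambda>j. x ^ j / fact j) sums exp x"
    using exp_converges[of x] by (simp add: scaleR_conv_of_real divide_inverse mult.commute)
qed

text \<open>Expanding each exponential in powers of \<open>u\<close> gives a double series. Taken
  with absolute values it is the series at 2 - norm u > 1, so the order of summation may be
  changed.\<close>

lemma dirichlet_series_sums:
  fixes c :: "'i \<Rightarrow> complex"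
  assumes lam: "\<And>i. i \<in> I \<Longrightarrow> lam i \<ge> 0"
    and summ: "\<And>\<sigma>. \<sigma> > 1 \<Longrightarrow> (\<lambda>i. norm (c i) * exp (- \<sigma> * lam i)) summable_on I"
    and u: "norm u < 1"
  shows "(\<lambda>j. dirichlet_taylor I c lam j * u ^ j) sums (\<Sum>\<^sub>\<infinity>i\<in>I. c i * exp (- (2 - u) * of_real (lam i)))"
proof -
  define f where "f = (\<lambda>(i, j). c i * of_real (exp (-2 * lam i)) * ((u * of_real (lam i)) ^ j / fact j))"
  have exp_eq: "exp (-2 * lam i) * exp (norm u * lam i) = exp (- (2 - norm u) * lam i)" for i
    by (simp add: exp_add [symmetric] algebra_simps)
  have abs: "(\<lambda>x. norm (f x)) summable_on I \<times> UNIV"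
    unfolding Infinite_Sum.abs_summable_on_Sigma_iff
  proof (intro conjI ballI)
    fix i assume i: "i \<in> I"
    have n: "norm (f (i, j)) = (norm (c i) * exp (-2 * lam i)) * ((norm u * lam i) ^ j / fact j)" for j
      using lam[OF i] by (simp add: f_def norm_mult norm_divide norm_power)
    have s: "((\<lambda>j. norm (f (i, j))) has_sum (norm (c i) * exp (-2 * lam i) * exp (norm u * lam i))) UNIV"
      unfolding n by (rule has_sum_cmult_right[OF has_sum_exp_real])
    thus "(\<lambda>j. norm (f (i, j))) summable_on UNIV" by (rule has_sum_imp_summable)
  next
    have eq: "norm (\<Sum>\<^sub>\<infinity>j. norm (f (i, j))) = norm (c i) * exp (- (2 - norm u) * lam i)" if i: "i \<in> I" for i
    proof -
      have n: "norm (f (i, j)) = (norm (c i) * exp (-2 * lam i)) * ((norm u * lam i) ^ j / fact j)" for j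
        using lam[OF i] by (simp add: f_def norm_mult norm_divide norm_power)
      have s: "((\<lambda>j. norm (f (i, j))) has_sum (norm (c i) * exp (-2 * lam i) * exp (norm u * lam i))) UNIV"
        unfolding n by (rule has_sum_cmult_right[OF has_sum_exp_real])
      show ?thesis using infsumI[OF s] exp_eq[of i] by (simp add: mult.assoc)
    qed
    show "(\<lambda>i. norm (\<Sum>\<^sub>\<infinity>j. norm (f (i, j)))) summable_on I"
      using summ[of "2 - norm u"] u by (subst summable_on_cong[OF eq]) auto
  qed
  hence sm: "f summable_on I \<times> UNIV" by (rule abs_summable_summable)
  define S where "S = infsum f (I \<times> UNIV)"
  have S: "(f has_sum S) (I \<times> UNIV)" unfolding S_def using sm by simp
  have "((\<lambda>i. c i * exp (- (2 - u) * of_real (lam i))) has_sum S) I"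
  proof (rule has_sum_SigmaD[OF S])
    fix i
    have "((\<lambda>j. c i * of_real (exp (-2 * lam i)) * ((u * of_real (lam i)) ^ j / fact j)) has_sum
            (c i * of_real (exp (-2 * lam i)) * exp (u * of_real (lam i)))) UNIV"
      by (rule has_sum_cmult_right[OF has_sum_exp_complex])
    also have "c i * of_real (exp (-2 * lam i)) * exp (u * of_real (lam i)) = c i * exp (- (2 - u) * of_real (lam i))"
      by (simp add: exp_of_real [symmetric] mult.assoc exp_add [symmetric] algebra_simps)
    finally show "((\<lambda>j. f (i, j)) has_sum c i * exp (- (2 - u) * of_real (lam i))) UNIV"
      by (simp add: f_def)
  qed
  hence Seq: "S = (\<Sum>\<^sub>\<infinity>i\<in>I. c i * exp (- (2 - u) * of_real (lam i)))"
    by (simp add: infsumI)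
  have S': "((\<lambda>(j, i). f (i, j)) has_sum S) (UNIV \<times> I)"
    using S by (subst (asm) has_sum_swap)
  have "((\<lambda>j. dirichlet_taylor I c lam j * u ^ j) has_sum S) UNIV"
  proof (rule has_sum_SigmaD[OF S'])
    fix j :: nat
    have "(\<lambda>(j, i). f (i, j)) summable_on (UNIV \<times> I)" using S' by (rule has_sum_imp_summable)
    hence "(\<lambda>i. f (i, j)) summable_on I"
      using summable_on_SigmaD1[of "\<lambda>j i. f (i, j)" UNIV "\<lambda>_. I" j] by simp
    hence "((\<lambda>i. f (i, j)) has_sum (\<Sum>\<^sub>\<infinity>i\<in>I. f (i, j))) I" by simp
    also have "(\<Sum>\<^sub>\<infinity>i\<in>I. f (i, j)) = (\<Sum>\<^sub>\<infinity>i\<in>I. (c i * of_real (exp (-2 * lam i) * lam i ^ j / fact j)) * u ^ j)"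
      by (simp add: f_def power_mult_distrib mult_ac)
    also have "\<dots> = dirichlet_taylor I c lam j * u ^ j"
      unfolding dirichlet_taylor_def by (rule infsum_cmult_left')
    finally show "((\<lambda>i. (\<lambda>(j, i). f (i, j)) (j, i)) has_sum dirichlet_taylor I c lam j * u ^ j) I" by simp
  qed
  thus ?thesis unfolding Seq by (rule has_sum_imp_sums)
qed

lemma dirichlet_taylor_eq_deriv:
  fixes c :: "'i \<Rightarrow> complex"
  assumes lam: "\<And>i. i \<in> I \<Longrightarrow> lam i \<ge> 0"
    and summ: "\<And>\<sigma>. \<sigma> > 1 \<Longrightarrow> (\<lambda>i. norm (c i) * exp (- \<sigma> * lam i)) summable_on I"
    and F: "\<And>u. norm u < 1 \<Longrightarrow> F u = (\<Sum>\<^sub>\<infinity>i\<in>I. c i * exp (- (2 - u) * of_real (lam i)))"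
  shows "dirichlet_taylor I c lam j = (deriv ^^ j) F 0 / fact j"
  by (rule power_series_coeff_unique[of 1]) (use dirichlet_series_sums[OF lam summ] F in auto)

section \<open>Non-vanishing on the line of real part one\<close>

text \<open>A power of \<open>lam i\<close> is, up to a constant, one term of the series of
  \<open>exp (lam i / 2)\<close>. This moves the exponent from 2 to 3/2, still within the range of
  \<open>summ\<close>.\<close>

lemma dirichlet_taylor_summable:
  fixes c :: "'i \<Rightarrow> real"
  assumes c: "\<And>i. i \<in> I \<Longrightarrow> c i \<ge> 0" and lam: "\<And>i. i \<in> I \<Longrightarrow> lam i \<ge> 0"
    and summ: "\<And>\<sigma>. \<sigma> > 1 \<Longrightarrow> (\<lambda>i. c i * exp (- \<sigma> * lam i)) summable_on I"
  shows "(\<lambda>i. c i * (exp (-2 * lam i) * lam i ^ j / fact j)) summable_on I"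
proof -
  have "(\<lambda>i. norm (c i * (exp (-2 * lam i) * lam i ^ j / fact j))) summable_on I"
  proof (rule abs_summable_comparison)
    show "(\<lambda>i. 2 ^ j * (c i * exp (- (3/2) * lam i))) summable_on I"
      by (intro summable_on_cmult_right summ) auto
    fix i assume i: "i \<in> I"
    have "((\<lambda>j. (lam i / 2) ^ j / fact j) has_sum exp (lam i / 2)) UNIV"
      by (rule has_sum_exp_real)
    hence "(\<Sum>j\<in>{j}. (lam i / 2) ^ j / fact j) \<le> exp (lam i / 2)"
      using lam[OF i] by (intro finite_sum_le_has_sum) auto
    hence "lam i ^ j / fact j \<le> 2 ^ j * exp (lam i / 2)"
      by (simp add: power_divide field_simps)
    hence "c i * exp (-2 * lam i) * (lam i ^ j / fact j) \<le> c i * exp (-2 * lam i) * (2 ^ j * exp (lam i / 2))"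
      using c[OF i] by (intro mult_left_mono) auto
    also have "\<dots> = 2 ^ j * (c i * exp (- (3/2) * lam i))"
      by (simp add: exp_add [symmetric] mult_ac)
    finally show "norm (c i * (exp (-2 * lam i) * lam i ^ j / fact j)) \<le> 2 ^ j * (c i * exp (- (3/2) * lam i))"
      using c[OF i] lam[OF i] by (simp add: mult.assoc)
  qed
  thus ?thesis by (rule abs_summable_summable)
qed

text \<open>Follows from the recursion for the derivatives given by \<open>(exp G)' = G' exp G\<close>, since \<open>exp (G 0) \<ge> 1\<close>.\<close>

lemma deriv_exp_dominates:
  fixes G D :: "complex \<Rightarrow> complex"
  assumes r: "r > 0" and hol: "G holomorphic_on ball 0 r"
    and D: "\<And>u. u \<in> ball 0 r \<Longrightarrow> D u = exp (G u)"
    and g: "\<And>n. (deriv ^^ n) G 0 = of_real (g n)" "\<And>n. g n \<ge> 0"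
  shows "\<exists>d. (deriv ^^ n) D 0 = of_real d \<and> d \<ge> 0 \<and> (n > 0 \<longrightarrow> d \<ge> g n)"
proof -
  have D': "deriv D u = deriv G u * D u" if u: "u \<in> ball 0 r" for u
  proof -
    have "(G has_field_derivative deriv G u) (at u)"
      using hol u by (meson holomorphic_derivI open_ball)
    hence "((\<lambda>u. exp (G u)) has_field_derivative exp (G u) * deriv G u) (at u)"
      by (rule DERIV_fun_exp)
    hence "(D has_field_derivative exp (G u) * deriv G u) (at u)"
      by (rule has_field_derivative_transform_within_open[OF _ open_ball u]) (use D in auto)
    thus ?thesis using D[OF u] by (simp add: DERIV_imp_deriv mult.commute)
  qed
  have holD: "D holomorphic_on ball 0 r"
    by (rule holomorphic_transform[of "\<lambda>u. exp (G u)"]) (use D hol in \<open>auto intro!: holomorphic_intros\<close>)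
  have D0: "D 0 = of_real (exp (g 0))"
    using D[of 0] g(1)[of 0] r by (simp add: exp_of_real)
  have rec: "(deriv ^^ Suc n) D 0 =
     (\<Sum>i = 0..n. of_nat (n choose i) * (deriv ^^ Suc i) G 0 * (deriv ^^ (n - i)) D 0)" for n
  proof -
    have "(deriv ^^ Suc n) D 0 = (deriv ^^ n) (deriv D) 0" by (simp only: funpow_Suc_right o_apply)
    also have "\<dots> = (deriv ^^ n) (\<lambda>u. deriv G u * D u) 0"
      by (rule higher_deriv_transform_within_open[of _ "ball 0 r"])
         (use D' r hol holD in \<open>auto intro!: holomorphic_intros holomorphic_deriv\<close>)
    also have "\<dots> = (\<Sum>i = 0..n. of_nat (n choose i) * (deriv ^^ i) (deriv G) 0 * (deriv ^^ (n - i)) D 0)"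
      by (rule higher_deriv_mult[of _ "ball 0 r"]) (use hol holD r in \<open>auto intro!: holomorphic_deriv\<close>)
    also have "\<dots> = (\<Sum>i = 0..n. of_nat (n choose i) * (deriv ^^ Suc i) G 0 * (deriv ^^ (n - i)) D 0)"
      by (simp only: funpow_Suc_right o_apply)
    finally show ?thesis .
  qed
  show ?thesis
  proof (induction n rule: less_induct)
    case (less n)
    show ?case
    proof (cases n)
      case 0
      thus ?thesis using D0 by (intro exI[of _ "exp (g 0)"]) auto
    next
      case (Suc m)
      have "\<exists>d. \<forall>j<n. (deriv ^^ j) D 0 = of_real (d j) \<and> d j \<ge> 0"
        using less by (intro choice[of "\<lambda>j d. j < n \<longrightarrow> (deriv ^^ j) D 0 = of_real d \<and> d \<ge> 0", simplified]) blast
      then obtain d where d: "\<And>j. j < n \<Longrightarrow> (deriv ^^ j) D 0 = of_real (d j)" "\<And>j. j < n \<Longrightarrow> d j \<ge> 0"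
        by blast
      have d0: "d 0 = exp (g 0)"
      proof -
        have "complex_of_real (d 0) = of_real (exp (g 0))" using d(1)[of 0] D0 Suc by simp
        thus ?thesis by (simp only: of_real_eq_iff)
      qed
      let ?t = "\<lambda>i. real (m choose i) * g (Suc i) * d (m - i)"
      have "(deriv ^^ n) D 0 = (\<Sum>i = 0..m. of_real (?t i))"
        unfolding Suc rec by (intro sum.cong refl) (use Suc d(1) g(1) in \<open>simp del: funpow.simps\<close>)
      hence "(deriv ^^ n) D 0 = of_real (\<Sum>i = 0..m. ?t i)" by simp
      moreover have nn: "?t i \<ge> 0" for i using d(2)[of "m - i"] g(2)[of "Suc i"] Suc by simp
      moreover have "g n \<le> ?t m" using g(2)[of n] g(2)[of 0] Suc d0 by (simp add: mult_le_cancel_left1)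
      moreover have "?t m \<le> (\<Sum>i = 0..m. ?t i)" using nn by (intro member_le_sum) auto
      ultimately show ?thesis by (intro exI[of _ "\<Sum>i = 0..m. ?t i"]) (auto intro: sum_nonneg)
    qed
  qed
qed

text \<open>Only the exponential \<open>D\<close> of the series is assumed to continue, since
  \<open>D\<close> may vanish outside the unit disc and then has no logarithm there. The Taylor
  coefficients of the logarithm are nonnegative and, from degree 1 on, dominated by those of
  \<open>D\<close>, so convergence of the Taylor series of \<open>D\<close> at \<open>x\<close>
  forces theirs. In the resulting double series of nonnegative terms the order of summation can be
  reversed, which gives the Dirichlet series at 2 - x.\<close>

theorem Landau_exp:
  fixes c :: "'i \<Rightarrow> real" and D :: "complex \<Rightarrow> complex"
  assumes c: "\<And>i. i \<in> I \<Longrightarrow> c i \<ge> 0" and lam: "\<And>i. i \<in> I \<Longrightarrow> lam i \<ge> 0"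
    and summ: "\<And>\<sigma>. \<sigma> > 1 \<Longrightarrow> (\<lambda>i. c i * exp (- \<sigma> * lam i)) summable_on I"
    and holD: "D holomorphic_on ball 0 R" and R: "R > 1"
    and D: "\<And>u. norm u < 1 \<Longrightarrow> D u = exp (\<Sum>\<^sub>\<infinity>i\<in>I. of_real (c i) * exp (- (2 - u) * of_real (lam i)))"
    and x: "0 \<le> x" "x < R"
  shows "(\<lambda>i. c i * exp (- (2 - x) * lam i)) summable_on I"
proof -
  define G where "G u = (\<Sum>\<^sub>\<infinity>i\<in>I. of_real (c i) * exp (- (2 - u) * of_real (lam i)))" for u :: complex
  define b where "b j = (\<Sum>\<^sub>\<infinity>i\<in>I. c i * (exp (-2 * lam i) * lam i ^ j / fact j))" for j
  have smn: "(\<lambda>i. norm (complex_of_real (c i)) * exp (- \<sigma> * lam i)) summable_on I" if "\<sigma> > 1" for \<sigma>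
    using summ[OF that] c by (subst summable_on_cong[of _ _ "\<lambda>i. c i * exp (- \<sigma> * lam i)"]) auto
  have b: "((\<lambda>i. c i * (exp (-2 * lam i) * lam i ^ j / fact j)) has_sum b j) I" for j
    unfolding b_def using dirichlet_taylor_summable[OF c lam summ] by simp
  have b0: "b j \<ge> 0" for j
    unfolding b_def using c lam by (intro infsum_nonneg) auto
  have tb: "dirichlet_taylor I (\<lambda>i. of_real (c i)) lam j = of_real (b j)" for j
  proof -
    have "((\<lambda>i. complex_of_real (c i * (exp (-2 * lam i) * lam i ^ j / fact j))) has_sum of_real (b j)) I"
      using b by (rule has_sum_of_real)
    thus ?thesis unfolding dirichlet_taylor_def by (intro infsumI) simp
  qed
  have "G holomorphic_on ball 0 1"
  proof (rule power_series_holomorphic)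
    fix w :: complex assume "w \<in> ball 0 1"
    hence "norm w < 1" by simp
    from dirichlet_series_sums[OF lam smn this]
    show "(\<lambda>n. of_real (b n) * (w - 0) ^ n) sums G w" by (simp add: tb G_def)
  qed
  moreover have gd: "(deriv ^^ n) G 0 = of_real (b n * fact n)" for n
    using dirichlet_taylor_eq_deriv[OF lam smn, where F = G and j = n] by (simp add: tb G_def field_simps)
  ultimately have ex: "\<exists>d. (deriv ^^ n) D 0 = of_real d \<and> d \<ge> 0 \<and> (n > 0 \<longrightarrow> d \<ge> b n * fact n)" for n
    using D b0 by (intro deriv_exp_dominates[of 1 G]) (auto simp: G_def)
  have "(\<lambda>n. (deriv ^^ n) D 0 / fact n * (of_real x - 0) ^ n) sums D (of_real x)"
    using x by (intro holomorphic_power_series[OF holD]) auto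
  from summable_Re[OF sums_summable[OF this]]
  have "summable (\<lambda>n. Re ((deriv ^^ n) D 0 / fact n * of_real x ^ n))" by simp
  hence sumb: "summable (\<lambda>n. b n * x ^ n)"
  proof (rule summable_comparison_test[rotated], intro exI[of _ 1] allI impI)
    fix n :: nat assume n: "n \<ge> 1"
    obtain d where d: "(deriv ^^ n) D 0 = of_real d" "d \<ge> b n * fact n" using ex[of n] n by auto
    have "Re ((deriv ^^ n) D 0 / fact n * of_real x ^ n) = d / fact n * x ^ n"
    proof -
      have "(deriv ^^ n) D 0 / fact n * of_real x ^ n = of_real (d / fact n * x ^ n)" by (simp add: d(1))
      thus ?thesis by (simp only: Re_complex_of_real)
    qed
    moreover have "b n * x ^ n \<le> d / fact n * x ^ n"
      using d(2) x by (intro mult_right_mono) (auto simp: field_simps)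
    ultimately show "norm (b n * x ^ n) \<le> Re ((deriv ^^ n) D 0 / fact n * of_real x ^ n)"
      using b0[of n] x by simp
  qed
  define f where "f = (\<lambda>(j, i). c i * (exp (-2 * lam i) * lam i ^ j / fact j) * x ^ j)"
  have fnn: "f (j, i) \<ge> 0" if "i \<in> I" for i j using c[OF that] lam[OF that] x by (simp add: f_def)
  have fs: "((\<lambda>i. f (j, i)) has_sum (b j * x ^ j)) I" for j
    unfolding f_def using has_sum_cmult_left[OF b] by simp
  have "(\<lambda>y. norm (f y)) summable_on UNIV \<times> I"
    unfolding Infinite_Sum.abs_summable_on_Sigma_iff
  proof (intro conjI ballI)
    fix j :: nat
    have "(\<lambda>i. f (j, i)) summable_on I" using fs by (rule has_sum_imp_summable)
    thus "(\<lambda>i. norm (f (j, i))) summable_on I"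
      using fnn by (subst summable_on_cong[of _ _ "\<lambda>i. f (j, i)"]) auto
  next
    have "norm (\<Sum>\<^sub>\<infinity>i\<in>I. norm (f (j, i))) = b j * x ^ j" for j
    proof -
      have "(\<Sum>\<^sub>\<infinity>i\<in>I. norm (f (j, i))) = (\<Sum>\<^sub>\<infinity>i\<in>I. f (j, i))" using fnn by (intro infsum_cong) auto
      thus ?thesis using infsumI[OF fs[of j]] b0[of j] x by simp
    qed
    thus "(\<lambda>j. norm (\<Sum>\<^sub>\<infinity>i\<in>I. norm (f (j, i)))) summable_on UNIV"
      using sumb b0 x by (simp add: summable_on_UNIV_nonneg_real_iff)
  qed
  hence "f summable_on UNIV \<times> I" by (rule abs_summable_summable)
  hence sw: "(\<lambda>(i, j). f (j, i)) summable_on I \<times> UNIV" by (subst (asm) summable_on_swap)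
  have "((\<lambda>i. c i * exp (- (2 - x) * lam i)) has_sum infsum (\<lambda>(i, j). f (j, i)) (I \<times> UNIV)) I"
  proof (rule has_sum_SigmaD[OF has_sum_infsum[OF sw]])
    fix i
    have "((\<lambda>j. c i * exp (-2 * lam i) * ((x * lam i) ^ j / fact j)) has_sum (c i * exp (-2 * lam i) * exp (x * lam i))) UNIV"
      by (rule has_sum_cmult_right[OF has_sum_exp_real])
    also have "c i * exp (-2 * lam i) * exp (x * lam i) = c i * exp (- (2 - x) * lam i)"
      by (simp add: mult.assoc exp_add [symmetric] algebra_simps)
    finally show "((\<lambda>j. (\<lambda>(i, j). f (j, i)) (i, j)) has_sum c i * exp (- (2 - x) * lam i)) UNIV"
      by (simp add: f_def power_mult_distrib mult_ac)
  qed
  thus ?thesis by (rule has_sum_imp_summable)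
qed

section \<open>The multiplicative functions n^(-s) and the sum of inverse primes\<close>

definition npowr :: "complex \<Rightarrow> nat \<Rightarrow> complex" where
  "npowr s n = of_nat n powr (-s)"

lemma npowr_mult: "npowr s (m * n) = npowr s m * npowr s n"
  by (simp add: npowr_def powr_times_real)

lemma npowr_1: "npowr s 1 = 1"
  by (simp add: npowr_def)

lemma norm_npowr: "norm (npowr s n) = real n powr (-Re s)"
  by (cases "n = 0") (simp_all add: npowr_def norm_nat_powr)

lemma npowr_exp: "n > 0 \<Longrightarrow> npowr s n = exp (- s * of_real (ln (real n)))"
  by (simp add: npowr_def powr_def Ln_of_nat)

text \<open>If the sum were a finite S, the Euler product would bound the zeta series by
  \<open>exp (2 * S)\<close> uniformly in \<sigma> > 1, because 1/(1 - x) is at most exp(2x) for 0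
  \<le> x \<le> 1/2. Letting \<sigma> tend to 1 in the partial sums would then bound the harmonic
  series.\<close>

lemma not_summable_inverse_primes: "\<not> (\<lambda>p. 1 / real p) summable_on {p. prime p}"
proof
  assume sm: "(\<lambda>p. 1 / real p) summable_on {p. prime p}"
  define S where "S = (\<Sum>\<^sub>\<infinity>p\<in>{p. prime p}. 1 / real p)"
  have le_S: "(\<Sum>p | prime p \<and> p \<le> N. 1 / real p) \<le> S" for N :: nat
    unfolding S_def by (rule finite_sum_le_infsum[OF sm]) auto
  have partial: "(\<Sum>n=1..N. real n powr (-\<sigma>)) \<le> exp (2 * S)" if \<sigma>: "\<sigma> > 1" for \<sigma> N
  proof -
    define h where "h = npowr (of_real \<sigma>)"
    have h_eq: "h n = of_real (real n powr (-\<sigma>))" for n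
      by (cases "n = 0") (auto simp: h_def npowr_def powr_of_real [symmetric])
    have hs: "(\<lambda>n. norm (h n)) summable_on {0<..}"
      unfolding h_def norm_npowr using summable_on_nat_powr[OF \<sigma>] by simp
    have lim: "(\<lambda>N. \<Prod>p | prime p \<and> p \<le> N. 1 / (1 - h p)) \<longlonglongrightarrow> (\<Sum>\<^sub>\<infinity>n\<in>{0<..}. h n)"
      by (rule completely_mult_euler[OF _ _ hs]) (simp_all only: h_def npowr_1 npowr_mult)
    have bd: "norm (\<Prod>p | prime p \<and> p \<le> N. 1 / (1 - h p)) \<le> exp (2 * S)" for N
    proof -
      have "norm (\<Prod>p | prime p \<and> p \<le> N. 1 / (1 - h p)) = (\<Prod>p | prime p \<and> p \<le> N. norm (1 / (1 - h p)))"
        by (rule prod_norm [symmetric])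
      also have "\<dots> \<le> (\<Prod>p | prime p \<and> p \<le> N. exp (2 * (1 / real p)))"
      proof (intro prod_mono conjI)
        fix p assume "p \<in> {p. prime p \<and> p \<le> N}"
        hence p2: "p \<ge> 2" using prime_ge_2_nat by auto
        define x where "x = real p powr (-\<sigma>)"
        have "x \<le> real p powr (-1)" unfolding x_def using p2 \<sigma> by (intro powr_mono) auto
        hence x: "0 \<le> x" "x \<le> 1 / real p" using p2 by (auto simp: x_def powr_minus_divide)
        moreover have "1 / real p \<le> 1 / 2" using p2 by (intro divide_left_mono) auto
        ultimately have x2: "x \<le> 1 / 2" by linarith
        have "norm (1 / (1 - h p)) = 1 / (1 - x)"
        proof -
          have "1 / (1 - h p) = of_real (1 / (1 - x))" by (simp add: h_eq x_def)
          thus ?thesis using x2 by (simp only: norm_of_real) simp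
        qed
        also have "1 / (1 - x) \<le> 1 + 2 * x"
        proof -
          have "x * (2 * x) \<le> x * 1" using x x2 by (intro mult_left_mono) auto
          thus ?thesis using x2 by (simp add: divide_le_eq algebra_simps)
        qed
        also have "\<dots> \<le> exp (2 * x)" by (rule exp_ge_add_one_self)
        also have "\<dots> \<le> exp (2 * (1 / real p))" using x by simp
        finally show "norm (1 / (1 - h p)) \<le> exp (2 * (1 / real p))" .
      qed auto
      also have "\<dots> = exp (2 * (\<Sum>p | prime p \<and> p \<le> N. 1 / real p))"
        by (simp only: exp_sum [symmetric] sum_distrib_left finite_Collect_conjI finite_Collect_le_nat disj_imp simp_thms)
      also have "\<dots> \<le> exp (2 * S)" using le_S[of N] by simp
      finally show ?thesis .
    qed
    have "norm (\<Sum>\<^sub>\<infinity>n\<in>{0<..}. h n) \<le> exp (2 * S)"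
      by (rule LIMSEQ_le_const2[OF tendsto_norm[OF lim]]) (use bd in blast)
    moreover have "(\<Sum>\<^sub>\<infinity>n\<in>{0<..}. h n) = of_real (\<Sum>\<^sub>\<infinity>n\<in>{0<..}. real n powr (-\<sigma>))"
    proof -
      have "((\<lambda>n. real n powr (-\<sigma>)) has_sum (\<Sum>\<^sub>\<infinity>n\<in>{0<..}. real n powr (-\<sigma>))) {0<..}"
        using summable_on_nat_powr[OF \<sigma>] by simp
      hence "((\<lambda>n. complex_of_real (real n powr (-\<sigma>))) has_sum of_real (\<Sum>\<^sub>\<infinity>n\<in>{0<..}. real n powr (-\<sigma>))) {0<..}"
        by (rule has_sum_of_real)
      thus ?thesis unfolding h_eq by (rule infsumI)
    qed
    ultimately have "(\<Sum>\<^sub>\<infinity>n\<in>{0<..}. real n powr (-\<sigma>)) \<le> exp (2 * S)" by simp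
    moreover have "(\<Sum>n=1..N. real n powr (-\<sigma>)) \<le> (\<Sum>\<^sub>\<infinity>n\<in>{0<..}. real n powr (-\<sigma>))"
      by (rule finite_sum_le_infsum[OF summable_on_nat_powr[OF \<sigma>]]) auto
    ultimately show ?thesis by linarith
  qed
  have "(\<Sum>n=1..N. real n powr (-1)) \<le> exp (2 * S)" for N
  proof (rule tendsto_upperbound)
    show "((\<lambda>\<sigma>. \<Sum>n=1..N. real n powr (-\<sigma>)) \<longlongrightarrow> (\<Sum>n=1..N. real n powr (-1))) (at_right (1::real))"
      by (intro tendsto_intros) auto
    show "\<forall>\<^sub>F \<sigma> in at_right 1. (\<Sum>n=1..N. real n powr (-\<sigma>)) \<le> exp (2 * S)"
      using eventually_at_right_less by eventually_elim (rule partial)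
  qed auto
  hence "(\<Sum>n<N. real n powr (-1)) \<le> exp (2 * S)" for N
  proof -
    have "(\<Sum>n<N. real n powr (-1)) \<le> (\<Sum>n\<le>N. real n powr (-1))" by (rule sum_mono2) auto
    also have "\<dots> = (\<Sum>n=1..N. real n powr (-1))" by (rule sum.mono_neutral_right) (auto simp: Suc_le_eq)
    finally show ?thesis using \<open>\<And>N. (\<Sum>n=1..N. real n powr (-1)) \<le> exp (2 * S)\<close> order_trans by blast
  qed
  hence "summable (\<lambda>n. real n powr (-1))"
    by (intro summableI_nonneg_bounded) auto
  moreover have "\<not> summable (\<lambda>n. real n powr (-1))" by (subst summable_real_powr_iff) simp
  ultimately show False by blast
qed

section \<open>L-functions as convergent series for Re s > 0\<close>

definition L_cont :: "(nat \<Rightarrow> complex) \<Rightarrow> complex \<Rightarrow> complex" where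
  "L_cont chi s = (\<Sum>n. abel_term chi n s)"

text \<open>Complete periods sum to 0, so fewer than \<open>q\<close> terms of modulus at most 1
  remain.\<close>

lemma norm_sum_dcharacter:
  assumes q: "q > 0" and chi: "dcharacter q chi" "chi \<noteq> principal_char q"
  shows "norm (\<Sum>r=1..n. chi r) \<le> real q"
proof -
  have period: "(\<Sum>r<k * q. chi r) = 0" for k
  proof (induction k)
    case (Suc k)
    have "(\<Sum>r<Suc k * q. chi r) = (\<Sum>r<k * q. chi r) + (\<Sum>r\<in>{k * q..<k * q + q}. chi r)"
      using sum.atLeastLessThan_concat[of 0 "k * q" "k * q + q" chi]
      by (simp add: lessThan_atLeast0 add.commute)
    also have "(\<Sum>r\<in>{k * q..<k * q + q}. chi r) = (\<Sum>r<q. chi (r + k * q))"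
      using sum.shift_bounds_nat_ivl[of chi 0 "k * q" q] by (simp add: lessThan_atLeast0 add.commute)
    also have "\<dots> = (\<Sum>r<q. chi r)"
      by (intro sum.cong refl dcharacter_cong[OF chi(1)]) (simp add: cong_def)
    finally show ?case using Suc sum_dcharacter_period[OF q chi] by simp
  qed auto
  show ?thesis
  proof (cases "q = 1")
    case True
    have "chi n = principal_char q n" for n
    proof -
      have "[n = 1] (mod q)" unfolding True by (simp add: cong_def)
      hence "chi n = chi 1" by (rule dcharacter_cong[OF chi(1)])
      also have "chi 1 = 1" using chi(1) unfolding dcharacter_def by blast
      finally show ?thesis by (simp add: True principal_char_def)
    qed
    thus ?thesis using chi(2) by blast
  next
    case False
    \<comment> \<open>The vanishing of \<open>chi 0\<close> lets the sum start at 0, in line with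
      the periods; it fails for \<open>q = 1\<close>, where every character is principal.\<close>
    hence chi0: "chi 0 = 0" using chi(1) by (simp add: dcharacter_def)
    define k where "k = Suc n div q"
    have "(\<Sum>r=1..n. chi r) = (\<Sum>r<Suc n. chi r)"
      using chi0 by (simp add: lessThan_Suc_atMost atMost_atLeast0 sum.atLeast_Suc_atMost)
    also have "\<dots> = (\<Sum>r<k * q. chi r) + (\<Sum>r\<in>{k * q..<Suc n}. chi r)"
      using sum.atLeastLessThan_concat[of 0 "k * q" "Suc n" chi] div_times_less_eq_dividend[of "Suc n" q]
      unfolding lessThan_atLeast0 k_def by simp
    also have "\<dots> = (\<Sum>r\<in>{k * q..<Suc n}. chi r)" using period by simp
    finally have eq: "(\<Sum>r=1..n. chi r) = (\<Sum>r\<in>{k * q..<Suc n}. chi r)" .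
    have "norm (\<Sum>r=1..n. chi r) \<le> (\<Sum>r\<in>{k * q..<Suc n}. norm (chi r))"
      unfolding eq by (rule norm_sum)
    also have "\<dots> \<le> (\<Sum>r\<in>{k * q..<Suc n}. 1)"
      by (intro sum_mono norm_dcharacter_le[OF chi(1) q])
    also have "\<dots> = real (Suc n - k * q)" by simp
    also have "Suc n - k * q = Suc n mod q" by (simp add: k_def minus_div_mult_eq_mod)
    also have "real (Suc n mod q) \<le> real q" using q by (simp add: less_imp_le)
    finally show ?thesis .
  qed
qed

context
  fixes q :: nat and chi :: "nat \<Rightarrow> complex"
  assumes q: "q > 0" and chi: "dcharacter q chi" and nonprincipal: "chi \<noteq> principal_char q"
begin

lemma L_cont_eq:
  assumes "Re s > 0"
  shows "dirichlet_L q chi s = L_cont chi s"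
  using limI[OF abel_sums[OF norm_sum_dcharacter[OF q chi nonprincipal] assms]] nonprincipal
  by (simp add: dirichlet_L_def L_cont_def)

lemma holomorphic_L_cont: "L_cont chi holomorphic_on {s. Re s > 0}"
  unfolding L_cont_def [abs_def]
  by (rule holomorphic_abel[OF norm_sum_dcharacter[OF q chi nonprincipal]])

lemma summable_dirichlet_terms:
  assumes "Re s > 1"
  shows "(\<lambda>n. norm (chi n * npowr s n)) summable_on {0<..}"
proof (rule abs_summable_comparison)
  show "(\<lambda>n. real n powr (-Re s)) summable_on {0<..}" using assms by (rule summable_on_nat_powr)
  show "norm (chi n * npowr s n) \<le> real n powr (-Re s)" for n
    using norm_dcharacter_le[OF chi q, of n] mult_right_mono[of "norm (chi n)" 1 "real n powr (-Re s)"]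
    by (simp add: norm_mult norm_npowr)
qed

lemma L_cont_series:
  assumes s: "Re s > 1"
  shows "L_cont chi s = (\<Sum>\<^sub>\<infinity>n\<in>{0<..}. chi n * npowr s n)"
proof (rule LIMSEQ_unique)
  show "(\<lambda>N. \<Sum>n=1..N. chi n * of_nat n powr (-s)) \<longlonglongrightarrow> L_cont chi s"
    unfolding L_cont_def
    using abel_sums[OF norm_sum_dcharacter[OF q chi nonprincipal]] s by simp
  show "(\<lambda>N. \<Sum>n=1..N. chi n * of_nat n powr (-s)) \<longlonglongrightarrow> (\<Sum>\<^sub>\<infinity>n\<in>{0<..}. chi n * npowr s n)"
  proof (rule has_sum_exhaustion)
    show "((\<lambda>n. chi n * npowr s n) has_sum (\<Sum>\<^sub>\<infinity>n\<in>{0<..}. chi n * npowr s n)) {0<..}"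
      by (rule has_sum_infsum[OF abs_summable_summable[OF summable_dirichlet_terms[OF s]]])
    show "((\<lambda>n. chi n * npowr s n) has_sum (\<Sum>n=1..N. chi n * of_nat n powr (-s))) {1..N}" for N
      unfolding npowr_def by (rule has_sum_finite) simp
    fix F :: "nat set" assume F: "finite F" "F \<subseteq> {0<..}"
    show "\<forall>\<^sub>F N in sequentially. F \<subseteq> {1..N}"
      using eventually_finite_subset_atMost[OF F(1)]
    proof eventually_elim
      case (elim N)
      thus ?case using F(2) by (auto simp: Suc_le_eq)
    qed
  qed auto
qed

end

lemma npowr_add: "npowr (s + t) n = npowr s n * npowr t n"
  unfolding npowr_def minus_add_distrib by (rule powr_add)

lemma cnj_npowr: "cnj (npowr s n) = npowr (cnj s) n"
  by (simp add: npowr_def cnj_powr)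

lemma npowr_prime_power:
  assumes "prime p"
  shows "npowr s p ^ j = exp (- s * of_real (real j * ln (real p)))"
proof -
  have "p > 0" using assms prime_gt_0_nat by auto
  thus ?thesis by (simp add: npowr_exp exp_of_nat_mult [symmetric] mult_ac)
qed

text \<open>Frequencies j ln p replace the powers of p^(-s), so that logarithms of several
  L-functions can be added coefficientwise and handed to \<open>Landau_exp\<close>.\<close>

lemma completely_mult_dirichlet_exp:
  fixes f :: "nat \<Rightarrow> complex"
  assumes f1: "f 1 = 1" and fmult: "\<And>m n. f (m * n) = f m * f n"
    and fb: "\<And>n. norm (f n) \<le> 1" and s: "Re s > 1"
  shows "(\<Sum>\<^sub>\<infinity>n\<in>{0<..}. f n * npowr s n) =
           exp (\<Sum>\<^sub>\<infinity>(p, j)\<in>{p. prime p} \<times> {0<..}. f p ^ j / of_nat j * exp (- s * of_real (real j * ln (real p))))"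
    and "(\<lambda>x. norm (case x of (p, j) \<Rightarrow> f p ^ j / of_nat j * exp (- s * of_real (real j * ln (real p)))))
           summable_on {p. prime p} \<times> {0<..}"
proof -
  let ?h = "\<lambda>n. f n * npowr s n"
  have h1: "?h 1 = 1" using f1 npowr_1 by simp
  have hm: "?h (m * n) = ?h m * ?h n" for m n by (simp add: fmult npowr_mult)
  have hs: "(\<lambda>n. norm (?h n)) summable_on {0<..}"
  proof (rule abs_summable_comparison)
    show "(\<lambda>n. real n powr (-Re s)) summable_on {0<..}" using s by (rule summable_on_nat_powr)
    show "norm (?h n) \<le> real n powr (-Re s)" for n
      using mult_right_mono[OF fb[of n], of "real n powr (-Re s)"] by (simp add: norm_mult norm_npowr)
  qed
  have eq: "(case x of (p, j) \<Rightarrow> ?h p ^ j / of_nat j) =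
            (case x of (p, j) \<Rightarrow> f p ^ j / of_nat j * exp (- s * of_real (real j * ln (real p))))"
    if "x \<in> {p. prime p} \<times> {0<..}" for x
    using that by (auto simp: power_mult_distrib npowr_prime_power)
  show "(\<Sum>\<^sub>\<infinity>n\<in>{0<..}. f n * npowr s n) =
           exp (\<Sum>\<^sub>\<infinity>(p, j)\<in>{p. prime p} \<times> {0<..}. f p ^ j / of_nat j * exp (- s * of_real (real j * ln (real p))))"
    unfolding completely_mult_eq_exp[OF h1 hm hs] by (rule arg_cong[of _ _ exp]) (rule infsum_cong, rule eq)
  show "(\<lambda>x. norm (case x of (p, j) \<Rightarrow> f p ^ j / of_nat j * exp (- s * of_real (real j * ln (real p)))))
           summable_on {p. prime p} \<times> {0<..}"
    using completely_mult_log_summable[OF h1 hm hs]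
    by (subst (asm) summable_on_cong[OF arg_cong[OF eq, of _ norm]]) auto
qed

lemma zeta_reg_series:
  assumes s: "Re s > 1"
  shows "zeta_reg s = (s - 1) * (\<Sum>\<^sub>\<infinity>n\<in>{0<..}. npowr s n)"
proof (rule zeta_reg_eq[OF s])
  have "(\<lambda>n. norm (npowr s n)) summable_on {0<..}"
    unfolding norm_npowr using s by (rule summable_on_nat_powr)
  hence "(npowr s has_sum (\<Sum>\<^sub>\<infinity>n\<in>{0<..}. npowr s n)) {0<..}"
    by (rule has_sum_infsum[OF abs_summable_summable])
  hence "(npowr s has_sum (\<Sum>\<^sub>\<infinity>n\<in>{0<..}. npowr s n)) UNIV"
  proof (subst has_sum_cong_neutral[where T = "{0<..}" and g = "npowr s"])
    show "npowr s n = 0" if "n \<in> UNIV - {0<..}" for n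
      using that by (simp add: npowr_def)
  qed auto
  thus "(\<lambda>n. of_nat n powr (-s)) sums (\<Sum>\<^sub>\<infinity>n\<in>{0<..}. npowr s n)"
    unfolding npowr_def [abs_def] by (rule has_sum_imp_sums)
qed

context
  fixes q :: nat and chi :: "nat \<Rightarrow> complex"
  assumes q: "q > 0" and chi: "dcharacter q chi" and nonprincipal: "chi \<noteq> principal_char q"
begin

lemma nonprincipal_cnj: "(\<lambda>n. cnj (chi n)) \<noteq> principal_char q"
proof
  assume *: "(\<lambda>n. cnj (chi n)) = principal_char q"
  have "chi n = principal_char q n" for n
    using arg_cong[OF fun_cong[OF *, of n], of cnj] by (simp add: principal_char_def split: if_splits)
  thus False using nonprincipal by blast
qed

text \<open>Conjugation moves a zero at 1 + it to a zero of the conjugate L-function at 1 - it. This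
  is the second of the two zeros that cancel the double pole.\<close>

lemma L_cont_cnj:
  assumes s: "Re s > 0"
  shows "L_cont (\<lambda>n. cnj (chi n)) (cnj s) = cnj (L_cont chi s)"
proof -
  have "summable (\<lambda>n. norm (abel_term chi n s))"
    by (rule summable_norm_abel_term[OF norm_sum_dcharacter[OF q chi nonprincipal] s])
  hence "(\<lambda>n. abel_term chi n s) sums L_cont chi s"
    unfolding L_cont_def by (rule summable_sums[OF summable_norm_cancel])
  hence "(\<lambda>n. cnj (abel_term chi n s)) sums cnj (L_cont chi s)"
    by (simp only: sums_cnj)
  moreover have "cnj (abel_term chi n s) = abel_term (\<lambda>n. cnj (chi n)) n (cnj s)" for n
    by (simp add: abel_term_def cnj_powr del: of_nat_Suc)
  ultimately have "(\<lambda>n. abel_term (\<lambda>n. cnj (chi n)) n (cnj s)) sums cnj (L_cont chi s)" by simp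
  thus ?thesis unfolding L_cont_def by (rule sums_unique [symmetric])
qed

text \<open>If \<open>L(1 + it, \<chi>) = 0\<close>, the double pole of \<open>\<zeta>(s)\<^sup>2\<close> is cancelled in the product
  \<open>\<zeta>(s)\<^sup>2 L(s + it, \<chi>) L(s - it, cnj \<chi>)\<close>. With \<open>f(p) = \<chi>(p) p powr -it\<close>, the logarithm of this product
  has coefficients \<open>(2 + 2 Re (f(p)^j))/j \<ge> 0\<close> at \<open>p^j\<close>, so by Landau's theorem its Dirichlet series
  converges at \<open>s = 1/2\<close>; but there the terms with \<open>j \<le> 2\<close> already dominate \<open>\<Sum> 1/p\<close>.\<close>

theorem dirichlet_L_nonzero_line_1: "L_cont chi (1 + \<i> * of_real t) \<noteq> 0"
proof
  assume zero: "L_cont chi (1 + \<i> * of_real t) = 0"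
  define chi' where "chi' = (\<lambda>n. cnj (chi n))"
  have chi': "dcharacter q chi'" "chi' \<noteq> principal_char q"
    unfolding chi'_def using dcharacter_cnj[OF chi] nonprincipal_cnj by auto
  have zero': "L_cont chi' (1 - \<i> * of_real t) = 0"
    using L_cont_cnj[of "1 + \<i> * of_real t"] zero by (simp add: chi'_def)
  define f where "f n = chi n * npowr (\<i> * of_real t) n" for n
  have f1: "f 1 = 1" using chi npowr_1 by (simp add: f_def dcharacter_def)
  have fm: "f (m * n) = f m * f n" for m n using chi by (simp add: f_def dcharacter_def npowr_mult)
  have fb: "norm (f n) \<le> 1" for n
  proof -
    have "real n powr 0 \<le> 1" by (cases "n = 0") auto
    hence "norm (chi n) * (real n powr 0) \<le> 1 * 1"
      by (intro mult_mono norm_dcharacter_le[OF chi q]) auto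
    thus ?thesis by (simp add: f_def norm_mult norm_npowr)
  qed
  define I where "I = {p::nat. prime p} \<times> {0::nat<..}"
  define lam where "lam = (\<lambda>(p::nat, j::nat). real j * ln (real p))"
  define c where "c = (\<lambda>(p, j). (2 + 2 * Re (f p ^ j)) / real j)"
  have Re_f: "\<bar>Re (f p ^ j)\<bar> \<le> 1" for p j
    using abs_Re_le_cmod[of "f p ^ j"] power_le_one[OF _ fb[of p], of j] by (simp add: norm_power)
  have Re2: "2 + 2 * Re (f p ^ j) \<ge> 0" for p j using Re_f[of p j] by linarith
  have c0: "c i \<ge> 0" for i using Re2 by (cases i) (simp add: c_def)
  have lam0: "lam i \<ge> 0" if "i \<in> I" for i
    using that prime_ge_1_nat by (auto simp: I_def lam_def)
  have summ: "(\<lambda>i. c i * exp (- \<sigma> * lam i)) summable_on I" if \<sigma>: "\<sigma> > 1" for \<sigma> :: real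
  proof -
    have s1: "(\<lambda>x. norm (case x of (p, j) \<Rightarrow> (1::complex) ^ j / of_nat j * exp (- (of_real \<sigma>) * of_real (real j * ln (real p))))) summable_on I"
      unfolding I_def using completely_mult_dirichlet_exp(2)[of "\<lambda>_. 1" "of_real \<sigma>"] \<sigma> by simp
    have "(\<lambda>i. norm (c i * exp (- \<sigma> * lam i))) summable_on I"
    proof (rule abs_summable_comparison)
      show "(\<lambda>x. 4 * norm (case x of (p, j) \<Rightarrow> (1::complex) ^ j / of_nat j * exp (- (of_real \<sigma>) * of_real (real j * ln (real p))))) summable_on I"
        by (intro summable_on_cmult_right s1)
      fix i assume "i \<in> I"
      obtain p j where i: "i = (p, j)" by (cases i)
      have "(2 + 2 * Re (f p ^ j)) / real j * exp (- \<sigma> * (real j * ln (real p))) \<le> 4 / real j * exp (- \<sigma> * (real j * ln (real p)))"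
        using Re_f[of p j] by (intro mult_right_mono divide_right_mono) auto
      thus "norm (c i * exp (- \<sigma> * lam i)) \<le> 4 * norm (case i of (p, j) \<Rightarrow> (1::complex) ^ j / of_nat j * exp (- (of_real \<sigma>) * of_real (real j * ln (real p))))"
        unfolding norm_mult[of "c i"] using Re2[of p j]
        by (simp add: i c_def lam_def norm_mult norm_divide)
    qed
    thus ?thesis by (rule abs_summable_summable)
  qed
  define L1 where "L1 s = L_cont chi (s + \<i> * of_real t)" for s
  define L2 where "L2 s = L_cont chi' (s - \<i> * of_real t)" for s
  let ?S = "{s::complex. Re s > 0}"
  have opS: "open ?S" by (rule open_halfspace_Re_gt)
  have hol1: "L1 holomorphic_on ?S" unfolding L1_def
    by (rule holomorphic_on_compose_gen[OF _ holomorphic_L_cont[OF q chi nonprincipal], unfolded o_def])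
       (auto intro!: holomorphic_intros)
  have hol2: "L2 holomorphic_on ?S" unfolding L2_def
    by (rule holomorphic_on_compose_gen[OF _ holomorphic_L_cont[OF q chi'], unfolded o_def])
       (auto intro!: holomorphic_intros)
  \<comment> \<open>Because \<open>L1\<close> and \<open>L2\<close> vanish at 1, these difference
    quotients are \<open>L1\<close> and \<open>L2\<close> divided by z - 1, with the singularity at
    1 removed.\<close>
  define M1 where "M1 z = (if z = 1 then deriv L1 1 else (L1 z - L1 1) / (z - 1))" for z
  define M2 where "M2 z = (if z = 1 then deriv L2 1 else (L2 z - L2 1) / (z - 1))" for z
  have "M1 holomorphic_on ?S" "M2 holomorphic_on ?S"
    unfolding M1_def M2_def by (rule pole_lemma_open[OF hol1 opS], rule pole_lemma_open[OF hol2 opS])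
  hence "(\<lambda>s. zeta_reg s ^ 2 * M1 s * M2 s) holomorphic_on ?S"
    by (intro holomorphic_intros holomorphic_zeta_reg)
  define D where "D u = zeta_reg (2 - u) ^ 2 * M1 (2 - u) * M2 (2 - u)" for u
  have "D holomorphic_on ball 0 2" unfolding D_def
  proof (rule holomorphic_on_compose_gen[of "\<lambda>u. 2 - u" _ "\<lambda>s. zeta_reg s ^ 2 * M1 s * M2 s" ?S, unfolded o_def])
    show "(\<lambda>u. 2 - u) ` ball 0 2 \<subseteq> ?S"
    proof
      fix s assume "s \<in> (\<lambda>u. 2 - u) ` ball (0::complex) 2"
      then obtain u where u: "s = 2 - u" "norm u < 2" by auto
      thus "s \<in> ?S" using complex_Re_le_cmod[of u] by simp
    qed
  qed (use \<open>(\<lambda>s. zeta_reg s ^ 2 * M1 s * M2 s) holomorphic_on ?S\<close> in \<open>auto intro!: holomorphic_intros\<close>)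
  moreover have "D u = exp (\<Sum>\<^sub>\<infinity>i\<in>I. of_real (c i) * exp (- (2 - u) * of_real (lam i)))" if u: "norm u < 1" for u
  proof -
    define s where "s = 2 - u"
    have s: "Re s > 1" using u complex_Re_le_cmod[of u] by (simp add: s_def)
    have s1: "s \<noteq> 1" using s by auto
    define e where "e = (\<lambda>(p::nat, j::nat). exp (- s * of_real (real j * ln (real p))))"
    let ?t0 = "\<lambda>(p, j). (1::complex) ^ j / of_nat j * exp (- s * of_real (real j * ln (real p)))"
    let ?t1 = "\<lambda>(p, j). f p ^ j / of_nat j * exp (- s * of_real (real j * ln (real p)))"
    let ?t2 = "\<lambda>(p, j). cnj (f p) ^ j / of_nat j * exp (- s * of_real (real j * ln (real p)))"
    note E0 = completely_mult_dirichlet_exp[where f = "\<lambda>_. 1" and s = s, OF _ _ _ s, simplified mult_1, folded I_def]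
    note E1 = completely_mult_dirichlet_exp[where f = f and s = s, OF f1 fm fb s, folded I_def]
    note E2 = completely_mult_dirichlet_exp[where f = "\<lambda>n. cnj (f n)" and s = s, folded I_def]
    have hs0: "(?t0 has_sum infsum ?t0 I) I" using E0(2) by (intro has_sum_infsum[OF abs_summable_summable]) auto
    have hs1: "(?t1 has_sum infsum ?t1 I) I" by (rule has_sum_infsum[OF abs_summable_summable[OF E1(2)]])
    have hs2: "(?t2 has_sum infsum ?t2 I) I"
      using E2(2) f1 fm fb s by (intro has_sum_infsum[OF abs_summable_summable]) auto
    have z: "zeta_reg s = (s - 1) * exp (infsum ?t0 I)"
      using zeta_reg_series[OF s] E0(1) by simp
    have Re1: "Re (s + \<i> * of_real t) > 1" "Re (s - \<i> * of_real t) > 1" using s by auto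
    have "L1 s = exp (infsum ?t1 I)"
      unfolding L1_def L_cont_series[OF q chi nonprincipal Re1(1)] E1(1) [symmetric]
      by (simp add: f_def npowr_add mult_ac)
    moreover have "L2 s = exp (infsum ?t2 I)"
    proof -
      have "chi' n * npowr (s - \<i> * of_real t) n = cnj (f n) * npowr s n" for n
        using npowr_add[of s "- (\<i> * of_real t)" n]
        by (simp add: chi'_def f_def cnj_npowr mult_ac)
      hence "L2 s = (\<Sum>\<^sub>\<infinity>n\<in>{0<..}. cnj (f n) * npowr s n)"
        unfolding L2_def L_cont_series[OF q chi' Re1(2)] by simp
      also have "\<dots> = exp (infsum ?t2 I)"
        using f1 fm fb s by (intro E2(1)) auto
      finally show ?thesis .
    qed
    moreover have "L1 1 = 0" "L2 1 = 0" using zero zero' by (auto simp: L1_def L2_def)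
    ultimately have "D u = exp (infsum ?t0 I) * exp (infsum ?t0 I) * (exp (infsum ?t1 I) * exp (infsum ?t2 I))"
      unfolding D_def s_def [symmetric] M1_def M2_def z using s1 by (simp add: power2_eq_square)
    also have "\<dots> = exp (infsum ?t0 I + infsum ?t0 I + (infsum ?t1 I + infsum ?t2 I))"
      by (simp only: exp_add)
    also have "infsum ?t0 I + infsum ?t0 I + (infsum ?t1 I + infsum ?t2 I) =
        (\<Sum>\<^sub>\<infinity>i\<in>I. of_real (c i) * exp (- (2 - u) * of_real (lam i)))"
    proof (rule infsumI [symmetric])
      have "((\<lambda>i. ?t0 i + ?t0 i + (?t1 i + ?t2 i)) has_sum
          (infsum ?t0 I + infsum ?t0 I + (infsum ?t1 I + infsum ?t2 I))) I"
        by (intro has_sum_add hs0 hs1 hs2)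
      moreover have "?t0 i + ?t0 i + (?t1 i + ?t2 i) = of_real (c i) * exp (- (2 - u) * of_real (lam i))" for i
      proof -
        obtain p j where i: "i = (p, j)" by (cases i)
        have "f p ^ j + cnj (f p) ^ j = of_real (2 * Re (f p ^ j))"
          using complex_add_cnj[of "f p ^ j"] by simp
        hence "of_real (c i) = (1 + 1 + (f p ^ j + cnj (f p) ^ j)) / of_nat j"
          by (simp add: i c_def)
        thus ?thesis by (simp add: i lam_def s_def add_divide_distrib distrib_right)
      qed
      ultimately show "((\<lambda>i. of_real (c i) * exp (- (2 - u) * of_real (lam i))) has_sum
          (infsum ?t0 I + infsum ?t0 I + (infsum ?t1 I + infsum ?t2 I))) I" by simp
    qed
    finally show ?thesis .
  qed
  \<comment> \<open>The point x = 3/2 of the disc of radius 2 corresponds to s = 1/2.\<close>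
  ultimately have "(\<lambda>i. c i * exp (- (2 - 3 / 2) * lam i)) summable_on I"
    using c0 lam0 summ by (intro Landau_exp[where D = D and R = 2]) auto
  hence sm: "(\<lambda>i. c i * exp (- (1 / 2) * lam i)) summable_on I" by simp
  have line: "(\<lambda>p. c (p, j) * exp (- (1 / 2) * lam (p, j))) summable_on {p. prime p}" if "j > 0" for j
  proof -
    have inj: "inj_on (\<lambda>p. (p, j)) {p::nat. prime p}" by (auto intro: inj_onI)
    have "(\<lambda>i. c i * exp (- (1 / 2) * lam i)) summable_on (\<lambda>p. (p, j)) ` {p. prime p}"
      by (rule summable_on_subset_banach[OF sm]) (use that in \<open>auto simp: I_def\<close>)
    thus ?thesis unfolding summable_on_reindex[OF inj] o_def .
  qed
  have "(\<lambda>p. norm (1 / real p)) summable_on {p. prime p}"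
  proof (rule abs_summable_comparison)
    show "(\<lambda>p. c (p, 1) * exp (- (1 / 2) * lam (p, 1)) + c (p, 2) * exp (- (1 / 2) * lam (p, 2))) summable_on {p. prime p}"
      by (intro summable_on_add line) auto
    fix p :: nat assume "p \<in> {p. prime p}"
    hence p: "real p \<ge> 1" using prime_ge_1_nat by auto
    \<comment> \<open>At s = 1/2 the weight is p^(-1/2) for j = 1 and exactly 1/p for j = 2, hence
      at least 1/p in both cases.\<close>
    have e1: "exp (- (1 / 2) * lam (p, 1)) \<ge> 1 / real p"
    proof -
      have "1 / real p = exp (- ln (real p))" using p by (simp add: exp_minus inverse_eq_divide)
      thus ?thesis using p by (simp add: lam_def)
    qed
    have e2: "exp (- (1 / 2) * lam (p, 2)) = 1 / real p"
      using p by (simp add: lam_def exp_minus inverse_eq_divide)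
    define x where "x = Re (f p)"
    have "Re (f p ^ 2) = x ^ 2 - Im (f p) ^ 2" by (simp add: x_def power2_eq_square)
    moreover have "x ^ 2 + Im (f p) ^ 2 \<le> 1"
      using power_mono[OF fb[of p], of 2] unfolding cmod_power2 x_def by simp
    ultimately have Re_sq: "Re (f p ^ 2) \<ge> 2 * x ^ 2 - 1" by linarith
    \<comment> \<open>Completing the square. The terms with j = 2 are indispensable here, since the
      coefficient at j = 1 vanishes when \<open>f p\<close> is -1.\<close>
    have "0 \<le> 2 * (x + 1 / 2) ^ 2" by simp
    hence "2 + 2 * x + 2 * x ^ 2 \<ge> 3 / 2" by (simp add: power2_eq_square algebra_simps)
    moreover have "c (p, 1) + c (p, 2) = 3 + 2 * x + Re (f p ^ 2)" by (simp add: c_def x_def field_simps)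
    ultimately have "c (p, 1) + c (p, 2) \<ge> 1" using Re_sq by linarith
    hence "1 * (1 / real p) \<le> (c (p, 1) + c (p, 2)) * (1 / real p)"
      using p by (intro mult_right_mono) auto
    also have "\<dots> \<le> c (p, 1) * exp (- (1 / 2) * lam (p, 1)) + c (p, 2) * exp (- (1 / 2) * lam (p, 2))"
      unfolding e2 distrib_right using c0 e1 by (intro add_mono mult_left_mono) auto
    finally show "norm (1 / real p) \<le> c (p, 1) * exp (- (1 / 2) * lam (p, 1)) + c (p, 2) * exp (- (1 / 2) * lam (p, 2))"
      by simp
  qed
  hence "(\<lambda>p. 1 / real p) summable_on {p. prime p}" by (rule abs_summable_summable)
  thus False using not_summable_inverse_primes by blast
qed

end

section \<open>Lower bounds for Dirichlet L-functions\<close>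

text \<open>The Moebius map sending w to w/(2M - w) takes the half-plane Re w < M into the unit disc
  and fixes 0, so the Schwarz lemma applies after rescaling the disc.\<close>

lemma Borel_Caratheodory:
  fixes h :: "complex \<Rightarrow> complex"
  assumes hol: "h holomorphic_on ball 0 R" and h0: "h 0 = 0"
    and Re: "\<And>z. z \<in> ball 0 R \<Longrightarrow> Re (h z) < M" and z: "norm z < R"
  shows "norm (h z) \<le> 2 * M * norm z / (R - norm z)"
proof -
  have R: "R > 0" using z by (meson norm_ge_zero order.strict_trans1)
  have M: "M > 0" using Re[of 0] h0 R by simp
  have nz: "2 * M - h w \<noteq> 0" if "w \<in> ball 0 R" for w
    using Re[OF that] M by (auto simp: complex_eq_iff)
  define g where "g w = h (R * w) / (2 * M - h (R * w))" for w :: complex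
  have sub: "of_real R * w \<in> ball 0 R" if "norm w < 1" for w :: complex
    using that R by (simp add: norm_mult)
  have "g holomorphic_on ball 0 1"
    unfolding g_def using sub nz
    by (intro holomorphic_intros holomorphic_on_compose_gen[OF _ hol, unfolded o_def]) auto
  moreover have "g 0 = 0" by (simp add: g_def h0)
  moreover have "norm (g w) < 1" if w: "norm w < 1" for w
  proof -
    define u where "u = h (R * w)"
    have Reu: "Re u < M" unfolding u_def using Re[OF sub[OF w]] .
    have "norm u ^ 2 < norm (2 * M - u) ^ 2"
      using Reu M unfolding cmod_power2 by (simp add: power2_eq_square algebra_simps)
    hence "norm u < norm (2 * M - u)" by (rule power_less_imp_less_base) simp
    thus ?thesis using nz[OF sub[OF w]] unfolding g_def u_def by (simp add: norm_divide)
  qed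
  moreover have "norm (z / R) < 1" using z R by (simp add: norm_divide)
  ultimately have le: "norm (g (z / R)) \<le> norm (z / R)"
    by (rule Schwarz_Lemma(1))
  have gz: "g (z / R) = h z / (2 * M - h z)" using R by (simp add: g_def)
  have zR: "z \<in> ball 0 R" using z by simp
  have "norm (h z) * R \<le> norm z * norm (2 * M - h z)"
    using le nz[OF zR] R by (simp add: gz norm_divide field_simps)
  also have "norm (2 * M - h z) \<le> 2 * M + norm (h z)"
    using norm_triangle_ineq4[of "of_real (2 * M)" "h z"] M by (simp add: norm_mult)
  finally have "norm (h z) * R \<le> norm z * (2 * M + norm (h z))"
    by (simp add: mult_left_mono)
  thus ?thesis using z by (simp add: field_simps)
qed

text \<open>A nonvanishing \<open>f\<close> has a holomorphic logarithm, whose real part is bounded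
  above through \<open>K\<close>. On a smaller disc the Borel-Caratheodory inequality turns this
  one-sided bound into a bound for the modulus of the logarithm, hence for 1/f; the two radii
  determine the exponent.\<close>

lemma norm_inverse_le_of_nonvanishing:
  fixes f :: "complex \<Rightarrow> complex"
  assumes hol: "f holomorphic_on ball 0 R" and nz: "\<And>z. z \<in> ball 0 R \<Longrightarrow> f z \<noteq> 0"
    and K: "\<And>z. z \<in> ball 0 R \<Longrightarrow> norm (f z) < K" and r: "r < R" and z: "norm z \<le> r"
  shows "norm (inverse (f z)) \<le> (K / norm (f 0)) powr (2 * r / (R - r)) / norm (f 0)"
proof -
  have r0: "0 \<le> r" using z norm_ge_zero order_trans by blast
  have R: "0 < R" using r r0 by simp
  have f0: "f 0 \<noteq> 0" using nz R by simp
  obtain g where g: "g holomorphic_on ball 0 R" "\<And>z. z \<in> ball 0 R \<Longrightarrow> f z = exp (g z)"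
    using contractible_imp_holomorphic_log[OF hol _ nz] convex_imp_contractible[OF convex_ball] by metis
  define M where "M = ln (K / norm (f 0))"
  have K1: "K / norm (f 0) > 1" using K[of 0] R f0 by simp
  have M: "M > 0" unfolding M_def using K1 by simp
  define h where "h w = g w - g 0" for w
  have nh: "norm (f w) = norm (f 0) * exp (Re (h w))" if "w \<in> ball 0 R" for w
    using g(2)[OF that] g(2)[of 0] R by (simp add: h_def exp_diff)
  have "norm (h z) \<le> 2 * M * norm z / (R - norm z)"
  proof (rule Borel_Caratheodory)
    show "h holomorphic_on ball 0 R" unfolding h_def by (intro holomorphic_intros g)
    show "h 0 = 0" by (simp add: h_def)
    fix w :: complex assume w: "w \<in> ball 0 R"
    have "exp (Re (h w)) < K / norm (f 0)" using nh[OF w] K[OF w] f0 by (simp add: field_simps)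
    also have "\<dots> = exp M" unfolding M_def using K1 by simp
    finally show "Re (h w) < M" by simp
  qed (use z r in auto)
  also have "\<dots> \<le> 2 * M * r / (R - r)" using z r r0 M by (intro frac_le mult_left_mono) auto
  finally have hz: "norm (h z) \<le> M * (2 * r / (R - r))" by (simp add: mult_ac)
  have zR: "z \<in> ball 0 R" using z r by simp
  have "norm (inverse (f z)) = exp (- Re (h z)) / norm (f 0)"
    using nh[OF zR] f0 by (simp only: norm_inverse exp_minus divide_inverse inverse_mult_distrib mult.commute)
  also have "- Re (h z) \<le> norm (h z)" by (metis abs_Re_le_cmod abs_le_D2)
  hence "exp (- Re (h z)) / norm (f 0) \<le> exp (M * (2 * r / (R - r))) / norm (f 0)"
    using hz f0 by (intro divide_right_mono) auto
  also have "exp (M * (2 * r / (R - r))) = (K / norm (f 0)) powr (2 * r / (R - r))"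
    using K1 unfolding powr_def M_def by (auto simp: mult.commute)
  finally show ?thesis .
qed

lemma dirichlet_inverse_power:
  assumes q: "q > 0" and chi: "dcharacter q chi" "chi \<noteq> principal_char q" and s: "Re s > 1"
  shows "(\<Sum>\<^sub>\<infinity>n\<in>{0<..}. of_real (zeta_inv_coeff k n) * (chi n * npowr s n)) * L_cont chi s ^ k = 1"
  unfolding L_cont_series[OF q chi s]
proof (rule zeta_inv_coeff_inverse[where \<sigma> = "Re s"])
  show "chi 1 * npowr s 1 = 1" using chi npowr_1 by (simp add: dcharacter_def)
  show "chi (m * n) * npowr s (m * n) = chi m * npowr s m * (chi n * npowr s n)" for m n
    using chi by (simp add: dcharacter_def npowr_mult)
  show "norm (chi n * npowr s n) \<le> real n powr (-Re s)" for n
    using norm_dcharacter_le[OF chi(1) q, of n] mult_right_mono[of "norm (chi n)" 1 "real n powr (-Re s)"]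
    by (simp add: norm_mult norm_npowr)
qed (use s in auto)

text \<open>\<open>GRH\<close> speaks only of the open strip 0 < Re s < 1. The line Re s = 1 needs
  Landau's argument, and the half-plane beyond it the absolutely convergent inverse series.\<close>

lemma L_cont_nonzero:
  assumes GRH and q: "q > 0" and chi: "dcharacter q chi" "chi \<noteq> principal_char q" and s: "Re s > 1 / 2"
  shows "L_cont chi s \<noteq> 0"
proof -
  consider "Re s < 1" | "Re s = 1" | "Re s > 1" by linarith
  thus ?thesis
  proof cases
    case 1
    have "dirichlet_L q chi s = 0 \<longrightarrow> Re s = 1 / 2"
      using \<open>GRH\<close> q chi(1) s 1 unfolding GRH_def by (metis One_nat_def Suc_leI half_gt_zero less_trans zero_less_one)
    thus ?thesis using L_cont_eq[OF q chi, of s] s by auto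
  next
    case 2
    have "s = 1 + \<i> * of_real (Im s)" using 2 by (simp add: complex_eq_iff)
    thus ?thesis using dirichlet_L_nonzero_line_1[OF q chi, of "Im s"] by simp
  next
    case 3
    show ?thesis using dirichlet_inverse_power[OF q chi 3, of 1] by auto
  qed
qed

lemma has_sum_finite_sum:
  fixes f :: "'i \<Rightarrow> 'a \<Rightarrow> 'b::{topological_comm_monoid_add}"
  assumes "finite I" and "\<And>i. i \<in> I \<Longrightarrow> (f i has_sum S i) A"
  shows "((\<lambda>x. \<Sum>i\<in>I. f i x) has_sum (\<Sum>i\<in>I. S i)) A"
  using assms by (induction I rule: finite_induct) (auto intro: has_sum_add)

text \<open>The radius 3/2 is the distance from 2 to the critical line, the largest for which
  \<open>GRH\<close> keeps the open disc free of zeros.\<close>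

lemma in_ball_2:
  assumes "norm u < 3 / 2"
  shows "Re (2 - u) > 1 / 2" "norm (2 - u) < 4"
proof -
  show "Re (2 - u) > 1 / 2" using complex_Re_le_cmod[of u] assms by simp
  have "norm (2 - u) \<le> norm (2::complex) + norm u" by (rule norm_triangle_ineq4)
  thus "norm (2 - u) < 4" using assms by simp
qed

lemma holomorphic_dirichlet_L_shift:
  assumes q: "q > 0" and chi: "dcharacter q chi" "chi \<noteq> principal_char q"
  shows "(\<lambda>u. L_cont chi (2 - u)) holomorphic_on ball 0 (3/2)"
proof (rule holomorphic_on_compose_gen[OF _ holomorphic_L_cont[OF q chi], unfolded o_def])
  show "(\<lambda>u. 2 - u) ` ball (0::complex) (3/2) \<subseteq> {s. 0 < Re s}"
  proof
    fix s assume "s \<in> (\<lambda>u. 2 - u) ` ball (0::complex) (3/2)"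
    then obtain u where "s = 2 - u" "norm u < 3 / 2" by auto
    thus "s \<in> {s. 0 < Re s}" using in_ball_2(1)[of u] by simp
  qed
qed (intro holomorphic_intros)

text \<open>On the disc of radius R = 3/2 the L-function is at most linear in \<open>q\<close>, and
  at the centre 2 its inverse is bounded independently of \<open>q\<close> and \<open>chi\<close>.
  The inner radius r = 5/4 exceeds 1, so that u = 1 lies strictly inside; the exponent 10 is 2r/(R -
  r).\<close>

lemma inverse_dirichlet_L_bound:
  assumes GRH
  shows "\<exists>C>0. \<forall>q>0. \<forall>chi. dcharacter q chi \<longrightarrow> chi \<noteq> principal_char q \<longrightarrow>
           (\<forall>u. norm u \<le> 5 / 4 \<longrightarrow> norm (inverse (L_cont chi (2 - u))) \<le> C * real q ^ 10)"
proof -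
  define Z where "Z = (\<Sum>n. real n powr (-(3/2)))"
  have Z0: "Z \<ge> 0" unfolding Z_def by (intro suminf_nonneg summable_nat_powr) auto
  define A where "A = (\<Sum>\<^sub>\<infinity>n\<in>{0<..}. \<bar>zeta_inv_coeff 1 n\<bar> * real n powr (-2))"
  have smA: "(\<lambda>n. \<bar>zeta_inv_coeff 1 n\<bar> * real n powr (-2)) summable_on {0<..}"
    by (rule summable_on_zeta_inv_coeff) simp
  have A1: "A \<ge> 1"
    using finite_sum_le_infsum[OF smA, of "{1}"] by (simp add: A_def)
  define C where "C = ((4 * Z + 1) * A) ^ 10 * A"
  have "C > 0" unfolding C_def using Z0 A1 by (intro mult_pos_pos zero_less_power) auto
  moreover have "norm (inverse (L_cont chi (2 - u))) \<le> C * real q ^ 10"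
    if q: "q > 0" and chi: "dcharacter q chi" "chi \<noteq> principal_char q" and u: "norm u \<le> 5 / 4" for q chi u
  proof -
    define f where "f u = L_cont chi (2 - u)" for u
    \<comment> \<open>The summand 1 makes the upper bound strict, as
      \<open>norm_inverse_le_of_nonvanishing\<close> demands.\<close>
    define K where "K = real q * (4 * Z + 1)"
    have "norm (inverse (f u)) \<le> (K / norm (f 0)) powr (2 * (5/4) / (3/2 - 5/4)) / norm (f 0)"
    proof (rule norm_inverse_le_of_nonvanishing)
      show "f holomorphic_on ball 0 (3/2)" unfolding f_def by (rule holomorphic_dirichlet_L_shift[OF q chi])
      fix z :: complex assume "z \<in> ball 0 (3/2)"
      hence z: "norm z < 3 / 2" by simp
      show "f z \<noteq> 0" unfolding f_def using L_cont_nonzero[OF \<open>GRH\<close> q chi in_ball_2(1)[OF z]] .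
      have "norm (f z) \<le> real q * norm (2 - z) * Z"
        unfolding f_def L_cont_def Z_def
        by (rule norm_abel_le[OF norm_sum_dcharacter[OF q chi]]) (use in_ball_2(1)[OF z] in simp)
      also have "\<dots> \<le> real q * 4 * Z"
        using in_ball_2(2)[OF z] Z0 q by (intro mult_right_mono mult_left_mono) auto
      also have "\<dots> < K" unfolding K_def using q by (simp add: algebra_simps)
      finally show "norm (f z) < K" .
    qed (use u in auto)
    also have "2 * (5/4) / (3/2 - 5/4) = (real 10)" by simp
    also have "(K / norm (f 0)) powr real 10 / norm (f 0) = (K * inverse (norm (f 0))) ^ 10 * inverse (norm (f 0))"
    proof -
      have "f 0 \<noteq> 0" unfolding f_def using L_cont_nonzero[OF \<open>GRH\<close> q chi in_ball_2(1)[of 0]] by simp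
      moreover have "K > 0" unfolding K_def using q Z0 by simp
      ultimately have "K / norm (f 0) > 0" by simp
      thus ?thesis by (simp only: powr_realpow divide_inverse)
    qed
    also have "\<dots> \<le> (K * A) ^ 10 * A"
    proof -
      define S where "S = (\<Sum>\<^sub>\<infinity>n\<in>{0<..}. of_real (zeta_inv_coeff 1 n) * (chi n * npowr 2 n))"
      have "S * f 0 = 1"
        using dirichlet_inverse_power[OF q chi, of 2 1] by (simp add: S_def f_def)
      hence "inverse (f 0) = S" by (metis inverse_unique mult.commute)
      hence "inverse (norm (f 0)) = norm S" by (simp add: norm_inverse [symmetric])
      also have "norm S \<le> A"
      proof (rule norm_infsum_le)
        let ?t = "\<lambda>n. of_real (zeta_inv_coeff 1 n) * (chi n * npowr 2 n)"
        have le: "norm (?t n) \<le> \<bar>zeta_inv_coeff 1 n\<bar> * real n powr (-2)" for n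
          unfolding norm_mult norm_of_real norm_npowr
          using mult_right_mono[OF norm_dcharacter_le[OF chi(1) q, of n], of "real n powr (-2)"]
          by (intro mult_left_mono) auto
        thus "norm (?t n) \<le> \<bar>zeta_inv_coeff 1 n\<bar> * real n powr (-2)" for n .
        have "(\<lambda>n. norm (?t n)) summable_on {0<..}"
          by (rule abs_summable_comparison[OF smA]) (rule le)
        thus "(?t has_sum S) {0<..}" unfolding S_def by (rule has_sum_infsum[OF abs_summable_summable])
        show "((\<lambda>n. \<bar>zeta_inv_coeff 1 n\<bar> * real n powr (-2)) has_sum A) {0<..}"
          unfolding A_def using smA by (rule has_sum_infsum)
      qed
      finally have le: "inverse (norm (f 0)) \<le> A" .
      have "K \<ge> 0" unfolding K_def using Z0 by simp
      thus ?thesis using le A1 by (intro mult_mono power_mono mult_left_mono) auto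
    qed
    also have "(K * A) ^ 10 * A = C * real q ^ 10"
      by (simp add: K_def C_def power_mult_distrib mult_ac)
    finally show ?thesis unfolding f_def .
  qed
  ultimately show ?thesis by blast
qed

section \<open>Poisson weights and the truncated Taylor series\<close>

definition poisson_weight :: "nat \<Rightarrow> nat \<Rightarrow> real" where
  "poisson_weight J n = (\<Sum>j\<le>J. ln (real n) ^ j / fact j) / real n"

lemma poisson_weight_nonneg: "poisson_weight J n \<ge> 0"
  unfolding poisson_weight_def
  by (cases "n = 0") (auto intro!: divide_nonneg_nonneg sum_nonneg)

text \<open>Chernoff bounds for both tails of a Poisson distribution with mean \<open>ln n\<close>.\<close>

lemma poisson_weight_le:
  assumes n: "n > 0" and z: "0 < z" "z \<le> 1"
  shows "poisson_weight J n \<le> (1 / z) ^ J * real n powr (z - 1)"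
proof -
  define x where "x = ln (real n)"
  have x: "x \<ge> 0" using n by (simp add: x_def)
  have "(\<Sum>j\<le>J. x ^ j / fact j) \<le> (\<Sum>j\<le>J. (1 / z) ^ J * ((z * x) ^ j / fact j))"
  proof (rule sum_mono)
    fix j assume "j \<in> {..J}"
    hence "(1 / z) ^ j \<le> (1 / z) ^ J" using z by (intro power_increasing) auto
    hence "(1 / z) ^ j * ((z * x) ^ j / fact j) \<le> (1 / z) ^ J * ((z * x) ^ j / fact j)"
      using x z by (intro mult_right_mono) auto
    moreover have "(1 / z) ^ j * ((z * x) ^ j / fact j) = x ^ j / fact j"
      using z by (simp add: power_mult_distrib power_divide)
    ultimately show "x ^ j / fact j \<le> (1 / z) ^ J * ((z * x) ^ j / fact j)" by simp
  qed
  also have "\<dots> = (1 / z) ^ J * (\<Sum>j\<le>J. (z * x) ^ j / fact j)" by (rule sum_distrib_left [symmetric])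
  also have "\<dots> \<le> (1 / z) ^ J * exp (z * x)"
    using x z by (intro mult_left_mono finite_sum_le_has_sum[OF has_sum_exp_real]) auto
  also have "exp (z * x) = real n powr z" using n by (simp add: powr_def x_def)
  finally have "(\<Sum>j\<le>J. x ^ j / fact j) / real n \<le> (1 / z) ^ J * real n powr z / real n"
    by (rule divide_right_mono) simp
  thus ?thesis using n by (simp add: poisson_weight_def x_def powr_diff)
qed

lemma poisson_weight_le_1: "n > 0 \<Longrightarrow> poisson_weight J n \<le> 1"
  using poisson_weight_le[of n 1 J] by simp

lemma poisson_weight_ge:
  assumes n: "n > 0" and z: "z \<ge> 1"
  shows "1 - poisson_weight J n \<le> (1 / z) ^ J * real n powr (z - 1)"
proof -
  define x where "x = ln (real n)"
  have x: "x \<ge> 0" using n by (simp add: x_def)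
  let ?S = "\<Sum>j\<le>J. x ^ j / fact j"
  have "exp x \<le> ?S + (1 / z) ^ J * exp (z * x)"
  proof (rule has_sum_mono[OF has_sum_exp_real])
    have "((\<lambda>j. if j \<le> J then x ^ j / fact j else 0) has_sum ?S) UNIV"
      by (rule has_sum_finite_neutralI[where B = "{..J}"]) auto
    thus "((\<lambda>j. (if j \<le> J then x ^ j / fact j else 0) + (1 / z) ^ J * ((z * x) ^ j / fact j)) has_sum
            (?S + (1 / z) ^ J * exp (z * x))) UNIV"
      by (intro has_sum_add has_sum_cmult_right has_sum_exp_real)
    fix j
    show "x ^ j / fact j \<le> (if j \<le> J then x ^ j / fact j else 0) + (1 / z) ^ J * ((z * x) ^ j / fact j)"
    proof (cases "j \<le> J")
      case False
      hence "(1 / z) ^ j \<le> (1 / z) ^ J" using z by (intro power_decreasing) auto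
      hence "(1 / z) ^ j * ((z * x) ^ j / fact j) \<le> (1 / z) ^ J * ((z * x) ^ j / fact j)"
        using x z by (intro mult_right_mono) auto
      moreover have "(1 / z) ^ j * ((z * x) ^ j / fact j) = x ^ j / fact j"
        using z by (simp add: power_mult_distrib power_divide)
      ultimately show ?thesis using False by simp
    qed (use x z in simp)
  qed
  moreover have "exp x = real n" "exp (z * x) = real n powr z" using n by (auto simp: powr_def x_def)
  ultimately have "real n - ?S \<le> (1 / z) ^ J * real n powr z" by simp
  hence "(real n - ?S) / real n \<le> (1 / z) ^ J * real n powr z / real n"
    by (rule divide_right_mono) simp
  thus ?thesis using n by (simp add: poisson_weight_def x_def powr_diff diff_divide_distrib)
qed

definition approx_coeff :: "nat \<Rightarrow> nat \<Rightarrow> nat \<Rightarrow> real" where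
  "approx_coeff k J n = zeta_inv_coeff k n * poisson_weight J n / real n"

text \<open>The disc of radius \<open>5/4\<close> about \<open>2\<close> contains \<open>1\<close>, so the Taylor series of \<open>L(s, \<chi>)\<^sup>-\<^sup>k\<close> at \<open>2\<close>
  converges geometrically at \<open>1\<close>; its partial sums are Dirichlet series weighted by Poisson
  probabilities.\<close>

theorem inverse_dirichlet_L_approx:
  assumes GRH
  shows "\<exists>C>0. \<forall>q>0. \<forall>chi. dcharacter q chi \<longrightarrow> chi \<noteq> principal_char q \<longrightarrow>
           (\<forall>J. norm (inverse (L_cont chi 1) ^ k
                   - (\<Sum>\<^sub>\<infinity>n\<in>{0<..}. of_real (approx_coeff k J n) * chi n)) \<le> C * real q ^ (10 * k) * (4 / 5) ^ J)"
proof -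
  obtain C0 where C0: "C0 > 0" "\<And>q chi u. q > 0 \<Longrightarrow> dcharacter q chi \<Longrightarrow> chi \<noteq> principal_char q \<Longrightarrow> norm u \<le> 5 / 4 \<Longrightarrow>
      norm (inverse (L_cont chi (2 - u))) \<le> C0 * real q ^ 10"
    using inverse_dirichlet_L_bound[OF assms] by blast
  have "norm (inverse (L_cont chi 1) ^ k - (\<Sum>\<^sub>\<infinity>n\<in>{0<..}. of_real (approx_coeff k J n) * chi n))
          \<le> (4 * C0 ^ k) * real q ^ (10 * k) * (4 / 5) ^ J"
    if q: "q > 0" and chi: "dcharacter q chi" "chi \<noteq> principal_char q" for q chi J
  proof -
    define F where "F u = inverse (L_cont chi (2 - u)) ^ k" for u
    define M where "M = C0 ^ k * real q ^ (10 * k)"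
    define c where "c n = of_real (zeta_inv_coeff k n) * chi n" for n
    define b where "b = dirichlet_taylor {0<..} c (\<lambda>n. ln (real n))"
    have holF: "F holomorphic_on ball 0 (3/2)"
      unfolding F_def
      using L_cont_nonzero[OF assms q chi in_ball_2(1)]
      by (intro holomorphic_intros holomorphic_dirichlet_L_shift[OF q chi]) auto
    have FM: "norm (F u) \<le> M" if "norm u \<le> 5 / 4" for u
    proof -
      have "norm (F u) \<le> (C0 * real q ^ 10) ^ k"
        unfolding F_def norm_power using C0(2)[OF q chi that] by (intro power_mono) auto
      thus ?thesis by (simp add: M_def power_mult_distrib power_mult)
    qed
    have lam: "ln (real n) \<ge> 0" if "n \<in> {0<..}" for n :: nat using that by simp
    have cn: "norm (c n) \<le> \<bar>zeta_inv_coeff k n\<bar>" for n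
      using mult_left_mono[OF norm_dcharacter_le[OF chi(1) q, of n], of "\<bar>zeta_inv_coeff k n\<bar>"]
      by (simp add: c_def norm_mult)
    have summ: "(\<lambda>n. norm (c n) * exp (- \<sigma> * ln (real n))) summable_on {0<..}" if "\<sigma> > 1" for \<sigma>
    proof -
      have "(\<lambda>n. norm (norm (c n) * exp (- \<sigma> * ln (real n)))) summable_on {0<..}"
      proof (rule abs_summable_comparison[OF summable_on_zeta_inv_coeff[OF that, of k]])
        fix n :: nat assume "n \<in> {0<..}"
        hence "exp (- \<sigma> * ln (real n)) = real n powr (-\<sigma>)" by (simp add: powr_def)
        thus "norm (norm (c n) * exp (- \<sigma> * ln (real n))) \<le> \<bar>zeta_inv_coeff k n\<bar> * real n powr (-\<sigma>)"
          using mult_right_mono[OF cn[of n], of "real n powr (-\<sigma>)"] by simp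
      qed
      thus ?thesis by (rule abs_summable_summable)
    qed
    have Feq: "F u = (\<Sum>\<^sub>\<infinity>n\<in>{0<..}. c n * exp (- (2 - u) * of_real (ln (real n))))" if u: "norm u < 1" for u
    proof -
      have Re: "Re (2 - u) > 1" using u complex_Re_le_cmod[of u] by simp
      have "(\<Sum>\<^sub>\<infinity>n\<in>{0<..}. of_real (zeta_inv_coeff k n) * (chi n * npowr (2 - u) n)) * L_cont chi (2 - u) ^ k = 1"
        by (rule dirichlet_inverse_power[OF q chi Re])
      hence "F u = (\<Sum>\<^sub>\<infinity>n\<in>{0<..}. of_real (zeta_inv_coeff k n) * (chi n * npowr (2 - u) n))"
        unfolding F_def power_inverse by (metis inverse_unique mult.commute)
      also have "\<dots> = (\<Sum>\<^sub>\<infinity>n\<in>{0<..}. c n * exp (- (2 - u) * of_real (ln (real n))))"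
        by (rule infsum_cong) (simp add: c_def npowr_exp)
      finally show ?thesis .
    qed
    have bF: "b j = (deriv ^^ j) F 0 / fact j" for j
      unfolding b_def by (rule dirichlet_taylor_eq_deriv[OF lam summ Feq])
    \<comment> \<open>Cauchy's inequality on the circle of radius 5/4 is the source of the ratio
      4/5.\<close>
    have bM: "norm (b j) \<le> M * (4 / 5) ^ j" for j
    proof -
      have "norm ((deriv ^^ j) F 0) \<le> fact j * M / (5 / 4) ^ j"
      proof (rule Cauchy_inequality)
        show "F holomorphic_on ball 0 (5/4)" by (rule holomorphic_on_subset[OF holF]) auto
        show "continuous_on (cball 0 (5/4)) F"
          by (rule continuous_on_subset[OF holomorphic_on_imp_continuous_on[OF holF]]) auto
      qed (use FM in auto)
      thus ?thesis by (simp add: bF norm_divide power_divide field_simps)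
    qed
    have "(\<lambda>j. (deriv ^^ j) F 0 / fact j * (1 - 0) ^ j) sums F 1"
      by (rule holomorphic_power_series[OF holF]) auto
    hence sb: "b sums F 1" by (simp add: bF [symmetric])
    hence tail: "(\<lambda>j. b (j + Suc J)) sums (F 1 - (\<Sum>j<Suc J. b j))"
      by (rule sums_split_initial_segment)
    \<comment> \<open>The factor 4 is the geometric tail: (4/5)^(J+1) divided by 1 - 4/5.\<close>
    have "norm (F 1 - (\<Sum>j<Suc J. b j)) \<le> 4 * M * (4 / 5) ^ J"
    proof -
      have g: "(\<lambda>j. M * (4 / 5) ^ Suc J * (4 / 5) ^ j) sums (M * (4 / 5) ^ Suc J * (1 / (1 - 4 / 5)))"
        by (intro sums_mult geometric_sums) auto
      have "norm (b (j + Suc J)) \<le> M * (4 / 5) ^ Suc J * (4 / 5) ^ j" for j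
        using bM[of "j + Suc J"] by (simp add: power_add mult_ac)
      from norm_suminf_le[OF this sums_summable[OF g]] 
      have "norm (\<Sum>j. b (j + Suc J)) \<le> M * (4 / 5) ^ Suc J * (1 / (1 - 4 / 5))"
        unfolding sums_unique[OF g, symmetric] .
      thus ?thesis unfolding sums_unique[OF tail, symmetric] by simp
    qed
    moreover have "(\<Sum>j<Suc J. b j) = (\<Sum>\<^sub>\<infinity>n\<in>{0<..}. of_real (approx_coeff k J n) * chi n)"
    proof -
      have hs: "((\<lambda>n. c n * of_real (exp (-2 * ln (real n)) * ln (real n) ^ j / fact j)) has_sum b j) {0<..}" for j
      proof -
        have nn: "norm (c n) \<ge> 0" for n by simp
        have "(\<lambda>n. norm (c n) * (exp (-2 * ln (real n)) * ln (real n) ^ j / fact j)) summable_on {0<..}"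
          by (rule dirichlet_taylor_summable[OF nn lam summ])
        hence "(\<lambda>n. norm (c n * of_real (exp (-2 * ln (real n)) * ln (real n) ^ j / fact j))) summable_on {0<..}"
          by (subst summable_on_cong[of _ _ "\<lambda>n. norm (c n) * (exp (-2 * ln (real n)) * ln (real n) ^ j / fact j)"])
             (auto simp: norm_mult norm_divide norm_power)
        thus ?thesis unfolding b_def dirichlet_taylor_def by (rule has_sum_infsum[OF abs_summable_summable])
      qed
      have "((\<lambda>n. \<Sum>j<Suc J. c n * of_real (exp (-2 * ln (real n)) * ln (real n) ^ j / fact j)) has_sum (\<Sum>j<Suc J. b j)) {0<..}"
        by (rule has_sum_finite_sum) (use hs in auto)
      hence "(\<Sum>j<Suc J. b j) = (\<Sum>\<^sub>\<infinity>n\<in>{0<..}. \<Sum>j<Suc J. c n * of_real (exp (-2 * ln (real n)) * ln (real n) ^ j / fact j))"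
        by (rule infsumI [symmetric])
      also have "\<dots> = (\<Sum>\<^sub>\<infinity>n\<in>{0<..}. of_real (approx_coeff k J n) * chi n)"
      proof (rule infsum_cong)
        fix n :: nat assume n: "n \<in> {0<..}"
        \<comment> \<open>One factor 1/n becomes the normalisation inside
          \<open>poisson_weight\<close>, the other remains in \<open>approx_coeff\<close>.\<close>
        have e: "exp (-2 * ln (real n)) = 1 / real n * (1 / real n)"
        proof -
          have "exp (-2 * ln (real n)) = exp (- ln (real n)) * exp (- ln (real n))" by (simp add: exp_add [symmetric])
          thus ?thesis using n by (simp add: exp_minus inverse_eq_divide)
        qed
        have "(\<Sum>j<Suc J. exp (-2 * ln (real n)) * ln (real n) ^ j / fact j) = poisson_weight J n / real n"
          unfolding poisson_weight_def e lessThan_Suc_atMost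
          by (simp add: sum_divide_distrib mult_ac)
        hence "(\<Sum>j<Suc J. c n * of_real (exp (-2 * ln (real n)) * ln (real n) ^ j / fact j)) = c n * of_real (poisson_weight J n / real n)"
          by (simp only: sum_distrib_left [symmetric] of_real_sum [symmetric])
        thus "(\<Sum>j<Suc J. c n * of_real (exp (-2 * ln (real n)) * ln (real n) ^ j / fact j)) = of_real (approx_coeff k J n) * chi n"
          by (simp add: c_def approx_coeff_def mult_ac)
      qed
      finally show ?thesis .
    qed
    moreover have "F 1 = inverse (L_cont chi 1) ^ k" by (simp add: F_def)
    ultimately show ?thesis by (simp add: M_def mult_ac)
  qed
  thus ?thesis using C0(1) by (intro exI[of _ "4 * C0 ^ k"]) auto
qed

section \<open>The second moment\<close>

lemma has_sum_product:
  fixes f :: "'i \<Rightarrow> 'a::{banach, real_normed_field}"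
  assumes f: "(\<lambda>x. norm (f x)) summable_on A" and g: "(\<lambda>y. norm (g y)) summable_on B"
  shows "((\<lambda>(x, y). f x * g y) has_sum (infsum f A * infsum g B)) (A \<times> B)"
proof -
  have "(\<lambda>p. norm (case p of (x, y) \<Rightarrow> f x * g y)) summable_on A \<times> B"
    unfolding Infinite_Sum.abs_summable_on_Sigma_iff
  proof (intro conjI ballI)
    fix x
    show "(\<lambda>y. norm (case (x, y) of (x, y) \<Rightarrow> f x * g y)) summable_on B"
      using summable_on_cmult_right[OF g, of "norm (f x)"] by (simp add: norm_mult)
  next
    have eq: "norm (\<Sum>\<^sub>\<infinity>y\<in>B. norm (case (x, y) of (x, y) \<Rightarrow> f x * g y)) = norm (f x) * (\<Sum>\<^sub>\<infinity>y\<in>B. norm (g y))" for x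
      by (simp add: norm_mult infsum_cmult_right' abs_mult infsum_nonneg)
    show "(\<lambda>x. norm (\<Sum>\<^sub>\<infinity>y\<in>B. norm (case (x, y) of (x, y) \<Rightarrow> f x * g y))) summable_on A"
      unfolding eq by (rule summable_on_cmult_left[OF f])
  qed
  hence sm: "(\<lambda>p. case p of (x, y) \<Rightarrow> f x * g y) summable_on A \<times> B" by (rule abs_summable_summable)
  show ?thesis
  proof (rule has_sum_SigmaI[OF _ _ sm])
    show "((\<lambda>y. case (x, y) of (x, y) \<Rightarrow> f x * g y) has_sum (f x * infsum g B)) B" for x
      using has_sum_cmult_right[OF has_sum_infsum[OF abs_summable_summable[OF g]], of "f x"] by simp
    show "((\<lambda>x. f x * infsum g B) has_sum (infsum f A * infsum g B)) A"
      by (rule has_sum_cmult_left[OF has_sum_infsum[OF abs_summable_summable[OF f]]])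
  qed
qed

text \<open>Each squared norm is a double sum over pairs, into which the finite sum over characters
  is carried so that orthogonality applies to every pair.\<close>

lemma sum_norm_sq_dcharacter:
  fixes d :: "nat \<Rightarrow> real"
  assumes q: "q > 0" and d: "(\<lambda>n. \<bar>d n\<bar>) summable_on {0<..}"
  shows "((\<lambda>(m, n). real (totient q) * (if coprime n q \<and> [m = n] (mod q) then d m * d n else 0)) has_sum
           (\<Sum>chi | dcharacter q chi. (norm (\<Sum>\<^sub>\<infinity>n\<in>{0<..}. of_real (d n) * chi n))\<^sup>2)) ({0<..} \<times> {0<..})"
proof -
  let ?X = "{0<..} \<times> {0::nat<..}"
  let ?P = "\<lambda>chi. \<Sum>\<^sub>\<infinity>n\<in>{0<..}. of_real (d n) * chi n :: complex"
  let ?g = "\<lambda>(m, n). if coprime n q \<and> [m = n] (mod q) then d m * d n else 0"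
  have one: "((\<lambda>(m, n). (of_real (d m) * chi m) * (of_real (d n) * cnj (chi n))) has_sum of_real ((norm (?P chi))\<^sup>2)) ?X"
    if chi: "dcharacter q chi" for chi
  proof -
    have le: "norm (of_real (d n) * chi n) \<le> \<bar>d n\<bar>" for n
      using mult_left_mono[OF norm_dcharacter_le[OF chi q, of n], of "\<bar>d n\<bar>"] by (simp add: norm_mult)
    have s1: "(\<lambda>n. norm (of_real (d n) * chi n)) summable_on {0<..}"
      by (rule abs_summable_comparison[OF d]) (rule le)
    have s2: "(\<lambda>n. norm (of_real (d n) * cnj (chi n))) summable_on {0<..}"
      using s1 by (simp add: norm_mult)
    have "cnj (?P chi) = (\<Sum>\<^sub>\<infinity>n\<in>{0<..}. of_real (d n) * cnj (chi n))"
      by (subst infsum_cnj [symmetric]) simp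
    hence "of_real ((norm (?P chi))\<^sup>2) = ?P chi * (\<Sum>\<^sub>\<infinity>n\<in>{0<..}. of_real (d n) * cnj (chi n))"
      using complex_norm_square[of "?P chi"] by simp
    thus ?thesis using has_sum_product[OF s1 s2] by (simp only:)
  qed
  have "((\<lambda>x. \<Sum>chi | dcharacter q chi. (\<lambda>(m, n). (of_real (d m) * chi m) * (of_real (d n) * cnj (chi n))) x) has_sum
          (\<Sum>chi | dcharacter q chi. of_real ((norm (?P chi))\<^sup>2))) ?X"
    by (rule has_sum_finite_sum[OF finite_dcharacter[OF q]]) (use one in simp)
  moreover have "(\<Sum>chi | dcharacter q chi. (\<lambda>(m, n). (of_real (d m) * chi m) * (of_real (d n) * cnj (chi n))) x)
      = complex_of_real ((\<lambda>(m, n). real (totient q) * ?g (m, n)) x)" for x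
  proof -
    obtain m n where x: "x = (m, n)" by (cases x)
    have "(\<Sum>chi | dcharacter q chi. (of_real (d m) * chi m) * (of_real (d n) * cnj (chi n)))
        = of_real (d m * d n) * (\<Sum>chi | dcharacter q chi. chi m * cnj (chi n))"
      unfolding sum_distrib_left by (intro sum.cong refl) (simp add: mult_ac)
    thus ?thesis unfolding dcharacter_orthogonality[OF q] x by simp
  qed
  ultimately have "((\<lambda>x. complex_of_real ((\<lambda>(m, n). real (totient q) * ?g (m, n)) x)) has_sum
      of_real (\<Sum>chi | dcharacter q chi. (norm (?P chi))\<^sup>2)) ?X"
    by simp
  thus ?thesis unfolding has_sum_of_real_iff by simp
qed

text \<open>For m < n the congruence means n = m + l q with l > 0, so n^(-s) is at most l^(-s)
  q^(-s) and the double sum factors. The pairs with m > n follow by symmetry, whence the factor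
  2.\<close>

lemma off_diagonal_bound:
  assumes q: "q > 0" and s: "s > 1"
  defines "W \<equiv> \<Sum>\<^sub>\<infinity>n\<in>{0<..}. real n powr (-s)"
  shows "\<exists>V. V \<le> 2 * W ^ 2 * real q powr (-s) \<and>
    ((\<lambda>(m, n). real m powr (-s) * real n powr (-s)) has_sum V)
      {(m, n). m > 0 \<and> n > 0 \<and> m \<noteq> n \<and> [m = n] (mod q)}"
proof -
  let ?f = "\<lambda>(m, n). real m powr (-s) * real n powr (-s)"
  define O1 where "O1 = (\<lambda>(m, l). (m, m + l * q)) ` ({0<..} \<times> {0<..})"
  have ps: "(\<lambda>n. norm (real n powr (-s))) summable_on {0<..}"
    using summable_on_nat_powr[OF s] by simp
  have inj: "inj_on (\<lambda>(m, l). (m, m + l * q)) ({0<..} \<times> {0<..})"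
    using q by (auto intro!: inj_onI)
  have prod: "((\<lambda>(m, l). real m powr (-s) * real l powr (-s)) has_sum (W * W)) ({0<..} \<times> {0<..})"
    unfolding W_def by (rule has_sum_product[OF ps ps])
  have prod': "((\<lambda>x. (\<lambda>(m, l). real m powr (-s) * real l powr (-s)) x * real q powr (-s)) has_sum (W * W * real q powr (-s))) ({0<..} \<times> {0<..})"
    by (rule has_sum_cmult_left[OF prod])
  have le: "(?f \<circ> (\<lambda>(m, l). (m, m + l * q))) x \<le> (\<lambda>(m, l). real m powr (-s) * real l powr (-s)) x * real q powr (-s)"
    if xpos: "x \<in> {0<..} \<times> {0<..}" for x
  proof -
    obtain m l where x: "x = (m, l)" "m > 0" "l > 0" using xpos by auto
    have "real (m + l * q) powr (-s) \<le> real (l * q) powr (-s)"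
      using x q s by (intro powr_mono2') (auto simp del: of_nat_add of_nat_mult)
    also have "\<dots> = real l powr (-s) * real q powr (-s)" by (simp add: powr_mult)
    finally have "real m powr (-s) * real (m + l * q) powr (-s) \<le> real m powr (-s) * (real l powr (-s) * real q powr (-s))"
      by (intro mult_left_mono) auto
    thus ?thesis by (simp add: x mult.assoc)
  qed
  have "(\<lambda>x. norm ((?f \<circ> (\<lambda>(m, l). (m, m + l * q))) x)) summable_on ({0<..} \<times> {0<..})"
    by (rule abs_summable_comparison[OF has_sum_imp_summable[OF prod']])
       (use le in \<open>auto simp: case_prod_unfold\<close>)
  hence smc: "(?f \<circ> (\<lambda>(m, l). (m, m + l * q))) summable_on ({0<..} \<times> {0<..})"
    by (rule abs_summable_summable)
  define V where "V = infsum (?f \<circ> (\<lambda>(m, l). (m, m + l * q))) ({0<..} \<times> {0<..})"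
  have V: "((?f \<circ> (\<lambda>(m, l). (m, m + l * q))) has_sum V) ({0<..} \<times> {0<..})"
    unfolding V_def using smc by (rule has_sum_infsum)
  have VW: "V \<le> W * W * real q powr (-s)" by (rule has_sum_mono[OF V prod']) (rule le)
  have h1: "(?f has_sum V) O1"
    using V unfolding O1_def has_sum_reindex[OF inj] .
  have h2: "(?f has_sum V) (prod.swap ` O1)"
  proof -
    have "?f \<circ> prod.swap = ?f" by (auto simp: fun_eq_iff)
    thus ?thesis using h1 by (subst has_sum_reindex) (auto intro: inj_onI)
  qed
  have "(?f has_sum (V + V)) (O1 \<union> prod.swap ` O1)"
    by (rule has_sum_Un_disjoint[OF h1 h2]) (use q in \<open>auto simp: O1_def\<close>)
  also have "O1 \<union> prod.swap ` O1 = {(m, n). m > 0 \<and> n > 0 \<and> m \<noteq> n \<and> [m = n] (mod q)}"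
  proof (intro equalityI subsetI)
    fix x assume "x \<in> O1 \<union> prod.swap ` O1"
    thus "x \<in> {(m, n). m > 0 \<and> n > 0 \<and> m \<noteq> n \<and> [m = n] (mod q)}"
      using q by (auto simp: O1_def cong_def)
  next
    fix x assume "x \<in> {(m, n). m > 0 \<and> n > 0 \<and> m \<noteq> n \<and> [m = n] (mod q)}"
    then obtain m n where x: "x = (m, n)" "m > 0" "n > 0" "m \<noteq> n" "[m = n] (mod q)" by auto
    have mem: "(a, b) \<in> O1" if ab: "a > 0" "a < b" "[a = b] (mod q)" for a b
    proof -
      have "q dvd b - a" using ab mod_eq_dvd_iff_nat[of a b q] by (simp add: cong_def)
      then obtain l where l: "b - a = q * l" by (elim dvdE)
      hence "b = a + l * q" "l > 0" using ab by (auto simp: mult.commute intro!: Nat.gr0I)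
      thus ?thesis using ab unfolding O1_def by (intro image_eqI[of _ _ "(a, l)"]) auto
    qed
    consider "m < n" | "n < m" using x by linarith
    thus "x \<in> O1 \<union> prod.swap ` O1"
    proof cases
      case 1
      thus ?thesis using mem[of m n] x by auto
    next
      case 2
      have "(n, m) \<in> O1" using mem[of n m] x 2 by (auto simp: cong_sym_eq)
      thus ?thesis unfolding x by (auto intro!: image_eqI[of _ _ "(n, m)"])
    qed
  qed
  finally show ?thesis using VW by (intro exI[of _ "V + V"]) (auto simp: power2_eq_square)
qed

text \<open>Pairs with m = n satisfy the congruence trivially and form the diagonal; the other
  congruent pairs are at distance at least \<open>q\<close>, which makes their total small.\<close>

theorem second_moment_dcharacter:
  fixes d :: "nat \<Rightarrow> real"
  assumes q: "q > 0" and s: "s > 1" and d: "\<And>n. n > 0 \<Longrightarrow> \<bar>d n\<bar> \<le> K * real n powr (-s)"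
  defines "W \<equiv> \<Sum>\<^sub>\<infinity>n\<in>{0<..}. real n powr (-s)"
  shows "\<bar>(\<Sum>chi | dcharacter q chi. (norm (\<Sum>\<^sub>\<infinity>n\<in>{0<..}. of_real (d n) * chi n))\<^sup>2)
           - real (totient q) * (\<Sum>\<^sub>\<infinity>n\<in>{0<..}. if coprime n q then d n ^ 2 else 0)\<bar>
         \<le> real (totient q) * (2 * K ^ 2 * W ^ 2 * real q powr (-s))"
proof -
  let ?X = "{0<..} \<times> {0::nat<..}"
  define Y where "Y = {(m, n). m > 0 \<and> n > 0 \<and> m \<noteq> (n::nat)}"
  define S where "S = (\<Sum>chi | dcharacter q chi. (norm (\<Sum>\<^sub>\<infinity>n\<in>{0<..}. of_real (d n) * chi n))\<^sup>2)"
  define g where "g = (\<lambda>(m, n). real (totient q) * (if coprime n q \<and> [m = n] (mod q) then d m * d n else 0))"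
  have "(\<lambda>n. norm (\<bar>d n\<bar>)) summable_on {0<..}"
    by (rule abs_summable_comparison[OF summable_on_cmult_right[OF summable_on_nat_powr[OF s], where c = K]])
       (use d in auto)
  hence ds: "(\<lambda>n. \<bar>d n\<bar>) summable_on {0<..}" by (rule abs_summable_summable)
  have S: "(g has_sum S) ?X" unfolding g_def S_def by (rule sum_norm_sq_dcharacter[OF q ds])
  have inj: "inj_on (\<lambda>n. (n, n)) {0::nat<..}" by (auto intro: inj_onI)
  define Dg where "Dg = (\<lambda>n. (n, n)) ` {0::nat<..}"
  have X: "?X = Dg \<union> Y" "Dg \<inter> Y = {}" by (auto simp: Dg_def Y_def)
  have smD: "g summable_on Dg" by (rule summable_on_subset_banach[OF has_sum_imp_summable[OF S]]) (use X in auto)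
  have smY: "g summable_on Y" by (rule summable_on_subset_banach[OF has_sum_imp_summable[OF S]]) (use X in auto)
  have "S = infsum g Dg + infsum g Y"
    using infsum_Un_disjoint[OF smD smY X(2)] infsumI[OF S] X(1) by simp
  moreover have "infsum g Dg = real (totient q) * (\<Sum>\<^sub>\<infinity>n\<in>{0<..}. if coprime n q then d n ^ 2 else 0)"
  proof -
    have "infsum g Dg = infsum (g \<circ> (\<lambda>n. (n, n))) {0<..}" unfolding Dg_def by (rule infsum_reindex[OF inj])
    also have "\<dots> = (\<Sum>\<^sub>\<infinity>n\<in>{0<..}. real (totient q) * (if coprime n q then d n ^ 2 else 0))"
      by (rule infsum_cong) (simp add: g_def power2_eq_square)
    finally show ?thesis by (simp add: infsum_cmult_right')
  qed
  moreover have "norm (infsum g Y) \<le> real (totient q) * (2 * K ^ 2 * W ^ 2 * real q powr (-s))"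
  proof -
    let ?f = "\<lambda>(m, n). real m powr (-s) * real n powr (-s)"
    obtain V where V: "V \<le> 2 * W ^ 2 * real q powr (-s)"
      "(?f has_sum V) {(m, n). m > 0 \<and> n > 0 \<and> m \<noteq> n \<and> [m = n] (mod q)}"
      using off_diagonal_bound[OF q s] unfolding W_def by blast
    \<comment> \<open>Pairs that are not congruent contribute 0, so the majorant is extended by 0 to
      all of \<open>Y\<close>.\<close>
    define G where "G = (\<lambda>(m, n). if [m = n] (mod q) then real m powr (-s) * real n powr (-s) else 0)"
    have "(G has_sum V) Y"
      using V(2) by (rule has_sum_cong_neutral[THEN iffD1, rotated -1]) (auto simp: Y_def G_def split: if_splits)
    hence "((\<lambda>x. real (totient q) * K ^ 2 * G x) has_sum (real (totient q) * K ^ 2 * V)) Y"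
      by (rule has_sum_cmult_right)
    hence "norm (infsum g Y) \<le> real (totient q) * K ^ 2 * V"
    proof (rule norm_infsum_le[OF has_sum_infsum[OF smY]])
      fix x assume "x \<in> Y"
      then obtain m n where x: "x = (m, n)" "m > 0" "n > 0" by (auto simp: Y_def)
      have "\<bar>d m\<bar> * \<bar>d n\<bar> \<le> (K * real m powr (-s)) * (K * real n powr (-s))"
        using d[OF x(2)] d[OF x(3)] by (intro mult_mono) (auto intro: order_trans[OF abs_ge_zero])
      hence le: "real (totient q) * (\<bar>d m\<bar> * \<bar>d n\<bar>) \<le> real (totient q) * ((K * real m powr (-s)) * (K * real n powr (-s)))"
        by (intro mult_left_mono) auto
      show "norm (g x) \<le> real (totient q) * K ^ 2 * G x"
      proof (cases "[m = n] (mod q)")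
        case True
        have "norm (g x) \<le> real (totient q) * (\<bar>d m\<bar> * \<bar>d n\<bar>)"
          by (simp add: g_def x abs_mult)
        also note le
        also have "real (totient q) * ((K * real m powr (-s)) * (K * real n powr (-s))) = real (totient q) * K ^ 2 * G x"
          using True by (simp add: G_def x power2_eq_square mult_ac)
        finally show ?thesis .
      qed (simp add: g_def G_def x)
    qed
    also have "\<dots> \<le> real (totient q) * K ^ 2 * (2 * W ^ 2 * real q powr (-s))"
      using V(1) by (intro mult_left_mono) auto
    finally show ?thesis by (simp add: mult_ac)
  qed
  ultimately show ?thesis unfolding S_def [symmetric] by simp
qed

text \<open>The lower-tail bound with z = 1 - eta gains n^(-eta). Half of this pays for the
  coefficient bound n^(eta/2), and the other half makes the series absolutely convergent, at the
  cost of \<open>(1 / (1 - eta)) ^ J\<close>.\<close>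

lemma approx_coeff_bound:
  assumes eta: "0 < eta" "eta < 1"
  shows "\<exists>C>0. \<forall>J n. n > 0 \<longrightarrow> \<bar>approx_coeff k J n\<bar> \<le> C * (1 / (1 - eta)) ^ J * real n powr (-(1 + eta / 2))"
proof -
  obtain C where C: "C > 0" "\<And>n. n > 0 \<Longrightarrow> \<bar>zeta_inv_coeff k n\<bar> \<le> C * real n powr (eta / 2)"
    using zeta_inv_coeff_bound[of "eta / 2" k] eta by auto
  have "\<bar>approx_coeff k J n\<bar> \<le> C * (1 / (1 - eta)) ^ J * real n powr (-(1 + eta / 2))" if n: "n > 0" for J n
  proof -
    have "\<bar>approx_coeff k J n\<bar> = \<bar>zeta_inv_coeff k n\<bar> * poisson_weight J n / real n"
      using poisson_weight_nonneg[of J n] by (simp add: approx_coeff_def abs_mult)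
    also have "\<dots> \<le> (C * real n powr (eta / 2)) * ((1 / (1 - eta)) ^ J * real n powr ((1 - eta) - 1)) / real n"
      using eta C(1) poisson_weight_nonneg[of J n]
      by (intro divide_right_mono mult_mono C(2)[OF n] poisson_weight_le[OF n]) auto
    also have "\<dots> = C * (1 / (1 - eta)) ^ J * (real n powr (eta / 2) * real n powr (-eta) * real n powr (-1))"
      using n by (simp add: powr_minus_divide)
    also have "real n powr (eta / 2) * real n powr (-eta) * real n powr (-1) = real n powr (eta / 2 + -eta + -1)"
      by (simp only: powr_add)
    also have "eta / 2 + -eta + -1 = -(1 + eta / 2)" by (simp add: field_simps)
    finally show ?thesis .
  qed
  thus ?thesis using C(1) by blast
qed

text \<open>The upper-tail bound with z = 3/2 gives 1 - w at most (2/3)^J n^(1/2), and the loss of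
  n^(1/2) still leaves the summable exponent -3/2. Restricting the sum to \<open>n\<close> coprime
  to \<open>q\<close> only omits terms, so \<open>D\<close> is uniform in \<open>q\<close>.\<close>

lemma diagonal_error:
  "\<exists>D\<ge>0. \<forall>q J. \<bar>(\<Sum>\<^sub>\<infinity>n\<in>{0<..}. if coprime n q then approx_coeff k J n ^ 2 else 0) - coprime_mass k q\<bar> \<le> D * (2 / 3) ^ J"
proof -
  define B where "B = (\<Sum>\<^sub>\<infinity>n\<in>{0<..}. zeta_inv_coeff k n ^ 2 * real n powr (-(3/2)))"
  have smB: "(\<lambda>n. zeta_inv_coeff k n ^ 2 * real n powr (-(3/2))) summable_on {0<..}"
    by (rule summable_on_zeta_inv_coeff_sq) simp
  have "\<bar>(\<Sum>\<^sub>\<infinity>n\<in>{0<..}. if coprime n q then approx_coeff k J n ^ 2 else 0) - coprime_mass k q\<bar> \<le> (2 * B) * (2 / 3) ^ J" for q J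
  proof -
    let ?a = "\<lambda>n. if coprime n q then zeta_inv_coeff k n ^ 2 / real n ^ 2 else 0"
    let ?b = "\<lambda>n. if coprime n q then approx_coeff k J n ^ 2 else 0"
    have smb: "?b summable_on {0<..}"
    proof -
      have "(\<lambda>n. norm (?b n)) summable_on {0<..}"
      proof (rule abs_summable_comparison[OF summable_on_coprime_mass[of q k]])
        fix n :: nat assume n: "n \<in> {0<..}"
        have "poisson_weight J n ^ 2 \<le> 1"
          using poisson_weight_nonneg[of J n] poisson_weight_le_1[of n J] n by (intro power_le_one) auto
        hence "zeta_inv_coeff k n ^ 2 * poisson_weight J n ^ 2 / real n ^ 2 \<le> zeta_inv_coeff k n ^ 2 * 1 / real n ^ 2"
          by (intro divide_right_mono mult_left_mono) auto
        thus "norm (?b n) \<le> ?a n" by (simp add: approx_coeff_def power_mult_distrib power_divide)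
      qed
      thus ?thesis by (rule abs_summable_summable)
    qed
    have hs: "((\<lambda>n. ?b n + - ?a n) has_sum ((\<Sum>\<^sub>\<infinity>n\<in>{0<..}. ?b n) + - coprime_mass k q)) {0<..}"
      unfolding coprime_mass_def
      by (intro has_sum_add has_sum_uminusI has_sum_infsum smb summable_on_coprime_mass)
    have "norm ((\<Sum>\<^sub>\<infinity>n\<in>{0<..}. ?b n) + - coprime_mass k q) \<le> 2 * (2 / 3) ^ J * B"
    proof (rule norm_infsum_le[OF hs])
      show "((\<lambda>n. 2 * (2 / 3) ^ J * (zeta_inv_coeff k n ^ 2 * real n powr (-(3/2)))) has_sum (2 * (2 / 3) ^ J * B)) {0<..}"
        unfolding B_def by (intro has_sum_cmult_right has_sum_infsum smB)
      fix n :: nat assume "n \<in> {0<..}"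
      hence n: "n > 0" by simp
      define w where "w = poisson_weight J n"
      have w: "0 \<le> w" "w \<le> 1" unfolding w_def using poisson_weight_nonneg poisson_weight_le_1[OF n] by auto
      have w1: "1 - w \<le> (2 / 3) ^ J * real n powr (1 / 2)"
        using poisson_weight_ge[OF n, of "3/2" J] by (simp add: w_def)
      have "1 - w ^ 2 = (1 - w) * (1 + w)" by (simp add: power2_eq_square algebra_simps)
      also have "\<dots> \<le> (1 - w) * 2" using w by (intro mult_left_mono) auto
      finally have w2: "1 - w ^ 2 \<le> 2 * ((2 / 3) ^ J * real n powr (1 / 2))" using w1 by simp
      have w3: "w ^ 2 \<le> 1" using w by (intro power_le_one)
      have "zeta_inv_coeff k n ^ 2 / real n ^ 2 * (1 - w ^ 2) \<le> zeta_inv_coeff k n ^ 2 / real n ^ 2 * (2 * ((2 / 3) ^ J * real n powr (1 / 2)))"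
        using w2 by (intro mult_left_mono) auto
      also have "\<dots> = 2 * (2 / 3) ^ J * (zeta_inv_coeff k n ^ 2 * (real n powr (1 / 2) * real n powr (-2)))"
      proof -
        have "real n powr (-2) = 1 / real n ^ 2" using n by (simp add: powr_minus_divide)
        thus ?thesis by (simp only:) (simp add: mult_ac)
      qed
      also have "real n powr (1 / 2) * real n powr (-2) = real n powr (-(3/2))"
        by (simp add: powr_add [symmetric])
      finally have main: "zeta_inv_coeff k n ^ 2 / real n ^ 2 * (1 - w ^ 2) \<le> 2 * (2 / 3) ^ J * (zeta_inv_coeff k n ^ 2 * real n powr (-(3/2)))" .
      show "norm (?b n + - ?a n) \<le> 2 * (2 / 3) ^ J * (zeta_inv_coeff k n ^ 2 * real n powr (-(3/2)))"
      proof (cases "coprime n q")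
        case True
        have "?b n + - ?a n = - (zeta_inv_coeff k n ^ 2 / real n ^ 2 * (1 - w ^ 2))"
          using True by (simp add: approx_coeff_def w_def power_mult_distrib power_divide algebra_simps diff_divide_distrib)
        moreover have "zeta_inv_coeff k n ^ 2 / real n ^ 2 * (1 - w ^ 2) \<ge> 0" using w3 by simp
        ultimately show ?thesis using main by simp
      qed simp
    qed
    thus ?thesis by (simp add: mult_ac)
  qed
  moreover have "2 * B \<ge> 0" unfolding B_def by (intro mult_nonneg_nonneg infsum_nonneg) auto
  ultimately show ?thesis by blast
qed

text \<open>Rounding the exponent up is free for a base at most 1 and costs one factor
  \<open>x\<close> otherwise.\<close>

lemma ceiling_power_bounds:
  fixes A x :: real and q :: nat
  assumes q: "q \<ge> 1" and A: "A \<ge> 0"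
  shows "0 < x \<Longrightarrow> x \<le> 1 \<Longrightarrow> x ^ nat \<lceil>A * ln (real q)\<rceil> \<le> real q powr (A * ln x)"
    and "x \<ge> 1 \<Longrightarrow> x ^ nat \<lceil>A * ln (real q)\<rceil> \<le> x * real q powr (A * ln x)"
proof -
  define J where "J = nat \<lceil>A * ln (real q)\<rceil>"
  have nn: "A * ln (real q) \<ge> 0" using q A by simp
  hence J: "A * ln (real q) \<le> real J" "real J \<le> A * ln (real q) + 1" unfolding J_def by linarith+
  have eq: "x powr (A * ln (real q)) = real q powr (A * ln x)" if "x > 0"
    using that q by (simp add: powr_def mult_ac)
  {
    assume x: "0 < x" "x \<le> 1"
    have "x ^ J = x powr real J" using x by (simp add: powr_realpow)
    also have "\<dots> \<le> x powr (A * ln (real q))" using J x by (intro powr_mono') auto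
    finally show "x ^ nat \<lceil>A * ln (real q)\<rceil> \<le> real q powr (A * ln x)" using eq x by (simp add: J_def)
  }
  {
    assume x: "x \<ge> 1"
    have "x ^ J = x powr real J" using x by (simp add: powr_realpow)
    also have "\<dots> \<le> x powr (A * ln (real q) + 1)" using J x by (intro powr_mono) auto
    finally show "x ^ nat \<lceil>A * ln (real q)\<rceil> \<le> x * real q powr (A * ln x)"
      using eq x by (simp add: J_def powr_add mult.commute)
  }
qed

text \<open>The right-hand side avoids \<open>norm a\<close>: in the application \<open>b\<close> is
  the truncated series, the quantity with a direct bound.\<close>

lemma abs_norm_sq_diff_le:
  fixes a b :: complex
  shows "\<bar>(norm a)\<^sup>2 - (norm b)\<^sup>2\<bar> \<le> norm (a - b) * (2 * norm b + norm (a - b))"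
proof -
  have 1: "\<bar>norm a - norm b\<bar> \<le> norm (a - b)" by (rule norm_triangle_ineq3)
  have "\<bar>(norm a)\<^sup>2 - (norm b)\<^sup>2\<bar> = \<bar>norm a - norm b\<bar> * (norm a + norm b)"
    by (simp add: power2_eq_square square_diff_square_factored abs_mult mult.commute)
  also have "\<dots> \<le> norm (a - b) * (2 * norm b + norm (a - b))"
    using 1 by (intro mult_mono) auto
  finally show ?thesis .
qed

theorem theorem5p5:
  fixes k :: nat and eps :: real
  assumes "GRH" and "k > 0" and "eps > 0"
  shows "\<exists>C. \<forall>q::nat. q \<ge> 2 \<longrightarrow>
     \<bar>(\<Sum>chi\<in>{chi. dcharacter q chi \<and> chi \<noteq> principal_char q}.
          1 / cmod (dirichlet_L q chi 1) ^ (2 * k))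
      - C_const k * real (totient q) / (\<Prod>p\<in>prime_factors q. local_factor k p)\<bar>
     \<le> C * (C_const k * real (totient q) / (\<Prod>p\<in>prime_factors q. local_factor k p))
          * real q powr (-1 + eps)"
proof -
  obtain M where M: "M > 0" "\<And>q chi J. q > 0 \<Longrightarrow> dcharacter q chi \<Longrightarrow> chi \<noteq> principal_char q \<Longrightarrow>
      norm (inverse (L_cont chi 1) ^ k - (\<Sum>\<^sub>\<infinity>n\<in>{0<..}. of_real (approx_coeff k J n) * chi n))
        \<le> M * real q ^ (10 * k) * (4 / 5) ^ J"
    using inverse_dirichlet_L_approx[OF \<open>GRH\<close>, of k] by blast
  \<comment> \<open>With J the ceiling of A ln q, this makes (4/5)^J at most q^(-10k-1), which
    absorbs the factor q^(10k) of the approximation and leaves 1/q.\<close>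
  define A where "A = (10 * real k + 1) / ln (5 / 4)"
  have l54: "ln (5 / 4 :: real) > 0" by simp
  have A: "A > 0" unfolding A_def using l54 by (intro divide_pos_pos) auto
  have A54: "A * ln (5 / 4) = 10 * real k + 1" using l54 by (simp add: A_def)
  \<comment> \<open>As 3/2 exceeds 5/4, the same \<open>A\<close> makes the diagonal factor (2/3)^J
    at most 1/q.\<close>
  have "A * ln (5 / 4) \<le> A * ln (3 / 2)" using A by (intro mult_left_mono) auto
  hence A32: "A * ln (3 / 2) \<ge> 1" using A54 by simp
  \<comment> \<open>Chosen after \<open>A\<close>, so that (1/z)^J grows only like
    q^(eps/4).\<close>
  define z where "z = exp (- (eps / (4 * A)))"
  define eta where "eta = 1 - z"
  have z: "0 < z" "z < 1" using A \<open>eps > 0\<close> by (auto simp: z_def)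
  hence eta: "0 < eta" "eta < 1" by (auto simp: eta_def)
  have Az: "A * ln (1 / z) = eps / 4" using A by (simp add: z_def ln_div)
  obtain C where C: "C > 0" "\<And>J n. n > 0 \<Longrightarrow> \<bar>approx_coeff k J n\<bar> \<le> C * (1 / (1 - eta)) ^ J * real n powr (-(1 + eta / 2))"
    using approx_coeff_bound[OF eta, of k] by blast
  define s where "s = 1 + eta / 2"
  have s: "s > 1" using eta by (simp add: s_def)
  define W where "W = (\<Sum>\<^sub>\<infinity>n\<in>{0<..}. real n powr (-s))"
  have W0: "W \<ge> 0" unfolding W_def by (intro infsum_nonneg) auto
  obtain D where D: "D \<ge> 0" "\<And>q J. \<bar>(\<Sum>\<^sub>\<infinity>n\<in>{0<..}. if coprime n q then approx_coeff k J n ^ 2 else 0) - coprime_mass k q\<bar> \<le> D * (2 / 3) ^ J"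
    using diagonal_error[of k] by blast
  obtain c where c: "c > 0" "\<And>q. q > 0 \<Longrightarrow> c * real q powr (1 - eps / 2) \<le> real (totient q)"
    using totient_lower_bound[of "eps / 2"] \<open>eps > 0\<close> by auto
  \<comment> \<open>The extra 1/z pays for rounding J up to an integer.\<close>
  define C1 where "C1 = C / z"
  have C1: "C1 > 0" unfolding C1_def using C z by simp
  \<comment> \<open>The four summands come from the approximation error, the added principal
    character, the off-diagonal terms and the truncation of the diagonal.\<close>
  define Ctot where "Ctot = M * (2 * (C1 * W) + M) + (C1 * W) ^ 2 / c + 2 * C1 ^ 2 * W ^ 2 + D"
  have Ctot0: "Ctot \<ge> 0" unfolding Ctot_def using M(1) C1 W0 c(1) D(1) by (intro add_nonneg_nonneg mult_nonneg_nonneg divide_nonneg_nonneg) auto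
  have main: "\<bar>(\<Sum>chi\<in>{chi. dcharacter q chi \<and> chi \<noteq> principal_char q}. 1 / cmod (dirichlet_L q chi 1) ^ (2 * k))
                - real (totient q) * coprime_mass k q\<bar> \<le> Ctot * real (totient q) * real q powr (-1 + eps)"
    if q2: "q \<ge> 2" for q :: nat
  proof -
    have q: "q > 0" and q1: "real q \<ge> 1" using q2 by auto
    define J where "J = nat \<lceil>A * ln (real q)\<rceil>"
    define X where "X = {chi. dcharacter q chi \<and> chi \<noteq> principal_char q}"
    define P where "P chi = (\<Sum>\<^sub>\<infinity>n\<in>{0<..}. of_real (approx_coeff k J n) * chi n)" for chi :: "nat \<Rightarrow> complex"
    define E where "E = real q powr (-1 + eps)"
    define phi where "phi = real (totient q)"
    have phi0: "phi \<ge> 0" by (simp add: phi_def)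
    define K where "K = C1 * real q powr (eps / 4)"
    have K0: "K > 0" unfolding K_def using C1 q by simp
    have fin: "finite {chi. dcharacter q chi}" by (rule finite_dcharacter[OF q])
    have XU: "{chi. dcharacter q chi} = insert (principal_char q) X" "principal_char q \<notin> X"
      using dcharacter_principal[OF q] by (auto simp: X_def)
    have finX: "finite X" using fin XU by (metis finite_insert)
    have cardX: "real (card X) \<le> phi"
      using card_mono[OF fin, of X] card_dcharacter[OF q] unfolding phi_def X_def by (simp add: Collect_mono_iff)
    have dK: "\<bar>approx_coeff k J n\<bar> \<le> K * real n powr (-s)" if n: "n > 0" for n
    proof -
      have "(1 / z) ^ J \<le> (1 / z) * real q powr (A * ln (1 / z))"
        unfolding J_def using z q2 A by (intro ceiling_power_bounds(2)) auto
      hence "C * (1 / z) ^ J \<le> C * ((1 / z) * real q powr (eps / 4))"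
        unfolding Az using C(1) by (intro mult_left_mono) auto
      also have "\<dots> = K" by (simp add: K_def C1_def)
      finally have "C * (1 / z) ^ J * real n powr (-s) \<le> K * real n powr (-s)"
        by (intro mult_right_mono) auto
      thus ?thesis using C(2)[OF n, of J] by (simp add: eta_def s_def)
    qed
    have PK: "norm (P chi) \<le> K * W" if chi: "dcharacter q chi" for chi
    proof -
      have le: "norm (of_real (approx_coeff k J n) * chi n) \<le> K * real n powr (-s)" if "n \<in> {0<..}" for n
      proof -
        have "\<bar>approx_coeff k J n\<bar> * norm (chi n) \<le> (K * real n powr (-s)) * 1"
          using dK[of n] that K0 by (intro mult_mono norm_dcharacter_le[OF chi q]) auto
        thus ?thesis by (simp add: norm_mult)
      qed
      have hs: "((\<lambda>n. K * real n powr (-s)) has_sum (K * W)) {0<..}"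
        unfolding W_def by (intro has_sum_cmult_right has_sum_infsum summable_on_nat_powr s)
      have "(\<lambda>n. norm (of_real (approx_coeff k J n) * chi n)) summable_on {0<..}"
        by (rule abs_summable_comparison[OF has_sum_imp_summable[OF hs]]) (rule le)
      hence "((\<lambda>n. of_real (approx_coeff k J n) * chi n) has_sum P chi) {0<..}"
        unfolding P_def by (rule has_sum_infsum[OF abs_summable_summable])
      thus ?thesis by (rule norm_infsum_le[OF _ hs]) (rule le)
    qed
    have powq: "real q powr x \<le> real q powr y" if "x \<le> y" for x y using that q1 by (intro powr_mono) auto
    have Eval: "\<bar>1 / cmod (dirichlet_L q chi 1) ^ (2 * k) - (norm (P chi))\<^sup>2\<bar> \<le> M * (2 * (C1 * W) + M) * E"
      if "chi \<in> X" for chi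
    proof -
      have chi: "dcharacter q chi" "chi \<noteq> principal_char q" using that by (auto simp: X_def)
      define F where "F = inverse (L_cont chi 1) ^ k"
      have eqF: "1 / cmod (dirichlet_L q chi 1) ^ (2 * k) = (norm F)\<^sup>2"
        using L_cont_eq[OF q chi, of 1]
        by (simp add: F_def norm_power norm_inverse norm_divide power_mult [symmetric] mult.commute power_inverse inverse_eq_divide power_one_over)
      have "(4 / 5) ^ J \<le> real q powr (A * ln (4 / 5))"
        unfolding J_def using q2 A by (intro ceiling_power_bounds(1)) auto
      also have "A * ln (4 / 5) = - (10 * real k + 1)"
      proof -
        have "ln (4 / 5 :: real) = - ln (5 / 4)" using ln_inverse[of "5 / 4 :: real"] by simp
        thus ?thesis using A54 by simp
      qed
      finally have J45: "(4 / 5) ^ J \<le> real q powr (- (10 * real k + 1))" .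
      have "norm (F - P chi) \<le> M * real q ^ (10 * k) * (4 / 5) ^ J"
        unfolding F_def P_def by (rule M(2)[OF q chi])
      also have "\<dots> \<le> M * real q ^ (10 * k) * real q powr (- (10 * real k + 1))"
        using J45 M(1) by (intro mult_left_mono) auto
      also have "\<dots> = M * (real q powr (10 * real k) * real q powr (- (10 * real k + 1)))"
        using q powr_realpow[of "real q" "10 * k"] by simp
      also have "real q powr (10 * real k) * real q powr (- (10 * real k + 1)) = real q powr (-1)"
        unfolding powr_add [symmetric] by simp
      finally have err: "norm (F - P chi) \<le> M * real q powr (-1)" .
      \<comment> \<open>A deliberately crude bound of the same order as \<open>K * W\<close>, so
        that the whole second factor below is of order q^(eps/4).\<close>
      have "M * real q powr (-1) \<le> M * real q powr (eps / 4)"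
        using M(1) \<open>eps > 0\<close> by (intro mult_left_mono powq) auto
      hence errM: "norm (F - P chi) \<le> M * real q powr (eps / 4)" using err by linarith
      have "\<bar>(norm F)\<^sup>2 - (norm (P chi))\<^sup>2\<bar> \<le> norm (F - P chi) * (2 * norm (P chi) + norm (F - P chi))"
        by (rule abs_norm_sq_diff_le)
      also have "\<dots> \<le> (M * real q powr (-1)) * (2 * (K * W) + M * real q powr (eps / 4))"
        using err errM PK[OF chi(1)] M(1) by (intro mult_mono add_mono mult_left_mono) auto
      also have "\<dots> = M * (2 * (C1 * W) + M) * (real q powr (-1) * real q powr (eps / 4))"
        by (simp add: K_def algebra_simps)
      also have "real q powr (-1) * real q powr (eps / 4) \<le> E"
        unfolding E_def powr_add [symmetric] using \<open>eps > 0\<close> by (intro powq) auto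
      hence "M * (2 * (C1 * W) + M) * (real q powr (-1) * real q powr (eps / 4)) \<le> M * (2 * (C1 * W) + M) * E"
        using M(1) C1 W0 by (intro mult_left_mono) auto
      finally show ?thesis unfolding eqF .
    qed
    have "\<bar>(\<Sum>chi\<in>X. 1 / cmod (dirichlet_L q chi 1) ^ (2 * k)) - (\<Sum>chi\<in>X. (norm (P chi))\<^sup>2)\<bar>
        \<le> (\<Sum>chi\<in>X. \<bar>1 / cmod (dirichlet_L q chi 1) ^ (2 * k) - (norm (P chi))\<^sup>2\<bar>)"
      unfolding sum_subtractf [symmetric] by (rule sum_abs)
    also have "\<dots> \<le> real (card X) * (M * (2 * (C1 * W) + M) * E)"
      by (rule sum_bounded_above) (rule Eval)
    also have "\<dots> \<le> phi * (M * (2 * (C1 * W) + M) * E)"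
      using cardX M(1) C1 W0 by (intro mult_right_mono) (auto simp: E_def)
    finally have 1: "\<bar>(\<Sum>chi\<in>X. 1 / cmod (dirichlet_L q chi 1) ^ (2 * k)) - (\<Sum>chi\<in>X. (norm (P chi))\<^sup>2)\<bar>
        \<le> phi * (M * (2 * (C1 * W) + M) * E)" .
    have K2: "K ^ 2 = C1 ^ 2 * real q powr (eps / 2)"
      by (simp add: K_def power2_eq_square powr_add [symmetric] mult_ac)
    \<comment> \<open>The square of the trivial bound is of order q^(eps/2), which is absorbed
      because the totient is at least c q^(1 - eps/2).\<close>
    have 2: "(norm (P (principal_char q)))\<^sup>2 \<le> phi * ((C1 * W) ^ 2 / c * E)"
    proof -
      have "(norm (P (principal_char q)))\<^sup>2 \<le> (K * W) ^ 2"
        by (intro power_mono PK dcharacter_principal q) auto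
      also have "\<dots> = (C1 * W) ^ 2 * real q powr (eps / 2)" by (simp add: power_mult_distrib K2)
      also have "real q powr (eps / 2) = real q powr (1 - eps / 2) * E"
        unfolding E_def powr_add [symmetric] by simp
      also have "real q powr (1 - eps / 2) \<le> phi / c"
        using c(2)[OF q] c(1) by (simp add: phi_def field_simps)
      hence "(C1 * W) ^ 2 * (real q powr (1 - eps / 2) * E) \<le> (C1 * W) ^ 2 * (phi / c * E)"
        by (intro mult_left_mono mult_right_mono) (auto simp: E_def)
      finally show ?thesis by (simp add: mult_ac)
    qed
    have 3: "\<bar>(\<Sum>chi | dcharacter q chi. (norm (P chi))\<^sup>2)
           - phi * (\<Sum>\<^sub>\<infinity>n\<in>{0<..}. if coprime n q then approx_coeff k J n ^ 2 else 0)\<bar> \<le> phi * (2 * C1 ^ 2 * W ^ 2 * E)"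
    proof -
      have "\<bar>(\<Sum>chi | dcharacter q chi. (norm (P chi))\<^sup>2)
           - phi * (\<Sum>\<^sub>\<infinity>n\<in>{0<..}. if coprime n q then approx_coeff k J n ^ 2 else 0)\<bar>
         \<le> phi * (2 * K ^ 2 * W ^ 2 * real q powr (-s))"
        unfolding P_def phi_def W_def by (rule second_moment_dcharacter[OF q s dK])
      also have "2 * K ^ 2 * W ^ 2 * real q powr (-s) = 2 * C1 ^ 2 * W ^ 2 * (real q powr (eps / 2) * real q powr (-s))"
        by (simp add: K2)
      also have "phi * (2 * C1 ^ 2 * W ^ 2 * (real q powr (eps / 2) * real q powr (-s))) \<le> phi * (2 * C1 ^ 2 * W ^ 2 * E)"
        unfolding E_def powr_add [symmetric] using s \<open>eps > 0\<close> phi0 by (intro mult_left_mono powq) auto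
      finally show ?thesis .
    qed
    have 4: "\<bar>phi * (\<Sum>\<^sub>\<infinity>n\<in>{0<..}. if coprime n q then approx_coeff k J n ^ 2 else 0) - phi * coprime_mass k q\<bar> \<le> phi * (D * E)"
    proof -
      have "(2 / 3) ^ J \<le> real q powr (A * ln (2 / 3))"
        unfolding J_def using q2 A by (intro ceiling_power_bounds(1)) auto
      also have "\<dots> \<le> E" unfolding E_def
      proof (rule powq)
        have "ln (2 / 3 :: real) = - ln (3 / 2)" using ln_inverse[of "3 / 2 :: real"] by simp
        thus "A * ln (2 / 3) \<le> -1 + eps" using A32 \<open>eps > 0\<close> by simp
      qed
      finally have "D * (2 / 3) ^ J \<le> D * E" using D(1) by (intro mult_left_mono)
      hence "\<bar>(\<Sum>\<^sub>\<infinity>n\<in>{0<..}. if coprime n q then approx_coeff k J n ^ 2 else 0) - coprime_mass k q\<bar> \<le> D * E"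
        using D(2)[of q J] by linarith
      thus ?thesis unfolding right_diff_distrib [symmetric] abs_mult using phi0 by (simp add: mult_left_mono)
    qed
    have "(\<Sum>chi | dcharacter q chi. (norm (P chi))\<^sup>2) = (norm (P (principal_char q)))\<^sup>2 + (\<Sum>chi\<in>X. (norm (P chi))\<^sup>2)"
      unfolding XU(1) using XU(2) finX by simp
    moreover have "(norm (P (principal_char q)))\<^sup>2 \<ge> 0" by simp
    ultimately have "\<bar>(\<Sum>chi\<in>X. 1 / cmod (dirichlet_L q chi 1) ^ (2 * k)) - phi * coprime_mass k q\<bar> \<le>
        phi * (M * (2 * (C1 * W) + M) * E) + phi * ((C1 * W) ^ 2 / c * E) + phi * (2 * C1 ^ 2 * W ^ 2 * E) + phi * (D * E)"
      using 1 2 3 4 by linarith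
    also have "\<dots> = Ctot * phi * E" by (simp add: Ctot_def algebra_simps)
    finally show ?thesis unfolding X_def phi_def E_def .
  qed
  show ?thesis
  proof (intro exI[of _ Ctot] allI impI)
    fix q :: nat assume q2: "q \<ge> 2"
    hence q: "q > 0" by simp
    let ?M = "C_const k * real (totient q) / (\<Prod>p\<in>prime_factors q. local_factor k p)"
    have Meq: "?M = real (totient q) * coprime_mass k q"
      unfolding coprime_mass_eq[OF q] by simp
    \<comment> \<open>Since \<open>coprime_mass k q\<close> is at least 1, an error measured against
      the totient is also one relative to the full main term.\<close>
    have "real (totient q) * 1 \<le> ?M" unfolding Meq using coprime_mass_ge_1 by (intro mult_left_mono) auto
    hence "Ctot * real (totient q) * real q powr (-1 + eps) \<le> Ctot * ?M * real q powr (-1 + eps)"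
      using Ctot0 by (intro mult_right_mono mult_left_mono) auto
    thus "\<bar>(\<Sum>chi\<in>{chi. dcharacter q chi \<and> chi \<noteq> principal_char q}. 1 / cmod (dirichlet_L q chi 1) ^ (2 * k)) - ?M\<bar>
        \<le> Ctot * ?M * real q powr (-1 + eps)"
      using main[OF q2] unfolding Meq by linarith
  qed
qed

end
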